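(* Let $q$ be an odd prime power, let $r>1$ and $n>1$ be integers. Let $\alpha_1,\dots,\alpha_r\in\mathbb{F}_q[x]$ be distinct polynomials with $\max_j \deg\alpha_j<n$, and let $\epsilon_1,\dots,\epsilon_r\in\{1,2\}$, not all equal to $2$. Then \[ \Big|\sum_{F\in M_n}\mu(F+\alpha_1)^{\epsilon_1}\cdots\mu(F+\alpha_r)^{\epsilon_r}\Big|\le 2rn\,q^{n-\frac12}+3rn^2q^{n-1}. \]
   Context: $\mathbb{F}_q$ is the finite field with $q$ elements and $M_n\subset\mathbb{F}_q[x]$ is the set of monic polynomials of degree $n$ (so $\#M_n=q^n$). The Möbius function of a nonzero $F\in\mathbb{F}_q[x]$ is $\mu(F)=(-1)^s$ if $F=cP_1\cdots P_s$ with $0\ne c\in\mathbb{F}_q$ and $P_1,\dots,P_s$ distinct monic irreducible polynomials, and $\mu(F)=0$ otherwise. *)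

theory Defs
  imports Complex_Main "HOL-Library.Cardinality" "HOL-Computational_Algebra.Computational_Algebra"
begin

definition monic_polys :: "nat \<Rightarrow> 'a::field poly set" where
  "monic_polys n = {F. lead_coeff F = 1 \<and> degree F = n}"

text \<open>
  A finite set \<open>S\<close> of polynomials encodes distinct monic irreducible factors \<open>P\<^sub>1, \<dots>, P\<^sub>s\<close>,
  with \<open>s = card S\<close>; the case \<open>S = {}\<close> covers nonzero constants.
\<close>

definition distinct_factorization :: "'a::field poly \<Rightarrow> 'a poly set \<Rightarrow> bool" where
  "distinct_factorization F S \<longleftrightarrow>
     finite S \<and> (\<forall>P\<in>S. lead_coeff P = 1 \<and> irreducible P) \<and> (\<exists>c. c \<noteq> 0 \<and> F = smult c (\<Prod>S))"

text \<open>
  The value at \<open>0\<close>, which the usual definition leaves open, is \<open>0\<close> here.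
\<close>

definition poly_moebius :: "'a::field poly \<Rightarrow> int" where
  "poly_moebius F =
     (if \<exists>S. distinct_factorization F S then (- 1) ^ card (THE S. distinct_factorization F S) else 0)"

lemma distinct_factorization_eq:
  fixes F :: "'a::field poly"
  assumes "distinct_factorization F S"
  shows "S = {P. lead_coeff P = 1 \<and> irreducible P \<and> P dvd F}"
proof -
  from assms obtain c where fin: "finite S"
    and irr: "\<And>P. P \<in> S \<Longrightarrow> lead_coeff P = 1 \<and> irreducible P"
    and c: "c \<noteq> 0" "F = smult c (\<Prod>S)"
    unfolding distinct_factorization_def by blast
  show ?thesis
  proof (intro equalityI subsetI)
    fix P assume "P \<in> S"
    then show "P \<in> {P. lead_coeff P = 1 \<and> irreducible P \<and> P dvd F}"
      using irr c fin dvd_prodI[of S P "\<lambda>x. x"] by (auto intro: dvd_smult)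
  next
    fix P assume "P \<in> {P. lead_coeff P = 1 \<and> irreducible P \<and> P dvd F}"
    then have P: "lead_coeff P = 1" "irreducible P" "P dvd F" by auto
    have prime: "prime_elem P" using P(2) by (rule field_poly_irreducible_imp_prime)
    have "P dvd \<Prod>S" using P(3) c by (simp add: dvd_smult_iff)
    then obtain Q where Q: "Q \<in> S" "P dvd Q"
      using prime_elem_dvd_prod_msetE[OF prime, of "mset_set S"] fin
      by (auto simp: prod_unfold_prod_mset)
    have "Q dvd P"
      using irreducibleD'[of Q P] irr[OF Q(1)] Q(2) irreducible_not_unit[OF P(2)] by argo
    obtain k where k: "Q = P * k" using Q(2) by (elim dvdE)
    have "P \<noteq> 0" using P(2) by auto
    then have "is_unit k" using \<open>Q dvd P\<close> dvd_mult_cancel_left[of P k 1] unfolding k by simp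
    then obtain a where a: "k = [:a:]" by (auto simp: is_unit_poly_iff)
    have "a = 1" using irr[OF Q(1)] P(1) unfolding k a by (simp split: if_splits)
    then have "P = Q" by (simp add: k a)
    with Q(1) show "P \<in> S" by simp
  qed
qed

lemma poly_moebius_eqI:
  assumes "distinct_factorization F S"
  shows "poly_moebius F = (- 1) ^ card S"
proof -
  have "(THE T. distinct_factorization F T) = S"
  proof (rule the_equality)
    show "T = S" if "distinct_factorization F T" for T
      using distinct_factorization_eq[OF that] distinct_factorization_eq[OF assms] by (rule trans[OF _ sym])
  qed (fact assms)
  with assms show ?thesis by (auto simp: poly_moebius_def)
qed

lemma poly_moebius_eq_0:
  assumes "\<nexists>S. distinct_factorization F S"
  shows "poly_moebius F = 0"
  using assms by (simp add: poly_moebius_def)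

end

theory Submission
  imports Defs "HOL-Algebra.Algebraic_Closure_Type" "Subresultants.Subresultant_Gcd"
begin

text \<open>
  By Pellet's formula the Moebius function of a monic polynomial \<open>f\<close> of degree \<open>n\<close> is
  \<open>(-1)\<^sup>n\<close> times the quadratic character of the discriminant of \<open>f\<close>. Fix all coefficients of
  \<open>F\<close> except the constant one, \<open>b\<close>. Up to a factor independent of \<open>b\<close>, the discriminant of
  \<open>F + b\<close> is the product of \<open>F(x) + b\<close> over the critical points \<open>x\<close> of \<open>F\<close>. The sum over
  \<open>b\<close> is therefore a character sum of a polynomial of degree at most \<open>r (n - 1)\<close>, and
  Stepanov's method bounds it unless that polynomial is a constant times a square.

  To see that squares are rare, vary the linear coefficient \<open>a\<close> too. With \<open>F = G + a X\<close>, two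
  critical points of the polynomials \<open>F + \<alpha>\<^sub>j\<close> have the same critical value only if a line
  of slope \<open>- a\<close> is tangent to the graphs of the \<open>G + \<alpha>\<^sub>j\<close> at two places. The two equations
  for such a bitangent have no common component, because the Jacobian of the pair is
  \<open>G\<^sub>i''(x) G\<^sub>j''(y) (y - x)\<close>. So only boundedly many slopes are bad as long as no second
  derivative vanishes, and the second derivatives are controlled by the coefficient of \<open>X\<^sup>2\<close>.
\<close>

section \<open>Polynomials over finite fields\<close>

hide_const (open) Polynomials.degree Polynomials.lead_coeff up_ring.coeff up_ring.monom Coset.order
  Divisibility.irreducible Divisibility.prime module.smult

text \<open>The obstacle is small characteristic: derivatives may vanish or have repeated roots, so
  one cannot expect the product of the critical polynomials to be squarefree. The argument asks for
  much less: one index \<open>i\<close> with exponent 1 and one critical point \<open>x\<close> of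
  its polynomial, with nonzero second derivative, whose critical value is taken at no other critical
  point of any polynomial with exponent 1. This gives one simple root, and by parity of
  multiplicities one simple root already excludes a constant times a square. A polynomial with
  exponent 2 merely deletes at most \<open>n - 1\<close> values of \<open>b\<close>.

  The constants arise as follows. Stepanov's method is weaker than the optimal bound for character
  sums and gives \<open>2 * (m + 2)\<close> in front of the square root, where \<open>m\<close> is
  the degree; with \<open>m\<close> at most \<open>r * (n - 1)\<close> and \<open>r\<close> at least
  2 this is at most \<open>2 * r * n\<close>. Eliminating one coordinate from the bitangent
  equations leaves resultants of degree at most \<open>n * (2 * n - 1)\<close>, one for each
  polynomial, and each bad slope is estimated trivially; this is the source of
  \<open>n^2\<close>.\<close>

lemma power_card_eq_same:
  fixes x :: "'a::{field,finite}"
  shows "x ^ CARD('a) = x"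
proof (cases "x = 0")
  case False
  let ?U = "UNIV - {0::'a}"
  have "inj_on ((*) x) ?U" using False by (auto intro: inj_onI)
  moreover have "(*) x ` ?U \<subseteq> ?U" using False by auto
  ultimately have "bij_betw ((*) x) ?U ?U"
    using endo_inj_surj[of ?U "(*) x"] by (simp add: bij_betw_def)
  then have "(\<Prod>y\<in>?U. x * y) = \<Prod>?U"
    by (rule prod.reindex_bij_betw[where g = "\<lambda>y. y"])
  then have "x ^ card ?U * \<Prod>?U = \<Prod>?U" unfolding prod.distrib prod_constant .
  moreover have "\<Prod>?U \<noteq> 0" by (subst prod_zero_iff) auto
  ultimately have "x ^ card ?U = 1" unfolding mult_cancel_right2 by blast
  moreover have "CARD('a) = Suc (card ?U)" by (rule card.remove) auto
  ultimately show ?thesis by (simp only: power_Suc mult_1_right)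
qed (simp add: power_0_left)

text \<open>As \<open>x ^ q = x\<close>, the polynomial \<open>(X + 1)^q - X^q - 1\<close> vanishes
  at all \<open>q\<close> elements, but its degree is below \<open>q\<close>, so its coefficients
  are zero. This way the characteristic never has to be mentioned.\<close>

lemma of_nat_card_choose:
  assumes "0 < i" "i < CARD('a)"
  shows "of_nat (CARD('a) choose i) = (0 :: 'a::{field,finite})"
proof -
  define q where "q = CARD('a)"
  have q: "q > 0" "0 < i" "i < q" using assms by (auto simp: q_def)
  have pq: "x ^ q = x" for x :: 'a unfolding q_def by (rule power_card_eq_same)
  define p :: "'a poly" where "p = (\<Sum>i\<in>{0<..<q}. monom (of_nat (q choose i)) i)"
  have ins: "{..q} = insert 0 (insert q {0<..<q})" using q by auto
  have "poly p x = 0" for x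
  proof -
    have "x + 1 = (x + 1) ^ q" by (rule pq[symmetric])
    also have "\<dots> = (\<Sum>k\<le>q. of_nat (q choose k) * x ^ k)"
      using binomial_ring[of x 1 q] by simp
    also have "\<dots> = 1 + (x ^ q + poly p x)"
      unfolding ins using q by (simp add: p_def poly_sum poly_monom)
    finally show ?thesis unfolding pq by (simp add: add.commute)
  qed
  then have roots: "{x. poly p x = 0} = UNIV" by auto
  have "p = 0"
  proof (rule ccontr)
    assume "p \<noteq> 0"
    then have "q \<le> degree p" using card_poly_roots_bound[of p] unfolding roots q_def by blast
    moreover have "degree p \<le> q - 1" unfolding p_def
    proof (rule degree_sum_le)
      fix k assume "k \<in> {0<..<q}"
      then have "k \<le> q - 1" by auto
      then show "degree (monom (of_nat (q choose k) :: 'a) k) \<le> q - 1"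
        using degree_monom_le order_trans by blast
    qed simp
    ultimately show False using q by linarith
  qed
  then have "coeff p i = 0" by simp
  moreover have "coeff p i = (\<Sum>k\<in>{0<..<q}. if k = i then of_nat (q choose k) else 0)"
    by (simp add: p_def coeff_sum)
  ultimately show ?thesis using q unfolding q_def[symmetric] by simp
qed

text \<open>Stated for a general ring because it is applied both to polynomials and to the algebraic
  closure.\<close>

lemma power_add_of_choose_eq_0:
  fixes x y :: "'b::comm_ring_1"
  assumes "\<And>i. 0 < i \<Longrightarrow> i < q \<Longrightarrow> of_nat (q choose i) = (0::'b)" and "q > 0"
  shows "(x + y) ^ q = x ^ q + y ^ q"
proof -
  have "(x + y) ^ q = (\<Sum>k\<le>q. of_nat (q choose k) * x ^ k * y ^ (q - k))"
    by (rule binomial_ring)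
  also have "{..q} = insert 0 (insert q {0<..<q})" by auto
  also have "(\<Sum>k\<in>insert 0 (insert q {0<..<q}). of_nat (q choose k) * x ^ k * y ^ (q - k)) = y ^ q + (x ^ q + 0)"
    using assms by (simp add: sum.neutral)
  finally show ?thesis by simp
qed

lemma power_card_add_poly:
  fixes f g :: "'a::{field,finite} poly"
  shows "(f + g) ^ CARD('a) = f ^ CARD('a) + g ^ CARD('a)"
  by (rule power_add_of_choose_eq_0) (simp_all add: of_nat_card_choose of_nat_poly)

text \<open>A condition on coefficients rather than on the degree: zero is included for every
  \<open>A\<close>, even \<open>A = 0\<close>, so that these sets are additive groups with exactly
  \<open>q ^ A\<close> elements.\<close>

definition polys_below :: "nat \<Rightarrow> 'a::zero poly set" where
  "polys_below A = {p. \<forall>i\<ge>A. coeff p i = 0}"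

lemma polys_below_0: "polys_below 0 = {0}"
  by (auto simp: polys_below_def poly_eq_iff)

lemma polys_below_Suc: "polys_below (Suc A) = (\<lambda>(a, p). pCons a p) ` (UNIV \<times> polys_below A)"
proof (intro equalityI subsetI)
  fix p :: "'a poly" assume p: "p \<in> polys_below (Suc A)"
  obtain a r where r: "p = pCons a r" by (cases p)
  with p have "r \<in> polys_below A" by (force simp: polys_below_def)
  with r show "p \<in> (\<lambda>(a, p). pCons a p) ` (UNIV \<times> polys_below A)" by force
next
  fix p :: "'a poly" assume "p \<in> (\<lambda>(a, p). pCons a p) ` (UNIV \<times> polys_below A)"
  then show "p \<in> polys_below (Suc A)" by (auto simp: polys_below_def coeff_pCons split: nat.splits)
qed

lemma finite_polys_below: "finite (polys_below A :: 'a::{zero,finite} poly set)"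
  by (induction A) (auto simp: polys_below_0 polys_below_Suc)

lemma card_polys_below: "card (polys_below A :: 'a::{zero,finite} poly set) = CARD('a) ^ A"
proof (induction A)
  case (Suc A)
  have "inj_on (\<lambda>(a, p). pCons a p) (UNIV \<times> polys_below A :: ('a \<times> 'a poly) set)"
    by (auto simp: inj_on_def)
  then show ?case by (simp add: polys_below_Suc card_image card_cartesian_product Suc.IH)
qed (simp add: polys_below_0)

lemma degree_less_polys_below: "p \<in> polys_below A \<Longrightarrow> p \<noteq> 0 \<Longrightarrow> degree p < A"
  unfolding polys_below_def using leading_coeff_0_iff not_le by blast

lemma polys_belowI: "degree p < A \<Longrightarrow> p \<in> polys_below A"
  by (auto simp: polys_below_def coeff_eq_0)

lemma polys_below_diff: "p \<in> polys_below A \<Longrightarrow> r \<in> polys_below A \<Longrightarrow> p - r \<in> polys_below A"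
  for p r :: "'a::ab_group_add poly"
  by (auto simp: polys_below_def)

section \<open>Stepanov's method\<close>

text \<open>
  The coefficient of \<open>Z\<^sup>k\<close> in \<open>p(X + Z)\<close> is the \<open>k\<close>-th Hasse derivative of \<open>p\<close>. Ordinary
  derivatives would lose information beyond order \<open>CHAR('a)\<close>.
\<close>

definition taylor :: "'a::comm_ring_1 poly \<Rightarrow> 'a poly poly" where
  "taylor p = fold_coeffs (\<lambda>a r. [:[:a:]:] + [:[:0, 1:], 1:] * r) p 0"

lemma taylor_0 [simp]: "taylor 0 = 0"
  by (simp add: taylor_def)

lemma taylor_pCons [simp]: "taylor (pCons a p) = [:[:a:]:] + [:[:0, 1:], 1:] * taylor p"
  by (cases "p = 0 \<and> a = 0") (auto simp: taylor_def)

lemma taylor_add: "taylor (p + r) = taylor p + taylor r"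
proof (induction p r rule: poly_induct2)
  case (pCons a p b r)
  have "[:[:a + b:]:] = [:[:a:]:] + [:[:b:]:]" by simp
  with pCons show ?case
    by (simp add: distrib_left add_ac del: mult_pCons_left mult_pCons_right)
qed simp

lemma taylor_smult: "taylor (smult c p) = [:[:c:]:] * taylor p"
proof (induction p)
  case (pCons a p)
  have "[:[:c * a:]:] = [:[:c:]:] * [:[:a:]:]" by simp
  with pCons show ?case
    by (simp only: smult_pCons taylor_pCons distrib_left mult.left_commute)
qed simp

lemma taylor_mult: "taylor (p * r) = taylor p * taylor r"
proof (induction p)
  case (pCons a p)
  have "taylor (pCons a p * r) = [:[:a:]:] * taylor r + [:[:0, 1:], 1:] * taylor (p * r)"
    unfolding mult_pCons_left taylor_add taylor_smult taylor_pCons by simp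
  with pCons show ?case by (simp only: taylor_pCons distrib_right mult.assoc)
qed simp

lemma coeff_coeff_taylor:
  "coeff (coeff (taylor p) k) i = of_nat (i + k choose k) * coeff p (i + k)"
proof (induction p arbitrary: k i)
  case (pCons a p)
  have "coeff (coeff (taylor (pCons a p)) k) i
      = coeff (coeff [:[:a:]:] k) i + coeff (pCons 0 (coeff (taylor p) k)) i
        + coeff (coeff (pCons 0 (taylor p)) k) i" by simp
  then show ?case
    by (cases k; cases i) (auto simp: pCons.IH coeff_pCons algebra_simps)
qed simp

lemma coeff_pcompose_linear: "coeff (pcompose p [:x, 1:]) k = poly (coeff (taylor p) k) x"
proof (induction p arbitrary: k)
  case (pCons a p)
  from pCons.IH[of 0] pCons.IH show ?case
    by (cases k) (auto simp: pcompose_pCons)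
qed simp

lemma linear_power_dvd_of_coeff_pcompose:
  fixes p :: "'a::field poly"
  assumes "\<And>k. k < l \<Longrightarrow> coeff (pcompose p [:x, 1:]) k = 0"
  shows "[:- x, 1:] ^ l dvd p"
proof -
  have "monom 1 l dvd pcompose p [:x, 1:]" using assms by (simp add: monom_1_dvd_iff')
  then obtain s where s: "pcompose p [:x, 1:] = monom 1 l * s" by (elim dvdE)
  have "pcompose [:x, 1:] [:- x, 1:] = [:0, 1:]" by (simp add: pcompose_pCons)
  then have "p = pcompose (pcompose p [:x, 1:]) [:- x, 1:]"
    by (metis pcompose_assoc pcompose_idR)
  also have "\<dots> = pcompose (monom 1 l) [:- x, 1:] * pcompose s [:- x, 1:]"
    unfolding s by (rule pcompose_mult)
  also have "pcompose (monom 1 l) [:- x, 1:] = [:- x, 1:] ^ l"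
    by (simp add: monom_altdef pcompose_hom.hom_power pcompose_pCons)
  finally show ?thesis by (metis dvd_triv_left)
qed

text \<open>By the Leibniz rule a Hasse derivative of order \<open>k\<close> can destroy at most
  \<open>k\<close> of the \<open>M\<close> factors \<open>f\<close>.\<close>

lemma power_dvd_coeff_taylor:
  fixes f :: "'a::comm_ring_1 poly"
  shows "f ^ (M - k) dvd coeff (taylor (f ^ M * r)) k"
proof (induction M arbitrary: k)
  case (Suc M)
  define w where "w = coeff (taylor f)"
  have w0: "w 0 = f" unfolding w_def by (simp add: poly_eq_iff coeff_coeff_taylor)
  have "coeff (taylor (f ^ Suc M * r)) k = coeff (taylor f * taylor (f ^ M * r)) k"
    by (simp add: taylor_mult mult_ac)
  also have "\<dots> = (\<Sum>i\<le>k. w i * coeff (taylor (f ^ M * r)) (k - i))"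
    by (simp add: coeff_mult w_def)
  also have "f ^ (Suc M - k) dvd \<dots>"
  proof (rule dvd_sum)
    fix i assume i: "i \<in> {..k}"
    show "f ^ (Suc M - k) dvd w i * coeff (taylor (f ^ M * r)) (k - i)"
    proof (cases "i = 0")
      case True
      have "f * f ^ (M - k) dvd w i * coeff (taylor (f ^ M * r)) (k - i)"
        using Suc.IH[of k] True w0 by (simp add: mult_dvd_mono)
      moreover have "f ^ (Suc M - k) dvd f * f ^ (M - k)"
        unfolding power_Suc[symmetric] by (rule le_imp_power_dvd) simp
      ultimately show ?thesis by (rule dvd_trans[rotated])
    next
      case False
      then have "f ^ (Suc M - k) dvd f ^ (M - (k - i))" using i by (intro le_imp_power_dvd) auto
      also have "\<dots> dvd w i * coeff (taylor (f ^ M * r)) (k - i)"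
        using Suc.IH[of "k - i"] by (rule dvd_mult)
      finally show ?thesis .
    qed
  qed
  finally show ?case .
qed simp


text \<open>The Hasse derivative of \<open>f ^ M * r\<close> without the power of \<open>f\<close>
  that it must contain; the division is exact. What remains has a degree bound independent of
  \<open>M\<close>, so that the exponents \<open>l\<close> and \<open>l + h\<close> can be treated
  alike.\<close>

definition hasse_quot :: "'a::field poly \<Rightarrow> nat \<Rightarrow> nat \<Rightarrow> 'a poly \<Rightarrow> 'a poly" where
  "hasse_quot f M k r = coeff (taylor (f ^ M * r)) k div f ^ (M - k)"

lemma coeff_taylor_power_mult: "coeff (taylor (f ^ M * r)) k = f ^ (M - k) * hasse_quot f M k r"
  unfolding hasse_quot_def using power_dvd_coeff_taylor[of f M k r] by simp

lemma hasse_quot_diff: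
  assumes "f \<noteq> 0"
  shows "hasse_quot f M k (r - s) = hasse_quot f M k r - hasse_quot f M k s"
proof -
  have "taylor (p - p') = taylor p - taylor p'" for p p' :: "'a poly"
    using taylor_add[of "p - p'" p'] by simp
  then have "f ^ (M - k) * hasse_quot f M k (r - s)
      = f ^ (M - k) * (hasse_quot f M k r - hasse_quot f M k s)"
    by (simp add: coeff_taylor_power_mult[symmetric] right_diff_distrib)
  then show ?thesis using assms by simp
qed

text \<open>Differentiating lowers the degree of \<open>f ^ M * r\<close> by at least
  \<open>k\<close>, and dividing lowers it by \<open>(M - k) * degree f\<close>; the difference to
  \<open>degree r\<close> is at most \<open>k * (degree f - 1)\<close>, whatever \<open>M\<close>
  is.\<close>

lemma hasse_quot_below:
  assumes r: "r \<in> polys_below A" and f: "degree f \<ge> 1" and k: "k \<le> M"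
  shows "hasse_quot f M k r \<in> polys_below (A + k * (degree f - 1))"
proof (cases "hasse_quot f M k r = 0")
  case True
  then show ?thesis by (simp add: polys_below_def)
next
  case False
  let ?h = "hasse_quot f M k r" and ?m = "degree f"
  have "f \<noteq> 0" using f by auto
  let ?c = "coeff (taylor (f ^ M * r)) k"
  have eq: "?c = f ^ (M - k) * ?h" by (rule coeff_taylor_power_mult)
  then have nz: "?c \<noteq> 0" using False \<open>f \<noteq> 0\<close> by simp
  then have "coeff ?c (degree ?c) \<noteq> 0" by simp
  then have "coeff (f ^ M * r) (degree ?c + k) \<noteq> 0" unfolding coeff_coeff_taylor by auto
  then have "degree ?c + k \<le> degree (f ^ M * r)" by (rule le_degree)
  moreover have rnz: "r \<noteq> 0" using nz by auto
  moreover have "degree (f ^ M * r) = M * ?m + degree r"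
    using rnz \<open>f \<noteq> 0\<close> by (simp add: degree_mult_eq degree_power_eq)
  moreover have "degree ?c = (M - k) * ?m + degree ?h"
    unfolding eq using False \<open>f \<noteq> 0\<close> by (simp add: degree_mult_eq degree_power_eq)
  moreover have "degree r < A" using r rnz by (rule degree_less_polys_below)
  moreover have "M * ?m = (M - k) * ?m + k * ?m" using k by (simp add: add_mult_distrib[symmetric])
  moreover have "k * ?m = k * (?m - 1) + k" using f by (simp add: diff_mult_distrib2)
  ultimately have "degree ?h < A + k * (?m - 1)" by linarith
  then show ?thesis by (rule polys_belowI)
qed

text \<open>
  Equivalently, \<open>f\<close> is not a constant times the square of a rational function.
\<close>

definition nonsquare :: "'a::field poly \<Rightarrow> bool" where
  "nonsquare f \<longleftrightarrow> (\<forall>u v c. c \<noteq> 0 \<longrightarrow> u\<^sup>2 * f = smult c (v\<^sup>2) \<longrightarrow> u = 0)"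

text \<open>
  Multiplying by the conjugate turns \<open>f ^ h\<close> into \<open>f ^ CARD('a)\<close>, which is constant modulo
  \<open>monom 1 (CARD('a))\<close>; the degrees are small enough to make the congruence an identity.
\<close>

lemma monom_power_dvd_imp_0:
  fixes f r s :: "'a::{field,finite} poly"
  assumes q: "CARD('a) = 2 * h + 1"
    and nonsq: "nonsquare f"
    and f0: "poly f 0 \<noteq> 0"
    and below: "r \<in> polys_below A" "s \<in> polys_below A"
    and deg: "2 * A + degree f \<le> CARD('a) + 1"
    and dvd: "monom 1 (CARD('a)) dvd r + s * f ^ h"
  shows "r = 0 \<and> s = 0"
proof -
  define q where "q = CARD('a)"
  define c where "c = poly f 0"
  have q2: "q = 2 * h + 1" using q by (simp add: q_def)
  obtain a w where w: "f = pCons a w" by (cases f)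
  have "f = [:c:] + [:0, 1:] * w" by (simp add: w c_def)
  then have "f ^ q = [:c:] ^ q + ([:0, 1:] * w) ^ q"
    unfolding q_def by (metis power_card_add_poly)
  also have "[:c:] ^ q = [:c:]"
    using power_card_eq_same[of c] by (simp add: q_def poly_const_pow)
  also have "([:0, 1:] * w) ^ q = monom 1 q * w ^ q"
    unfolding power_mult_distrib by (simp add: monom_altdef)
  finally have fq: "f ^ q = [:c:] + monom 1 q * w ^ q" .
  define D where "D = r\<^sup>2 * f - smult c (s\<^sup>2)"
  have "f ^ q = f * (f ^ h * f ^ h)" by (simp add: q2 power_add mult_2)
  then have "(r + s * f ^ h) * ((r - s * f ^ h) * f) = r\<^sup>2 * f - s\<^sup>2 * f ^ q"
    by (simp only: power2_eq_square algebra_simps)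
  also have "\<dots> = D - monom 1 q * (s\<^sup>2 * w ^ q)"
    unfolding fq D_def by (simp add: algebra_simps)
  finally have "D = (r + s * f ^ h) * ((r - s * f ^ h) * f) + monom 1 q * (s\<^sup>2 * w ^ q)"
    by (simp add: algebra_simps)
  moreover have "monom 1 q dvd \<dots>"
    unfolding q_def by (rule dvd_add[OF dvd_mult2[OF dvd] dvd_triv_left])
  ultimately have dvdD: "monom 1 q dvd D" by simp
  have "D = 0"
  proof (rule ccontr)
    assume "D \<noteq> 0"
    have "degree (monom (1::'a) q) \<le> degree D"
      using dvdD \<open>D \<noteq> 0\<close> by (rule dvd_imp_degree_le)
    then have qD: "q \<le> degree D" by (simp add: degree_monom_eq)
    have A: "A \<ge> 1" using below \<open>D \<noteq> 0\<close> by (cases A) (auto simp: D_def polys_below_0)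
    have "degree p \<le> A - 1" if "p \<in> polys_below A" for p :: "'a poly"
      using degree_less_polys_below[OF that] by (cases "p = 0") auto
    then have rs: "degree r \<le> A - 1" "degree s \<le> A - 1" using below by auto
    have "degree (r\<^sup>2 * f) \<le> degree r + degree r + degree f"
      unfolding power2_eq_square by (meson add_le_mono1 degree_mult_le order_trans)
    moreover have "degree (smult c (s\<^sup>2)) \<le> degree s + degree s"
      unfolding power2_eq_square by (meson degree_mult_le degree_smult_le order_trans)
    ultimately have "degree D \<le> 2 * (A - 1) + degree f"
      unfolding D_def using rs by (intro degree_diff_le) linarith+
    also have "\<dots> < q" using deg A unfolding q_def by linarith
    finally show False using qD by simp
  qed
  then have eq: "r\<^sup>2 * f = smult c (s\<^sup>2)" by (simp add: D_def)
  have c: "c \<noteq> 0" using f0 by (simp add: c_def)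
  have "r = 0" using nonsq c eq unfolding nonsquare_def by blast
  moreover from this eq c have "s = 0" by simp
  ultimately show ?thesis by simp
qed

text \<open>Modulo \<open>monom 1 (CARD('a))\<close> only the term \<open>j = 0\<close> survives,
  and \<open>monom_power_dvd_imp_0\<close> kills it; dividing by that monomial then lowers
  \<open>J\<close> by one. This guarantees that the auxiliary polynomial is nonzero as soon as one
  of its coefficients is.\<close>

lemma stepanov_independent:
  fixes f :: "'a::{field,finite} poly"
  assumes q: "CARD('a) = 2 * h + 1"
    and nonsq: "nonsquare f"
    and f0: "poly f 0 \<noteq> 0"
    and deg: "2 * A + degree f \<le> CARD('a) + 1"
    and "\<And>j. j < J \<Longrightarrow> r j \<in> polys_below A" "\<And>j. j < J \<Longrightarrow> s j \<in> polys_below A"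
    and "(\<Sum>j<J. (r j + s j * f ^ h) * monom 1 (j * CARD('a))) = 0"
  shows "\<forall>j<J. r j = 0 \<and> s j = 0"
  using assms(5-)
proof (induction J arbitrary: r s)
  case (Suc J)
  define q where "q = CARD('a)"
  define R where "R = (\<Sum>j<J. (r (Suc j) + s (Suc j) * f ^ h) * monom 1 (j * q))"
  have mm: "monom (1::'a) (Suc j * q) = monom 1 q * monom 1 (j * q)" for j
    by (simp add: mult_monom)
  have "0 = (\<Sum>j<Suc J. (r j + s j * f ^ h) * monom 1 (j * q))"
    using Suc.prems(3) by (simp add: q_def)
  also have "\<dots> = (r 0 + s 0 * f ^ h) + (\<Sum>j<J. (r (Suc j) + s (Suc j) * f ^ h) * monom 1 (Suc j * q))"
    unfolding sum.lessThan_Suc_shift by simp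
  also have "(\<Sum>j<J. (r (Suc j) + s (Suc j) * f ^ h) * monom 1 (Suc j * q)) = monom 1 q * R"
    unfolding R_def sum_distrib_left
    by (intro sum.cong refl) (simp only: mm mult.left_commute)
  finally have eq: "r 0 + s 0 * f ^ h = monom 1 q * (- R)"
    by (simp add: eq_neg_iff_add_eq_0)
  have "r 0 = 0 \<and> s 0 = 0"
    by (rule monom_power_dvd_imp_0[OF q nonsq f0 Suc.prems(1,2) deg])
      (auto simp: eq q_def[symmetric])
  with eq have "R = 0" by (auto simp: monom_eq_0_iff)
  then have "\<forall>j<J. r (Suc j) = 0 \<and> s (Suc j) = 0"
    using Suc.prems(1,2) by (intro Suc.IH) (auto simp: R_def q_def)
  with \<open>r 0 = 0 \<and> s 0 = 0\<close> show ?case by (metis less_Suc_eq_0_disj)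
qed simp


lemma sum_count_le_size:
  assumes "finite Z"
  shows "(\<Sum>x\<in>Z. count M x) \<le> size M"
proof -
  have "(\<Sum>x\<in>Z. count M x) = (\<Sum>x\<in>Z \<inter> set_mset M. count M x)"
    using assms by (intro sum.mono_neutral_right) (auto simp: not_in_iff)
  also have "\<dots> \<le> (\<Sum>x\<in>set_mset M. count M x)" by (intro sum_mono2) auto
  finally show ?thesis by (simp add: size_multiset_overloaded_eq)
qed

text \<open>
  There are more unknown coefficients than linear conditions, so by pigeonhole two choices agree.
\<close>

lemma stepanov_nontrivial_solution:
  fixes f :: "'a::{field,finite} poly"
  assumes f: "degree f \<ge> 1" and J: "J \<ge> 1"
    and count: "(\<Sum>k<l. A + J - 1 + k * (degree f - 1)) < 2 * A * J"
  obtains u t where "\<And>j. j < J \<Longrightarrow> u j \<in> polys_below A" "\<And>j. j < J \<Longrightarrow> t j \<in> polys_below A"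
    "\<exists>j<J. u j \<noteq> 0 \<or> t j \<noteq> 0"
    "\<And>k. k < l \<Longrightarrow>
      (\<Sum>j<J. monom 1 j * (hasse_quot f l k (u j) + smult c (hasse_quot f (l + h) k (t j)))) = 0"
proof -
  have fnz: "f \<noteq> 0" using f by auto
  define q where "q = CARD('a)"
  have q1: "q > 1" unfolding q_def using card_mono[of "UNIV :: 'a set" "{0, 1}"] by simp
  define V :: "(nat \<Rightarrow> 'a poly \<times> 'a poly) set"
    where "V = PiE {..<J} (\<lambda>_. polys_below A \<times> polys_below A)"
  \<comment> \<open>The summand \<open>J - 1\<close> makes room for the factor
    \<open>monom 1 j\<close>, on top of \<open>hasse_quot_below\<close>.\<close>
  define W :: "(nat \<Rightarrow> 'a poly) set"
    where "W = PiE {..<l} (\<lambda>k. polys_below (A + J - 1 + k * (degree f - 1)))"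
  define E where "E u t k =
    (\<Sum>j<J. monom 1 j * (hasse_quot f l k (u j) + smult c (hasse_quot f (l + h) k (t j))))"
    for u t :: "nat \<Rightarrow> 'a poly" and k
  define \<Phi> where "\<Phi> v = restrict (E (\<lambda>j. fst (v j)) (\<lambda>j. snd (v j))) {..<l}"
    for v :: "nat \<Rightarrow> 'a poly \<times> 'a poly"
  have "\<Phi> v \<in> W" if v: "v \<in> V" for v
  proof -
    have "E (\<lambda>j. fst (v j)) (\<lambda>j. snd (v j)) k \<in> polys_below (A + J - 1 + k * (degree f - 1))"
      if k: "k < l" for k
      unfolding polys_below_def mem_Collect_eq
    proof (intro allI impI)
      fix i assume i: "A + J - 1 + k * (degree f - 1) \<le> i"
      have "coeff (monom 1 j * (hasse_quot f l k (fst (v j)) + smult c (hasse_quot f (l + h) k (snd (v j))))) i = 0"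
        if j: "j < J" for j
      proof -
        have vj: "fst (v j) \<in> polys_below A" "snd (v j) \<in> polys_below A"
          using v j by (auto simp: V_def PiE_iff mem_Times_iff)
        have "A + k * (degree f - 1) \<le> i - j" using i j J by linarith
        then have "coeff (hasse_quot f l k (fst (v j))) (i - j) = 0"
          "coeff (hasse_quot f (l + h) k (snd (v j))) (i - j) = 0"
          using hasse_quot_below[OF vj(1) f, of k l] hasse_quot_below[OF vj(2) f, of k "l + h"] k
          by (auto simp: polys_below_def)
        then show ?thesis by (simp add: coeff_monom_mult)
      qed
      then show "coeff (E (\<lambda>j. fst (v j)) (\<lambda>j. snd (v j)) k) i = 0"
        by (simp add: E_def coeff_sum)
    qed
    then show ?thesis by (simp add: W_def \<Phi>_def PiE_iff)
  qed
  then have sub: "\<Phi> ` V \<subseteq> W" by auto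
  have finW: "finite W" unfolding W_def by (intro finite_PiE) (auto simp: finite_polys_below)
  have "card W = (\<Prod>k<l. q ^ (A + J - 1 + k * (degree f - 1)))"
    unfolding W_def by (simp add: card_PiE card_polys_below q_def)
  also have "\<dots> = q ^ (\<Sum>k<l. A + J - 1 + k * (degree f - 1))" by (rule power_sum[symmetric])
  also have "\<dots> < q ^ (2 * A * J)" using count q1 by (rule power_strict_increasing)
  also have "\<dots> = card V"
    unfolding V_def by (simp add: card_PiE card_polys_below q_def card_cartesian_product
        power_add[symmetric] power_mult[symmetric] mult_2)
  finally have "card W < card V" .
  then have "\<not> inj_on \<Phi> V" using card_inj_on_le[OF _ sub finW] by fastforce
  then obtain v w where vw: "v \<in> V" "w \<in> V" "\<Phi> v = \<Phi> w" "v \<noteq> w"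
    unfolding inj_on_def by blast
  show thesis
  proof (rule that[of "\<lambda>j. fst (v j) - fst (w j)" "\<lambda>j. snd (v j) - snd (w j)"])
    show "fst (v j) - fst (w j) \<in> polys_below A" "snd (v j) - snd (w j) \<in> polys_below A" if "j < J" for j
      using vw(1,2) that by (auto simp: V_def PiE_iff mem_Times_iff intro!: polys_below_diff)
    have "\<exists>j<J. v j \<noteq> w j"
      using vw PiE_ext[of v "{..<J}" _ w] unfolding V_def by blast
    then show "\<exists>j<J. fst (v j) - fst (w j) \<noteq> 0 \<or> snd (v j) - snd (w j) \<noteq> 0"
      by (auto simp: prod_eq_iff)
    fix k assume k: "k < l"
    have "E (\<lambda>j. fst (v j)) (\<lambda>j. snd (v j)) k = E (\<lambda>j. fst (w j)) (\<lambda>j. snd (w j)) k"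
      using fun_cong[OF vw(3), of k] k by (simp add: \<Phi>_def)
    then show "(\<Sum>j<J. monom 1 j * (hasse_quot f l k (fst (v j) - fst (w j))
        + smult c (hasse_quot f (l + h) k (snd (v j) - snd (w j))))) = 0"
      unfolding hasse_quot_diff[OF fnz] E_def
      by (simp add: algebra_simps smult_diff_right sum.distrib sum_subtractf)
  qed
qed

lemma linear_power_card:
  fixes x :: "'a::{field,finite}"
  obtains w where "[:x, 1:] ^ (j * CARD('a)) = [:x ^ j:] + monom 1 (CARD('a)) * w"
proof -
  define q where "q = CARD('a)"
  have "[:x, 1:] = [:x:] + [:0, 1:]" by simp
  then have "[:x, 1:] ^ q = [:x:] ^ q + [:0, 1:] ^ q"
    unfolding q_def by (metis power_card_add_poly)
  also have "\<dots> = [:x:] + monom 1 q"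
    using power_card_eq_same[of x] by (simp add: q_def poly_const_pow monom_altdef)
  finally have Lq: "[:x, 1:] ^ q = [:x:] + monom 1 q" .
  have "\<exists>w. [:x, 1:] ^ (j * q) = [:x ^ j:] + monom 1 q * w"
  proof (induction j)
    case 0
    show ?case by (intro exI[of _ 0]) (simp add: pCons_one)
  next
    case (Suc j)
    then obtain w where w: "[:x, 1:] ^ (j * q) = [:x ^ j:] + monom 1 q * w" by blast
    have "[:x, 1:] ^ (Suc j * q) = ([:x:] + monom 1 q) * ([:x ^ j:] + monom 1 q * w)"
      by (simp only: mult_Suc power_add Lq w)
    also have "\<dots> = [:x:] * [:x ^ j:] + monom 1 q * ([:x ^ j:] + ([:x:] + monom 1 q) * w)"
      by (simp only: algebra_simps)
    also have "[:x:] * [:x ^ j:] = [:x ^ Suc j:]" by simp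
    finally show ?case by blast
  qed
  then show thesis using that unfolding q_def by blast
qed

text \<open>Since \<open>(X + x)^q = X^q + x\<close>, near \<open>x\<close> the factor
  \<open>X^(j*q)\<close> looks like the constant \<open>x ^ j\<close> up to order \<open>q\<close>.
  It contributes much to the degree of the auxiliary polynomial but only \<open>j\<close> to the
  degree of the vanishing conditions.\<close>

lemma coeff_mult_linear_power_card:
  fixes x :: "'a::{field,finite}"
  assumes "k < CARD('a)"
  shows "coeff (p * [:x, 1:] ^ (j * CARD('a))) k = x ^ j * coeff p k"
proof -
  obtain w where w: "[:x, 1:] ^ (j * CARD('a)) = [:x ^ j:] + monom 1 (CARD('a)) * w"
    by (rule linear_power_card)
  have "p * [:x, 1:] ^ (j * CARD('a)) = smult (x ^ j) p + monom 1 (CARD('a)) * (p * w)"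
    unfolding w by (simp add: algebra_simps)
  then show ?thesis using assms by (simp add: coeff_monom_mult)
qed


text \<open>The nonzero polynomial \<open>R\<close> vanishes to order \<open>l\<close> at every
  counted point, so \<open>l\<close> times their number is at most its degree. Replacing
  \<open>f ^ h\<close> by \<open>c\<close> and \<open>x ^ q\<close> by \<open>x\<close> turns the
  vanishing of each Hasse derivative into a polynomial condition, which the chosen coefficients
  satisfy identically.\<close>

lemma stepanov_bound:
  fixes f :: "'a::{field,finite} poly"
  assumes q: "CARD('a) = 2 * h + 1"
    and nonsq: "nonsquare f"
    and f0: "poly f 0 \<noteq> 0"
    and f: "degree f \<ge> 1" and J: "J \<ge> 1"
    and deg: "2 * A + degree f \<le> CARD('a) + 1"
    and l: "l \<le> CARD('a)"
    and count: "(\<Sum>k<l. A + J - 1 + k * (degree f - 1)) < 2 * A * J"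
  shows "l * card {x. poly f x = 0 \<or> poly f x ^ h = c}
           \<le> l * degree f + (A - 1 + h * degree f + (J - 1) * CARD('a))"
proof -
  obtain u t where ut: "\<And>j. j < J \<Longrightarrow> u j \<in> polys_below A" "\<And>j. j < J \<Longrightarrow> t j \<in> polys_below A"
      and nz: "\<exists>j<J. u j \<noteq> 0 \<or> t j \<noteq> 0"
      and sol: "\<And>k. k < l \<Longrightarrow>
        (\<Sum>j<J. monom 1 j * (hasse_quot f l k (u j) + smult c (hasse_quot f (l + h) k (t j)))) = 0"
    by (rule stepanov_nontrivial_solution[OF f J count, where c = c and h = h]) blast
  have fnz: "f \<noteq> 0" using f by auto
  define q where "q = CARD('a)"
  define Z where "Z = {x. poly f x = 0 \<or> poly f x ^ h = c}"
  define R where "R = f ^ l * (\<Sum>j<J. (u j + t j * f ^ h) * monom 1 (j * q))"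
  have "(\<Sum>j<J. (u j + t j * f ^ h) * monom 1 (j * q)) \<noteq> 0"
  proof
    assume "(\<Sum>j<J. (u j + t j * f ^ h) * monom 1 (j * q)) = 0"
    then have "\<forall>j<J. u j = 0 \<and> t j = 0"
      unfolding q_def using ut by (intro stepanov_independent[OF q nonsq f0 deg]) auto
    with nz show False by blast
  qed
  then have R: "R \<noteq> 0" using fnz by (simp add: R_def)
  have order: "l \<le> count (proots R) x" if x: "x \<in> Z" for x
  proof -
    have "coeff (pcompose R [:x, 1:]) k = 0" if k: "k < l" for k
    proof -
      have kq: "k < CARD('a)" using k l by simp
      have X: "pcompose [:0, 1:] [:x, 1:] = [:x, 1:]" by (simp add: pcompose_pCons)
      have "R = (\<Sum>j<J. (f ^ l * u j + f ^ (l + h) * t j) * [:0, 1:] ^ (j * q))"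
        unfolding R_def sum_distrib_left
        by (intro sum.cong refl) (simp only: power_add monom_altdef algebra_simps smult_1_left)
      then have "pcompose R [:x, 1:] = (\<Sum>j<J. pcompose (f ^ l * u j + f ^ (l + h) * t j) [:x, 1:]
          * [:x, 1:] ^ (j * q))"
        by (simp only: pcompose_hom.hom_sum pcompose_mult pcompose_hom.hom_power X)
      then have "coeff (pcompose R [:x, 1:]) k
          = (\<Sum>j<J. x ^ j * coeff (pcompose (f ^ l * u j + f ^ (l + h) * t j) [:x, 1:]) k)"
        unfolding q_def by (simp only: coeff_sum coeff_mult_linear_power_card[OF kq])
      also have "\<dots> = (\<Sum>j<J. poly f x ^ (l - k) * poly (monom 1 j *
          (hasse_quot f l k (u j) + smult c (hasse_quot f (l + h) k (t j)))) x)"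
      proof (intro sum.cong refl)
        fix j
        have "coeff (pcompose (f ^ l * u j + f ^ (l + h) * t j) [:x, 1:]) k
            = poly f x ^ (l - k) * poly (hasse_quot f l k (u j)) x
              + poly f x ^ (l + h - k) * poly (hasse_quot f (l + h) k (t j)) x"
          by (simp only: coeff_pcompose_linear taylor_add coeff_taylor_power_mult coeff_add poly_add
              poly_mult poly_power)
        \<comment> \<open>At a zero of \<open>f\<close> both sides are zero because
          \<open>k < l\<close>; this is why the zeros can be counted together with the solutions of
          \<open>f ^ h = c\<close>.\<close>
        also have "poly f x ^ (l + h - k) = poly f x ^ (l - k) * c"
        proof (cases "poly f x = 0")
          case True
          then show ?thesis using k by (simp add: power_0_left)
        next
          case False
          have "l + h - k = (l - k) + h" using k by simp
          then show ?thesis using False x by (simp add: Z_def power_add)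
        qed
        finally show "x ^ j * coeff (pcompose (f ^ l * u j + f ^ (l + h) * t j) [:x, 1:]) k
            = poly f x ^ (l - k) * poly (monom 1 j *
              (hasse_quot f l k (u j) + smult c (hasse_quot f (l + h) k (t j)))) x"
          by (simp add: poly_monom algebra_simps)
      qed
      also have "\<dots> = poly f x ^ (l - k) * poly (\<Sum>j<J. monom 1 j *
          (hasse_quot f l k (u j) + smult c (hasse_quot f (l + h) k (t j)))) x"
        by (simp only: sum_distrib_left poly_sum)
      also have "\<dots> = 0" by (simp only: sol[OF k] poly_0 mult_zero_right)
      finally show ?thesis .
    qed
    then have "[:- x, 1:] ^ l dvd R" by (rule linear_power_dvd_of_coeff_pcompose)
    then show ?thesis using R order_divides[of x l R] unfolding count_proots[OF R] by blast
  qed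
  have "l * card Z = (\<Sum>x\<in>Z. l)" by simp
  also have "\<dots> \<le> (\<Sum>x\<in>Z. count (proots R) x)" using order by (rule sum_mono)
  also have "\<dots> \<le> size (proots R)" by (rule sum_count_le_size) simp
  also have "\<dots> \<le> degree R" by (rule size_proots_le)
  also have "degree R \<le> degree (f ^ l) + degree (\<Sum>j<J. (u j + t j * f ^ h) * monom 1 (j * q))"
    unfolding R_def by (rule degree_mult_le)
  also have "degree (f ^ l) = l * degree f" using fnz by (simp add: degree_power_eq)
  also have "degree (\<Sum>j<J. (u j + t j * f ^ h) * monom 1 (j * q))
      \<le> A - 1 + h * degree f + (J - 1) * q"
  proof (rule degree_sum_le)
    fix j assume j: "j \<in> {..<J}"
    have le: "degree p \<le> A - 1" if "p \<in> polys_below A" for p :: "'a poly"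
      using degree_less_polys_below[OF that] by (cases "p = 0") auto
    have "degree (u j) \<le> A - 1" "degree (t j) \<le> A - 1" using le ut j by blast+
    moreover have "degree (t j * f ^ h) \<le> degree (t j) + h * degree f"
      using fnz degree_mult_le[of "t j" "f ^ h"] by (simp add: degree_power_eq mult.commute)
    ultimately have "degree (u j + t j * f ^ h) \<le> A - 1 + h * degree f"
      by (intro degree_add_le) linarith+
    moreover have "degree (monom (1::'a) (j * q)) \<le> (J - 1) * q"
    proof -
      have "j * q \<le> (J - 1) * q" using j by (intro mult_le_mono1) auto
      then show ?thesis by (simp add: degree_monom_eq)
    qed
    ultimately show "degree ((u j + t j * f ^ h) * monom 1 (j * q)) \<le> A - 1 + h * degree f + (J - 1) * q"
      using degree_mult_le[of "u j + t j * f ^ h" "monom 1 (j * q)"] by linarith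
  qed simp
  finally show ?thesis by (simp add: Z_def q_def)
qed

section \<open>The quadratic character and its sums over polynomial values\<close>

definition quad_char :: "'a::{field,finite} \<Rightarrow> int" where
  "quad_char x = (if x = 0 then 0 else if x ^ ((CARD('a) - 1) div 2) = 1 then 1 else -1)"

lemma quad_char_0 [simp]: "quad_char 0 = 0"
  by (simp add: quad_char_def)

lemma abs_quad_char_le: "\<bar>quad_char x\<bar> \<le> 1"
  by (simp add: quad_char_def)

text \<open>Euler's criterion. Both Stepanov's method and Pellet's formula meet the character only
  through this power, so squares in the field never have to be counted.\<close>

lemma power_half_card:
  fixes x :: "'a::{field,finite}"
  assumes "odd CARD('a)" "x \<noteq> 0"
  shows "x ^ ((CARD('a) - 1) div 2) = of_int (quad_char x)"
proof -
  define h where "h = (CARD('a) - 1) div 2"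
  have q: "CARD('a) = Suc (h + h)" using assms(1) by (auto simp: h_def elim!: oddE)
  have "x * (x ^ h * x ^ h) = x" using power_card_eq_same[of x] unfolding q by (simp add: power_add)
  then have "x ^ h * x ^ h = 1" using assms(2) by (metis mult_cancel_left2)
  then have "x ^ h = 1 \<or> x ^ h = -1" by (simp add: square_eq_1_iff)
  then show ?thesis using assms(2) unfolding quad_char_def h_def[symmetric] by auto
qed


lemma sum_arith_progression: "2 * (\<Sum>k<l. B + k * d) + l * d = 2 * l * B + l * l * (d::nat)"
  by (induction l) (auto simp: algebra_simps)

text \<open>After substituting for \<open>2 * J\<close> and cancelling, the claim reads
  \<open>m * l^2 + l * (e - m - 1) < 2 * A * e\<close>. The left side is about \<open>m * q\<close>
  and the right side at least \<open>(q - m) * e\<close>; the spare \<open>q\<close> beats the terms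
  of order \<open>m^2\<close> by the lower bound on \<open>q\<close>.\<close>

lemma stepanov_parameters:
  fixes q m l e A J :: int
  assumes m: "m \<ge> 1" and q: "q > 4 * (m + 2) * (m + 2)"
    and l: "l \<ge> 1" "l * l \<le> q" and e: "e = m + 1 \<or> e = m + 2"
    and A: "2 * A \<ge> q - m" and J: "2 * J = l + e"
  shows "2 * l * (A + J - 1) + l * l * (m - 1) - l * (m - 1) < 4 * A * J"
proof -
  have "l \<le> l * l" using l(1) by (simp add: mult_le_cancel_left1)
  then have lq: "l \<le> q" using l(2) by linarith
  have mm: "m \<le> m * m" using m by (simp add: mult_le_cancel_left1)
  have q': "q > 4 * (m * m) + 16 * m + 16" using q by (simp add: algebra_simps)
  have "m * (l * l) \<le> m * q" using m l(2) by (intro mult_left_mono) auto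
  moreover have "(q - m) * e \<le> (2 * A) * e" using A e m by (intro mult_right_mono) auto
  moreover have "m * q + l * (e - m - 1) < (q - m) * e"
    using e
  proof
    assume e: "e = m + 1"
    have "(q - m) * e = m * q + q - m * m - m" unfolding e by (simp add: algebra_simps)
    moreover have "l * (e - m - 1) = 0" unfolding e by simp
    ultimately show ?thesis using q' m mm by linarith
  next
    assume e: "e = m + 2"
    have "(q - m) * e = m * q + 2 * q - m * m - 2 * m" unfolding e by (simp add: algebra_simps)
    moreover have "l * (e - m - 1) = l" unfolding e by simp
    ultimately show ?thesis using q' m mm lq by linarith
  qed
  ultimately have "m * (l * l) + l * (e - m - 1) < 2 * A * e" by linarith
  moreover have "4 * A * J = 2 * A * (l + e)" by (simp flip: J)
  moreover have "2 * l * J = l * (l + e)" by (simp flip: J)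
  ultimately show ?thesis by (simp add: algebra_simps)
qed

lemma abs_sum_quad_char_poly_aux:
  fixes f :: "'a::{field,finite} poly"
  assumes odd: "odd CARD('a)" and nonsq: "nonsquare f" and f0: "poly f 0 \<noteq> 0"
  shows "real_of_int \<bar>\<Sum>x\<in>UNIV. quad_char (poly f x)\<bar> \<le> 2 * (real (degree f) + 2) * sqrt (real CARD('a))"
proof -
  define q where "q = CARD('a)"
  define m where "m = degree f"
  define s where "s = sqrt (real q)"
  define S where "S = (\<Sum>x\<in>UNIV. quad_char (poly f x))"
  have s2: "s * s = real q" unfolding s_def by simp
  have m1: "m \<ge> 1"
  proof (rule ccontr)
    assume "\<not> m \<ge> 1"
    then obtain c where c: "f = [:c:]" unfolding m_def by (metis degree_eq_zeroE less_one not_le)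
    then have "c \<noteq> 0" "1\<^sup>2 * f = smult c (1\<^sup>2)" using f0 by auto
    then show False using nonsq unfolding nonsquare_def by (metis zero_neq_one)
  qed
  \<comment> \<open>For \<open>s\<close> this small the trivial bound \<open>q = s * s\<close> is
    good enough. Otherwise \<open>q > 4 * (m + 2)^2\<close>, as \<open>stepanov_parameters\<close>
    demands.\<close>
  show ?thesis
  proof (cases "s \<le> 2 * (real m + 2)")
    case True
    have "\<bar>S\<bar> \<le> (\<Sum>x\<in>(UNIV::'a set). 1)" unfolding S_def
      by (rule order_trans[OF sum_abs sum_mono]) (rule abs_quad_char_le)
    then have "real_of_int \<bar>S\<bar> \<le> s * s" by (simp add: s2 q_def)
    also have "\<dots> \<le> 2 * (real m + 2) * s"
      using True by (intro mult_right_mono) (auto simp: s_def)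
    finally show ?thesis by (simp add: S_def m_def s_def q_def)
  next
    case False
    \<comment> \<open>\<open>l\<close> is the order of vanishing. As \<open>l\<^sup>2 \<le> q\<close>, the value \<open>e = m + 1\<close> leaves more unknowns than
      conditions; \<open>m + 2\<close> is needed for parity only.\<close>
    define l where "l = nat \<lfloor>s\<rfloor>"
    define h where "h = (q - 1) div 2"
    have q: "q = 2 * h + 1" using odd unfolding h_def q_def by (auto elim!: oddE)
    have s0: "s > 2 * (real m + 2)" using False by simp
    have "real l = of_int \<lfloor>s\<rfloor>" using s0 unfolding l_def by simp
    then have ls: "real l \<le> s" "s < real l + 1" by linarith+
    have "real l * real l \<le> s * s" using ls by (intro mult_mono) auto
    then have ll: "l * l \<le> q" unfolding s2 by (metis of_nat_le_iff of_nat_mult)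
    have "2 * (real m + 2) * (2 * (real m + 2)) < s * s"
      using s0 by (intro mult_strict_mono) auto
    then have "real (4 * (m + 2) * (m + 2)) < real q" unfolding s2 by (simp add: algebra_simps)
    then have qm: "4 * (m + 2) * (m + 2) < q" by (simp only: of_nat_less_iff)
    have "s > 4" using s0 of_nat_0_le_iff[of m, where ?'a = real] by argo
    then have "real l > 0" using ls by linarith
    then have l1: "l \<ge> 1" by simp
    then have lq: "l \<le> q" using ll by (metis le_trans mult_le_mono1 nat_mult_1)
    define e where "e = (if even (l + m + 1) then m + 1 else m + 2)"
    define J where "J = (l + e) div 2"
    have J2: "2 * J = l + e" unfolding J_def e_def by auto
    have e: "e = m + 1 \<or> e = m + 2" unfolding e_def by auto
    have J1: "J \<ge> 1" using J2 e by auto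
    \<comment> \<open>The largest value with \<open>2 * A + m <= q + 1\<close>, the degree condition
      of \<open>stepanov_independent\<close>.\<close>
    define A where "A = (q - m + 1) div 2"
    have mq: "m < q" using qm by (simp add: algebra_simps)
    have A2: "q - m \<le> 2 * A" "2 * A \<le> q - m + 1" unfolding A_def by auto
    have "int (2 * l * (A + J - 1) + l * l * (m - 1)) - int (l * (m - 1)) < int (4 * A * J)"
    proof -
      have "2 * int l * (int A + int J - 1) + int l * int l * (int m - 1) - int l * (int m - 1)
          < 4 * int A * int J"
      proof (rule stepanov_parameters)
        show "4 * (int m + 2) * (int m + 2) < int q"
          using qm by (metis (mono_tags, lifting) of_nat_add of_nat_less_iff of_nat_mult of_nat_numeral)
        show "int l * int l \<le> int q" using ll by (metis of_nat_le_iff of_nat_mult)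
        show "2 * int J = int l + int e" using J2 by linarith
      qed (use m1 l1 e A2 mq in auto)
      then show ?thesis using J1 m1 by (simp add: of_nat_diff)
    qed
    then have count: "(\<Sum>k<l. A + J - 1 + k * (m - 1)) < 2 * A * J"
      using sum_arith_progression[where l = l and B = "A + J - 1" and d = "m - 1"] by linarith
    have main: "2 * real (card {x. poly f x = 0 \<or> poly f x ^ h = c}) - real q \<le> 2 * (real m + 2) * s"
      for c
    proof -
      define Z where "Z = card {x. poly f x = 0 \<or> poly f x ^ h = c}"
      have "l * Z \<le> l * m + (A - 1 + h * m + (J - 1) * q)"
        unfolding Z_def m_def q_def
        by (rule stepanov_bound[OF q[unfolded q_def] nonsq f0 m1[unfolded m_def] J1])
          (use A2 mq lq count in \<open>auto simp: m_def q_def\<close>)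
      then have "2 * (l * Z) \<le> 2 * (l * m) + ((2 * A - 2) + (2 * h) * m + (2 * J - 2) * q)"
        by (simp add: algebra_simps diff_mult_distrib)
      also have "\<dots> \<le> 2 * (l * m) + (q + q * m + (l + e - 2) * q)"
        using A2 m1 unfolding J2 q by (intro add_mono mult_right_mono) auto
      finally have "2 * (l * Z) + 2 * q \<le> 2 * (l * m) + (q + q * m + (l + e - 2) * q) + 2 * q" by simp
      also have "(l + e - 2) * q + 2 * q = (l + e) * q"
      proof -
        have "l + e = (l + e - 2) + 2" using l1 e m1 by linarith
        then show ?thesis by (metis add_mult_distrib)
      qed
      then have "2 * (l * m) + (q + q * m + (l + e - 2) * q) + 2 * q
          = 2 * (l * m) + (q + q * m + (l + e) * q)" by linarith
      also have "\<dots> \<le> 2 * (l * m) + (q + q * m + (l + (m + 2)) * q)"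
        using e by (intro add_left_mono mult_right_mono) auto
      finally have "real (2 * (l * Z) + 2 * q) \<le> real (2 * (l * m) + (q + q * m + (l + (m + 2)) * q))"
        by (simp only: of_nat_le_iff)
      then have "real l * (2 * real Z - real q) \<le> 2 * real l * real m + (2 * real m + 1) * (s * s)"
        unfolding s2 by (simp add: algebra_simps)
      \<comment> \<open>Rounding \<open>s\<close> down to \<open>l\<close> costs about
        \<open>(4 * m + 4) * s\<close>. It is paid from \<open>3 * s * s\<close>, the room that the
        coefficient \<open>2 * (m + 2)\<close> leaves above \<open>2 * m + 1\<close>.\<close>
      also have "\<dots> \<le> 2 * real l * real m + (real l * (2 * (real m + 2) * s - 2 * real m))"
      proof -
        have "(s - 1) * (2 * (real m + 2) * s - 2 * real m) \<le> real l * (2 * (real m + 2) * s - 2 * real m)"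
        proof (rule mult_right_mono)
          have "real m * 1 \<le> (real m + 2) * s" using s0 by (intro mult_mono) auto
          then show "0 \<le> 2 * (real m + 2) * s - 2 * real m" by (simp add: algebra_simps)
        qed (use ls in simp)
        moreover have "(2 * real m + 1) * (s * s) \<le> (s - 1) * (2 * (real m + 2) * s - 2 * real m)"
        proof -
          have "(4 * real m + 4) * s \<le> (3 * s) * s" using s0 by (intro mult_right_mono) auto
          then show ?thesis by (simp add: algebra_simps)
        qed
        ultimately show ?thesis by linarith
      qed
      also have "\<dots> = real l * (2 * (real m + 2) * s)" by (simp add: algebra_simps)
      finally show ?thesis using l1 unfolding Z_def by (simp only: mult_le_cancel_left_pos of_nat_0_less_iff)
    qed
    have card_sum: "(\<Sum>x\<in>(UNIV::'a set). if P x then 1 else -1) = 2 * int (card {x. P x}) - int q" for P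
    proof -
      have "(\<Sum>x\<in>(UNIV::'a set). if P x then 1 else -1) = (\<Sum>x\<in>(UNIV::'a set). (if P x then 2 else 0) - (1::int))"
        by (intro sum.cong) auto
      also have "\<dots> = (\<Sum>x\<in>(UNIV::'a set). if P x then 2 else 0) - int q"
        by (simp only: sum_subtractf sum_constant q_def mult_1_right of_nat_id)
      also have "(\<Sum>x\<in>(UNIV::'a set). if P x then 2 else 0) = 2 * int (card {x. P x})"
        by (subst sum.If_cases) simp_all
      finally show ?thesis .
    qed
    have ph: "quad_char x = (if x = 0 then 0 else if x ^ h = 1 then 1 else -1)" for x :: 'a
      unfolding quad_char_def h_def q_def ..
    \<comment> \<open>A zero of \<open>f\<close> contributes 0 to \<open>S\<close> and 1 to the
      right side, so including the zeros is harmless here and equally in the estimate of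
      \<open>- S\<close>.\<close>
    have "S \<le> (\<Sum>x\<in>UNIV. if poly f x = 0 \<or> poly f x ^ h = 1 then 1 else -1)"
      unfolding S_def by (intro sum_mono) (auto simp: ph)
    then have up: "S \<le> 2 * int (card {x. poly f x = 0 \<or> poly f x ^ h = 1}) - int q"
      unfolding card_sum .
    have "- S = (\<Sum>x\<in>UNIV. - quad_char (poly f x))" by (simp add: S_def sum_negf)
    also have "\<dots> \<le> (\<Sum>x\<in>UNIV. if poly f x = 0 \<or> poly f x ^ h = -1 then 1 else -1)"
    proof (intro sum_mono)
      fix x
      have "poly f x ^ h = 1 \<or> poly f x ^ h = - 1" if nz: "poly f x \<noteq> 0"
      proof -
        have "poly f x ^ h = of_int (quad_char (poly f x))"
          using power_half_card[OF odd nz] unfolding h_def q_def .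
        moreover have "quad_char (poly f x) = 1 \<or> quad_char (poly f x) = -1"
          using nz by (simp add: ph)
        ultimately show ?thesis by auto
      qed
      then show "- quad_char (poly f x) \<le> (if poly f x = 0 \<or> poly f x ^ h = -1 then 1 else -1)"
        by (auto simp: ph)
    qed
    finally have lo: "- S \<le> 2 * int (card {x. poly f x = 0 \<or> poly f x ^ h = -1}) - int q"
      unfolding card_sum .
    have bound: "real_of_int T \<le> 2 * (real m + 2) * s"
      if "T \<le> 2 * int (card {x. poly f x = 0 \<or> poly f x ^ h = c}) - int q" for T c
    proof -
      have "real_of_int T \<le> real_of_int (2 * int (card {x. poly f x = 0 \<or> poly f x ^ h = c}) - int q)"
        using that by (simp only: of_int_le_iff)
      also have "\<dots> = 2 * real (card {x. poly f x = 0 \<or> poly f x ^ h = c}) - real q"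
        by (simp only: of_int_diff of_int_mult of_int_of_nat_eq of_int_numeral)
      finally show ?thesis using main[of c] by linarith
    qed
    have "real_of_int \<bar>S\<bar> \<le> 2 * (real m + 2) * s"
      using bound[OF up] bound[OF lo] by (simp add: abs_if)
    then show ?thesis unfolding S_def m_def q_def s_def .
  qed
qed

lemma nonsquare_pcompose:
  fixes f :: "'a::field poly"
  assumes "nonsquare f"
  shows "nonsquare (pcompose f [:a, 1:])"
  unfolding nonsquare_def
proof (intro allI impI)
  fix u v :: "'a poly" and c
  assume c: "c \<noteq> 0" and eq: "u\<^sup>2 * pcompose f [:a, 1:] = smult c (v\<^sup>2)"
  have X: "pcompose [:a, 1:] [:-a, 1:] = [:0, 1:]" "pcompose [:-a, 1:] [:a, 1:] = [:0, 1:]"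
    by (simp_all add: pcompose_pCons)
  have inv_comp: "pcompose (pcompose p [:a, 1:]) [:-a, 1:] = p" "pcompose (pcompose p [:-a, 1:]) [:a, 1:] = p"
    for p by (simp_all only: pcompose_assoc[symmetric] X pcompose_idR)
  have "pcompose (u\<^sup>2 * pcompose f [:a, 1:]) [:-a, 1:] = (pcompose u [:-a, 1:])\<^sup>2 * f"
    by (simp only: pcompose_mult power2_eq_square inv_comp)
  moreover have "pcompose (smult c (v\<^sup>2)) [:-a, 1:] = smult c ((pcompose v [:-a, 1:])\<^sup>2)"
    by (simp only: pcompose_smult pcompose_mult power2_eq_square)
  ultimately have "(pcompose u [:-a, 1:])\<^sup>2 * f = smult c ((pcompose v [:-a, 1:])\<^sup>2)"
    using eq by simp
  then have "pcompose u [:-a, 1:] = 0" using assms c unfolding nonsquare_def by blast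
  then show "u = 0" using inv_comp(2)[of u] by simp
qed

text \<open>A translation moves some point with nonzero value to the origin, as reduction modulo a
  power of \<open>X\<close> requires; if there is no such point, every term is zero.\<close>

theorem abs_sum_quad_char_poly_le:
  fixes f :: "'a::{field,finite} poly"
  assumes odd: "odd CARD('a)" and nonsq: "nonsquare f"
  shows "real_of_int \<bar>\<Sum>x\<in>UNIV. quad_char (poly f x)\<bar> \<le> 2 * (real (degree f) + 2) * sqrt (real CARD('a))"
proof (cases "\<forall>x. poly f x = 0")
  case True
  then show ?thesis by simp
next
  case False
  then obtain a where a: "poly f a \<noteq> 0" by blast
  define g where "g = pcompose f [:a, 1:]"
  have "(\<Sum>x\<in>UNIV. quad_char (poly g x)) = (\<Sum>x\<in>UNIV. quad_char (poly f (a + x)))"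
    by (simp add: g_def poly_pcompose)
  also have "\<dots> = (\<Sum>x\<in>UNIV. quad_char (poly f x))"
    by (rule sum.reindex_bij_betw[of "(+) a" UNIV UNIV "\<lambda>x. quad_char (poly f x)"]) auto
  finally have eq: "(\<Sum>x\<in>UNIV. quad_char (poly f x)) = (\<Sum>x\<in>UNIV. quad_char (poly g x))" ..
  have deg: "degree g = degree f" by (simp add: g_def)
  show ?thesis unfolding eq deg[symmetric]
    by (rule abs_sum_quad_char_poly_aux[OF odd])
      (use a nonsquare_pcompose[OF nonsq] in \<open>auto simp: g_def poly_pcompose\<close>)
qed

declare pCons_one [simp del]

section \<open>Frobenius and discriminants\<close>

interpretation to_ac_hom: field_hom "to_ac :: 'a::field \<Rightarrow> 'a alg_closure"
  by unfold_locales auto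

interpretation to_ac_poly_hom: map_poly_inj_idom_hom "to_ac :: 'a::field \<Rightarrow> 'a alg_closure" ..

abbreviation ac_poly :: "'a::field poly \<Rightarrow> 'a alg_closure poly" where
  "ac_poly \<equiv> map_poly to_ac"

definition frob :: "'a::{field,finite} alg_closure \<Rightarrow> 'a alg_closure" where
  "frob x = x ^ CARD('a)"

lemma frob_add: "frob (x + y) = frob x + frob y"
  unfolding frob_def
proof (rule power_add_of_choose_eq_0)
  fix i assume "0 < i" "i < CARD('a)"
  then have "to_ac (of_nat (CARD('a) choose i) :: 'a) = 0"
    by (simp only: of_nat_card_choose to_ac_0)
  then show "of_nat (CARD('a) choose i) = (0 :: 'a alg_closure)" by simp
qed simp

interpretation frob_hom: field_hom "frob :: 'a::{field,finite} alg_closure \<Rightarrow> 'a alg_closure"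
proof
  show "frob (0 :: 'a alg_closure) = 0" by (simp add: frob_def power_0_left)
qed (auto simp: frob_add, auto simp: frob_def power_mult_distrib)

interpretation frob_poly_hom: map_poly_inj_idom_hom "frob :: 'a::{field,finite} alg_closure \<Rightarrow> 'a alg_closure" ..

lemma frob_to_ac [simp]: "frob (to_ac x) = to_ac x"
  unfolding frob_def to_ac_power[symmetric] by (simp only: power_card_eq_same)

text \<open>The fixed points are roots of \<open>X^q - X\<close>, and the \<open>q\<close> elements
  of the base field already exhaust these.\<close>

lemma frob_fixed:
  fixes x :: "'a::{field,finite} alg_closure"
  assumes "frob x = x"
  shows "x \<in> range to_ac"
proof -
  define q where "q = CARD('a)"
  define p :: "'a alg_closure poly" where "p = monom 1 q - [:0, 1:]"
  have q: "q > 1" unfolding q_def using card_mono[of "UNIV :: 'a set" "{0, 1}"] by simp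
  have "coeff p q = 1" using q by (auto simp: p_def coeff_pCons split: nat.splits)
  then have p: "p \<noteq> 0" by auto
  have root: "poly p x = frob x - x" for x by (simp add: p_def poly_monom frob_def q_def)
  have "degree p \<le> q" unfolding p_def
    using q by (intro degree_diff_le) (auto simp: degree_monom_eq)
  moreover have "card {x. poly p x = 0} \<le> degree p" using p by (rule card_poly_roots_bound)
  moreover have "card (range (to_ac :: 'a \<Rightarrow> 'a alg_closure)) = q"
    by (simp add: card_image inj_to_ac q_def)
  moreover have sub: "range (to_ac :: 'a \<Rightarrow> 'a alg_closure) \<subseteq> {x. poly p x = 0}" by (auto simp: root)
  moreover have "finite {x. poly p x = 0}" using p by (rule poly_roots_finite)
  ultimately have "range (to_ac :: 'a \<Rightarrow> 'a alg_closure) = {x. poly p x = 0}"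
    by (metis card_seteq le_trans)
  then show ?thesis using assms by (auto simp: root)
qed

lemma frob_poly_ac_poly [simp]: "map_poly frob (ac_poly p) = ac_poly p"
  by (rule poly_eqI) (simp add: coeff_map_poly)

lemma frob_poly_fixed:
  assumes "map_poly frob p = p"
  obtains p0 where "p = ac_poly p0"
proof -
  have "frob (coeff p i) = coeff p i" for i
    using arg_cong[OF assms, of "\<lambda>p. coeff p i"] by (simp add: coeff_map_poly)
  then have "coeff p i \<in> range to_ac" for i by (rule frob_fixed)
  then have "p = ac_poly (map_poly of_ac p)"
    by (intro poly_eqI) (simp add: coeff_map_poly to_ac_of_ac)
  then show thesis by (rule that)
qed

lemma frob_poly: "frob (poly (ac_poly p) x) = poly (ac_poly p) (frob x)"
  by (metis frob_hom.poly_map_poly frob_poly_ac_poly)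

section \<open>Products over roots in the algebraic closure\<close>

lemma prod_mset_linear_neq_0: "(\<Prod>x\<in>#M. [:- x, 1:]) \<noteq> (0 :: 'a::idom poly)"
  by (auto simp: prod_mset_zero_iff)

lemma proots_prod_mset_linear: "proots (\<Prod>x\<in>#M. [:- x, 1:]) = (M :: 'a::idom multiset)"
proof (induction M)
  case (add x M)
  have "proots ([:- x, 1:] * (\<Prod>x\<in>#M. [:- x, 1:])) = {#x#} + M"
    by (subst proots_mult) (use add prod_mset_linear_neq_0[of M] in \<open>auto simp del: mult_pCons_left\<close>)
  then show ?case by (simp del: mult_pCons_left)
qed simp

lemma alg_closed_factorization:
  fixes p :: "'a::alg_closed_field poly"
  shows "p = smult (lead_coeff p) (\<Prod>x\<in>#proots p. [:- x, 1:])"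
proof (cases "p = 0")
  case False
  then obtain M where M: "p = smult (lead_coeff p) (\<Prod>x\<in>#M. [:- x, 1:])"
    using alg_closed_imp_factorization by blast
  have "proots p = M"
    using False by (subst M) (simp add: proots_prod_mset_linear)
  with M show ?thesis by simp
qed simp

lemma size_proots_alg_closed: "size (proots p) = degree (p :: 'a::alg_closed_field poly)"
proof (cases "p = 0")
  case False
  then obtain M where M: "size M = degree p" "p = smult (lead_coeff p) (\<Prod>x\<in>#M. [:- x, 1:])"
    using alg_closed_imp_factorization by blast
  have "proots p = M" using False by (subst M(2)) (simp add: proots_prod_mset_linear)
  with M show ?thesis by simp
qed simp

lemma frob_poly_prod_linear:
  "map_poly frob (\<Prod>x\<in>#M. [:- x, 1:]) = (\<Prod>x\<in>#image_mset frob M. [:- x, 1:])"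
  by (induction M) (simp_all add: frob_poly_hom.hom_mult frob_hom.hom_uminus del: mult_pCons_left)

text \<open>Frobenius fixes the polynomial and acts on its linear factors through the roots, so it
  permutes the roots with multiplicity. Hence symmetric expressions in them descend to the base
  field.\<close>

lemma frob_proots: "image_mset frob (proots (ac_poly p)) = proots (ac_poly p)"
proof (cases "p = 0")
  case False
  let ?P = "ac_poly p"
  have nz: "lead_coeff ?P \<noteq> 0" using False by simp
  have "?P = map_poly frob (smult (lead_coeff ?P) (\<Prod>x\<in>#proots ?P. [:- x, 1:]))"
    using alg_closed_factorization[of ?P] by simp
  also have "\<dots> = smult (frob (lead_coeff ?P)) (\<Prod>x\<in>#image_mset frob (proots ?P). [:- x, 1:])"
    by (simp only: frob_hom.map_poly_hom_smult frob_poly_prod_linear)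
  finally have "proots ?P = proots (smult (frob (lead_coeff ?P)) (\<Prod>x\<in>#image_mset frob (proots ?P). [:- x, 1:]))"
    by simp
  also have "\<dots> = image_mset frob (proots ?P)"
    using nz by (subst proots_smult) (auto simp only: proots_prod_mset_linear frob_hom.hom_0_iff)
  finally show ?thesis ..
qed simp

text \<open>For monic \<open>f\<close> this is the resultant of \<open>f\<close> and \<open>g\<close>.\<close>

definition root_prod :: "'a::{field,finite} poly \<Rightarrow> 'a poly \<Rightarrow> 'a" where
  "root_prod f g = of_ac (\<Prod>x\<in>#proots (ac_poly f). poly (ac_poly g) x)"

lemma to_ac_root_prod: "to_ac (root_prod f g) = (\<Prod>x\<in>#proots (ac_poly f). poly (ac_poly g) x)"
proof -
  have "frob (\<Prod>x\<in>#proots (ac_poly f). poly (ac_poly g) x)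
      = (\<Prod>x\<in>#proots (ac_poly f). poly (ac_poly g) (frob x))"
    by (simp add: frob_hom.hom_prod_mset frob_poly multiset.map_comp comp_def)
  also have "\<dots> = (\<Prod>x\<in>#image_mset frob (proots (ac_poly f)). poly (ac_poly g) x)"
    by (simp add: multiset.map_comp comp_def)
  finally have "frob (\<Prod>x\<in>#proots (ac_poly f). poly (ac_poly g) x) = (\<Prod>x\<in>#proots (ac_poly f). poly (ac_poly g) x)"
    by (simp only: frob_proots)
  then show ?thesis unfolding root_prod_def by (intro to_ac_of_ac frob_fixed)
qed

lemma root_prod_mult_left:
  assumes "f \<noteq> 0" "g \<noteq> 0"
  shows "root_prod (f * g) p = root_prod f p * root_prod g p"
proof -
  have "to_ac (root_prod (f * g) p) = to_ac (root_prod f p * root_prod g p)"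
    using assms by (simp add: to_ac_root_prod to_ac_poly_hom.hom_mult proots_mult)
  then show ?thesis by (simp only: to_ac_eq_iff)
qed

lemma root_prod_mult_right: "root_prod p (f * g) = root_prod p f * root_prod p g"
proof -
  have "to_ac (root_prod p (f * g)) = to_ac (root_prod p f * root_prod p g)"
    by (simp add: to_ac_root_prod to_ac_poly_hom.hom_mult prod_mset.distrib)
  then show ?thesis by (simp only: to_ac_eq_iff)
qed

lemma root_prod_cong:
  assumes "f dvd g - h"
  shows "root_prod f g = root_prod f h"
proof (cases "f = 0")
  case False
  have "poly (ac_poly g) x = poly (ac_poly h) x" if "x \<in># proots (ac_poly f)" for x
  proof -
    obtain k where k: "g = h + f * k" using assms by (metis add.commute diff_add_cancel dvdE)
    have "poly (ac_poly f) x = 0" using that False by simp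
    then show ?thesis by (simp add: k to_ac_poly_hom.hom_mult to_ac_poly_hom.hom_add)
  qed
  then show ?thesis unfolding root_prod_def by (metis (mono_tags, lifting) image_mset_cong)
qed (simp add: root_prod_def)

lemma root_prod_eq_0_iff: "root_prod f g = 0 \<longleftrightarrow> f \<noteq> 0 \<and> (\<exists>x. poly (ac_poly f) x = 0 \<and> poly (ac_poly g) x = 0)"
proof -
  have "root_prod f g = 0 \<longleftrightarrow> to_ac (root_prod f g) = 0" by simp
  also have "\<dots> \<longleftrightarrow> (\<exists>x\<in>#proots (ac_poly f). poly (ac_poly g) x = 0)"
    unfolding to_ac_root_prod by (auto simp: prod_mset_zero_iff)
  also have "\<dots> \<longleftrightarrow> f \<noteq> 0 \<and> (\<exists>x. poly (ac_poly f) x = 0 \<and> poly (ac_poly g) x = 0)"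
    by (cases "f = 0") auto
  finally show ?thesis .
qed

text \<open>Both products are, up to leading coefficient and sign, the product of all differences
  between a root of \<open>f\<close> and a root of \<open>g\<close>. This exchanges the roots of
  \<open>f\<close>, which move with its constant coefficient, for the critical points, which do
  not.\<close>

lemma root_prod_swap:
  assumes "lead_coeff f = 1" "g \<noteq> 0"
  shows "root_prod f g = lead_coeff g ^ degree f * (-1) ^ (degree f * degree g) * root_prod g f"
proof -
  let ?F = "ac_poly f" and ?G = "ac_poly g"
  let ?c = "lead_coeff ?G"
  have F: "poly ?F y = (\<Prod>x\<in>#proots ?F. y - x)" for y
    using assms(1) by (subst alg_closed_factorization) (simp add: poly_prod_mset multiset.map_comp comp_def)
  have G: "poly ?G x = ?c * (\<Prod>y\<in>#proots ?G. x - y)" for x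
    by (subst alg_closed_factorization) (simp add: poly_prod_mset multiset.map_comp comp_def)
  have "(\<Prod>x\<in>#proots ?F. poly ?G x) = ?c ^ degree f * (\<Prod>x\<in>#proots ?F. \<Prod>y\<in>#proots ?G. x - y)"
    by (subst G) (simp add: prod_mset.distrib size_proots_alg_closed)
  also have "(\<Prod>x\<in>#proots ?F. \<Prod>y\<in>#proots ?G. x - y) = (\<Prod>y\<in>#proots ?G. \<Prod>x\<in>#proots ?F. x - y)"
    by (rule prod_mset.swap)
  also have "\<dots> = (\<Prod>y\<in>#proots ?G. (-1) ^ degree f * (\<Prod>x\<in>#proots ?F. y - x))"
  proof (intro arg_cong[where f = prod_mset] image_mset_cong)
    fix y
    have "(\<Prod>x\<in>#proots ?F. x - y) = (\<Prod>x\<in>#proots ?F. (-1) * (y - x))" by simp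
    also have "\<dots> = (-1) ^ degree f * (\<Prod>x\<in>#proots ?F. y - x)"
      unfolding prod_mset.distrib by (simp add: size_proots_alg_closed)
    finally show "(\<Prod>x\<in>#proots ?F. x - y) = (-1) ^ degree f * (\<Prod>x\<in>#proots ?F. y - x)" .
  qed
  also have "\<dots> = (-1) ^ (degree f * degree g) * (\<Prod>y\<in>#proots ?G. poly ?F y)"
    unfolding F prod_mset.distrib by (simp add: size_proots_alg_closed power_mult)
  finally have "to_ac (root_prod f g)
      = to_ac (lead_coeff g ^ degree f * (-1) ^ (degree f * degree g) * root_prod g f)"
    by (simp add: to_ac_root_prod)
  then show ?thesis by (simp only: to_ac_eq_iff)
qed


text \<open>The classical discriminant for monic \<open>f\<close>. Running over the roots of
  \<open>f\<close>, and not over those of the derivative, the product needs no correction when the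
  degree of \<open>pderiv f\<close> drops below \<open>degree f - 1\<close>.\<close>

definition discr :: "'a::{field,finite} poly \<Rightarrow> 'a" where
  "discr f = (-1) ^ (degree f choose 2) * root_prod f (pderiv f)"

lemma choose_two_add: "(m + n) choose 2 = (m choose 2) + (n choose 2) + m * n"
proof (induction n)
  case (Suc n)
  have "(m + Suc n) choose 2 = (m + n choose 1) + (m + n choose 2)"
    by (simp add: numeral_2_eq_2)
  moreover have "Suc n choose 2 = n + (n choose 2)"
    by (simp add: numeral_2_eq_2)
  ultimately show ?case using Suc by simp
qed simp

text \<open>The mixed factors \<open>root_prod f g\<close> and \<open>root_prod g f\<close> differ
  by a sign, which is exactly the cross term of \<open>choose_two_add\<close>. What remains is a
  square, invisible to the quadratic character unless it is zero.\<close>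

lemma discr_mult:
  assumes f: "lead_coeff f = 1" and g: "lead_coeff g = 1"
  shows "discr (f * g) = discr f * discr g * (root_prod f g)\<^sup>2"
proof -
  have nz: "f \<noteq> 0" "g \<noteq> 0" using f g by auto
  have deg: "degree (f * g) = degree f + degree g" using nz by (rule degree_mult_eq)
  have 1: "root_prod f (pderiv (f * g)) = root_prod f (pderiv f * g)"
    by (rule root_prod_cong) (simp add: pderiv_mult)
  have 2: "root_prod g (pderiv (f * g)) = root_prod g (pderiv g * f)"
    by (rule root_prod_cong) (simp add: pderiv_mult)
  have "root_prod (f * g) (pderiv (f * g))
      = (root_prod f (pderiv f) * root_prod f g) * (root_prod g (pderiv g) * root_prod g f)"
    unfolding root_prod_mult_left[OF nz] 1 2 root_prod_mult_right ..
  moreover have "root_prod g f = (-1) ^ (degree f * degree g) * root_prod f g"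
    using root_prod_swap[OF g nz(1)] f by (simp add: mult.commute)
  ultimately show ?thesis
    unfolding discr_def deg choose_two_add
    by (simp add: power_add power2_eq_square power_mult_distrib[symmetric] mult_ac)
qed

lemma one_neq_minus_one:
  assumes "odd CARD('a)"
  shows "(1 :: 'a::{field,finite}) \<noteq> - 1"
proof
  assume eq: "(1 :: 'a) = - 1"
  define q where "q = CARD('a)"
  have q: "q > 1" unfolding q_def using card_mono[of "UNIV :: 'a set" "{0, 1}"] by simp
  obtain h where h: "q = 2 * h + 1" using assms unfolding q_def by (auto elim: oddE)
  have "of_nat q = (0 :: 'a)" using of_nat_card_choose[where ?'a = 'a, of 1] q by (simp add: q_def)
  moreover have "(2 :: 'a) = 0" using eq by (metis add.right_inverse one_add_one)
  ultimately show False unfolding h by simp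
qed

lemma of_int_sign_eq_iff:
  assumes "odd CARD('a)" and "\<bar>a\<bar> = 1" "\<bar>b\<bar> = 1" and "of_int a = (of_int b :: 'a::{field,finite})"
  shows "a = b"
proof -
  have "a = 1 \<or> a = -1" "b = 1 \<or> b = -1" using assms(2,3) by linarith+
  moreover have "(1 :: 'a) \<noteq> - 1" "- 1 \<noteq> (1 :: 'a)"
    using one_neq_minus_one[OF assms(1)] by metis+
  ultimately show ?thesis using assms(4) by auto
qed

lemma abs_quad_char_eq_1: "x \<noteq> 0 \<Longrightarrow> \<bar>quad_char x\<bar> = 1"
  by (simp add: quad_char_def)

lemma quad_char_mult:
  fixes x y :: "'a::{field,finite}"
  assumes odd: "odd CARD('a)"
  shows "quad_char (x * y) = quad_char x * quad_char y"
proof (cases "x = 0 \<or> y = 0")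
  case False
  then have nz: "x \<noteq> 0" "y \<noteq> 0" "x * y \<noteq> 0" by auto
  have "of_int (quad_char (x * y)) = (x * y) ^ ((CARD('a) - 1) div 2)"
    by (rule power_half_card[OF odd nz(3), symmetric])
  also have "\<dots> = of_int (quad_char x) * of_int (quad_char y)"
    unfolding power_mult_distrib power_half_card[OF odd nz(1)] power_half_card[OF odd nz(2)] ..
  finally have eq: "of_int (quad_char (x * y)) = (of_int (quad_char x * quad_char y) :: 'a)"
    unfolding of_int_mult .
  have "\<bar>quad_char x * quad_char y\<bar> = 1"
    unfolding abs_mult abs_quad_char_eq_1[OF nz(1)] abs_quad_char_eq_1[OF nz(2)] by (rule mult_1)
  then show ?thesis
    using of_int_sign_eq_iff[OF odd abs_quad_char_eq_1[OF nz(3)] _ eq] by blast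
qed fastforce

lemma quad_char_power2:
  assumes "odd CARD('a)" "x \<noteq> (0 :: 'a::{field,finite})"
  shows "quad_char (x\<^sup>2) = 1"
proof -
  have "quad_char x * quad_char x = \<bar>quad_char x\<bar> * \<bar>quad_char x\<bar>" by simp
  then show ?thesis
    unfolding power2_eq_square quad_char_mult[OF assms(1)] abs_quad_char_eq_1[OF assms(2)] by simp
qed

section \<open>Vandermonde products and conjugate roots\<close>

definition vandermonde :: "(nat \<Rightarrow> 'b::comm_ring_1) \<Rightarrow> nat \<Rightarrow> 'b" where
  "vandermonde r n = (\<Prod>j<n. \<Prod>i<j. r j - r i)"

lemma vandermonde_Suc: "vandermonde r (Suc n) = vandermonde r n * (\<Prod>i<n. r n - r i)"
  by (simp add: vandermonde_def)

text \<open>Splitting off the first index instead of the last allows comparison with the cyclically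
  shifted product.\<close>

lemma vandermonde_shift:
  "vandermonde r (Suc n) = vandermonde (\<lambda>i. r (Suc i)) n * (\<Prod>j<n. r (Suc j) - r 0)"
proof (induction n)
  case (Suc n)
  have "vandermonde r (Suc (Suc n))
      = vandermonde r (Suc n) * ((r (Suc n) - r 0) * (\<Prod>i<n. r (Suc n) - r (Suc i)))"
    unfolding vandermonde_Suc[of r "Suc n"] by (simp only: prod.lessThan_Suc_shift)
  also have "\<dots> = (vandermonde (\<lambda>i. r (Suc i)) n * (\<Prod>i<n. r (Suc n) - r (Suc i)))
      * ((\<Prod>j<n. r (Suc j) - r 0) * (r (Suc n) - r 0))"
    by (simp add: Suc.IH mult_ac)
  finally show ?case by (simp add: vandermonde_Suc)
qed (simp add: vandermonde_def)

lemma prod_differences_eq_vandermonde_power2: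
  "(\<Prod>i<n. \<Prod>j\<in>{..<n} - {i}. r i - r j) = (-1) ^ (n choose 2) * (vandermonde r n)\<^sup>2"
proof (induction n)
  case (Suc n)
  have "(\<Prod>i<Suc n. \<Prod>j\<in>{..<Suc n} - {i}. r i - r j)
      = (\<Prod>i<n. \<Prod>j\<in>{..<Suc n} - {i}. r i - r j) * (\<Prod>j<n. r n - r j)"
    by (simp add: lessThan_Suc)
  also have "(\<Prod>i<n. \<Prod>j\<in>{..<Suc n} - {i}. r i - r j)
      = (\<Prod>i<n. (r i - r n) * (\<Prod>j\<in>{..<n} - {i}. r i - r j))"
  proof (intro prod.cong refl)
    fix i assume "i \<in> {..<n}"
    then have "{..<Suc n} - {i} = insert n ({..<n} - {i})" by auto
    then show "(\<Prod>j\<in>{..<Suc n} - {i}. r i - r j) = (r i - r n) * (\<Prod>j\<in>{..<n} - {i}. r i - r j)"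
      by simp
  qed
  also have "\<dots> = (\<Prod>i<n. (-1) * (r n - r i)) * (\<Prod>i<n. \<Prod>j\<in>{..<n} - {i}. r i - r j)"
    by (simp add: prod.distrib)
  also have "(\<Prod>i<n. (-1) * (r n - r i)) = (-1) ^ n * (\<Prod>i<n. r n - r i)"
    unfolding prod.distrib by simp
  finally have "(\<Prod>i<Suc n. \<Prod>j\<in>{..<Suc n} - {i}. r i - r j)
      = (-1) ^ (n + (n choose 2)) * (vandermonde r (Suc n))\<^sup>2"
    by (simp add: Suc.IH vandermonde_Suc power_add power2_eq_square mult_ac)
  moreover have "Suc n choose 2 = n + (n choose 2)" by (simp add: numeral_2_eq_2)
  ultimately show ?case by simp
qed (simp add: vandermonde_def numeral_2_eq_2)

text \<open>A Bezout identity persists in the closure. It is obtained from a nonzero element of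
  least degree in the ideal \<open>I\<close>: this divides both polynomials and is therefore a
  unit.\<close>

lemma no_common_root_of_irreducible:
  fixes P g :: "'a::field poly"
  assumes "irreducible P" "\<not> P dvd g" "poly (ac_poly P) x = 0"
  shows "poly (ac_poly g) x \<noteq> 0"
proof
  assume g: "poly (ac_poly g) x = 0"
  have "\<exists>a b. a * P + b * g = 1"
  proof -
    define I where "I = {h. \<exists>a b. h = a * P + b * g}"
    have "P = 1 * P + 0 * g" "g = 0 * P + 1 * g" by simp_all
    then have "P \<in> I" "g \<in> I" unfolding I_def by blast+
    moreover have "P \<noteq> 0" using assms(1) by auto
    ultimately have "\<exists>h. h \<in> I \<and> h \<noteq> 0" by blast
    then obtain h where h: "h \<in> I" "h \<noteq> 0" and min: "\<And>k. k \<in> I \<Longrightarrow> k \<noteq> 0 \<Longrightarrow> degree h \<le> degree k"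
      using ex_has_least_nat[of "\<lambda>h. h \<in> I \<and> h \<noteq> 0" _ degree] by blast
    have dvd: "h dvd k" if k: "k \<in> I" for k
    proof (rule ccontr)
      assume "\<not> h dvd k"
      then have nz: "k mod h \<noteq> 0" by (simp add: dvd_eq_mod_eq_0)
      obtain a b a' b' where "h = a * P + b * g" "k = a' * P + b' * g" using h k by (auto simp: I_def)
      then have "k mod h = (a' - (k div h) * a) * P + (b' - (k div h) * b) * g"
        by (simp add: minus_div_mult_eq_mod[symmetric] algebra_simps)
      then have "k mod h \<in> I" by (auto simp: I_def)
      then have "degree h \<le> degree (k mod h)" using nz by (rule min)
      then show False using degree_mod_less[OF h(2), of k] nz by auto
    qed
    have "h dvd P" "h dvd g" using dvd \<open>P \<in> I\<close> \<open>g \<in> I\<close> by auto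
    then have "is_unit h" using assms(1,2) irreducibleD'[of P h] dvd_trans by blast
    then obtain k where "1 = h * k" by (elim dvdE)
    moreover obtain a b where "h = a * P + b * g" using h by (auto simp: I_def)
    ultimately have "(a * k) * P + (b * k) * g = 1" by (simp add: algebra_simps)
    then show ?thesis by blast
  qed
  then obtain a b where "a * P + b * g = 1" by blast
  then have "poly (ac_poly (a * P + b * g)) x = 1" by simp
  then show False using assms(3) g by (simp add: to_ac_poly_hom.hom_mult to_ac_poly_hom.hom_add)
qed


text \<open>The product \<open>Q\<close> over one Frobenius orbit is fixed by Frobenius, so it comes
  from the base field and is divisible by \<open>P\<close>. Conversely the orbit consists of
  distinct roots of \<open>P\<close>; comparing degrees gives equality.\<close>

lemma irreducible_conjugate_roots:
  fixes P :: "'a::{field,finite} poly"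
  assumes irr: "irreducible P" and monic: "lead_coeff P = 1"
  obtains r where "ac_poly P = (\<Prod>i<degree P. [:- r i, 1:])" "inj_on r {..<degree P}"
    "\<And>i. r (Suc i) = frob (r i)" "r (degree P) = r 0"
proof -
  have P: "P \<noteq> 0" using irr by auto
  have degP: "degree P > 0"
    using irr P by (metis irreducible_not_unit is_unit_iff_degree bot_nat_0.not_eq_extremum)
  then have "degree (ac_poly P) > 0" by simp
  then obtain x where x: "poly (ac_poly P) x = 0" using alg_closed_imp_poly_has_root by blast
  define r where "r i = (frob ^^ i) x" for i
  have r0: "r 0 = x" and rSuc: "r (Suc i) = frob (r i)" for i by (simp_all add: r_def)
  have root: "poly (ac_poly P) (r i) = 0" for i
  proof (induction i)
    case (Suc i)
    then show ?case by (metis frob_poly frob_hom.hom_zero rSuc)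
  qed (simp add: r0 x)
  have fin: "finite {y. poly (ac_poly P) y = 0}" using P by (intro poly_roots_finite) simp
  have inj_frob: "inj ((frob :: 'a alg_closure \<Rightarrow> _) ^^ i)" for i
    by (intro inj_fn) (simp add: inj_def)
  have period: "r (j - i) = x" if "r i = r j" "i < j" for i j
  proof -
    have "(frob ^^ i) (r (j - i)) = r j" using that(2) funpow_add[of i "j - i" "frob :: 'a alg_closure \<Rightarrow> _"]
      by (simp add: r_def fun_eq_iff)
    then have "(frob ^^ i) (r (j - i)) = (frob ^^ i) x" using that(1) by (simp add: r_def)
    then show ?thesis using inj_frob[of i] by (simp add: inj_eq)
  qed
  have "\<not> inj r"
  proof
    assume "inj r"
    moreover have "range r \<subseteq> {y. poly (ac_poly P) y = 0}" using root by auto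
    ultimately show False using fin finite_subset finite_imageD infinite_UNIV_nat by blast
  qed
  then obtain i j where "r i = r j" "i \<noteq> j" by (auto simp: inj_def)
  then obtain i j where "r i = r j" "i < j" by (metis linorder_neqE_nat)
  then have ex: "\<exists>d. d > 0 \<and> r d = x" using period by (intro exI[of _ "j - i"]) simp
  define d where "d = (LEAST d. d > 0 \<and> r d = x)"
  have d: "d > 0" "r d = x" using LeastI_ex[OF ex] by (simp_all add: d_def)
  have least: "d \<le> k" if "k > 0" "r k = x" for k using that unfolding d_def by (intro Least_le) simp
  have inj: "inj_on r {..<d}"
  proof (rule linorder_inj_onI)
    fix i j assume ij: "i < j" "i \<in> {..<d}" "j \<in> {..<d}"
    show "r i \<noteq> r j"
    proof
      assume "r i = r j"
      then have "d \<le> j - i" using ij period by (intro least) auto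
      then show False using ij by auto
    qed
  qed auto
  define Q where "Q = (\<Prod>i<d. [:- r i, 1:])"
  have "map_poly frob Q = (\<Prod>i<d. [:- r (Suc i), 1:])"
    by (simp add: Q_def frob_poly_hom.hom_prod rSuc frob_hom.hom_uminus)
  also have "\<dots> = Q"
  proof -
    obtain e where e: "d = Suc e" using d(1) by (cases d) auto
    have "(\<Prod>i<d. [:- r (Suc i), 1:]) = (\<Prod>i<e. [:- r (Suc i), 1:]) * [:- r d, 1:]" by (simp add: e)
    also have "r d = r 0" by (simp add: d r0)
    also have "(\<Prod>i<e. [:- r (Suc i), 1:]) * [:- r 0, 1:] = (\<Prod>i<Suc e. [:- r i, 1:])"
      unfolding prod.lessThan_Suc_shift by (rule mult.commute)
    finally show ?thesis by (simp add: Q_def e)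
  qed
  finally obtain Q0 where Q0: "Q = ac_poly Q0" by (rule frob_poly_fixed)
  have degQ: "degree Q0 = d"
  proof -
    have "degree Q0 = degree Q" by (simp add: Q0)
    also have "\<dots> = (\<Sum>i<d. degree [:- r i, 1:])" unfolding Q_def by (rule degree_prod_eq_sum_degree) auto
    finally show ?thesis by simp
  qed
  have lcQ: "lead_coeff Q0 = 1"
  proof -
    have "to_ac (lead_coeff Q0) = lead_coeff Q" by (simp add: Q0)
    also have "\<dots> = 1" by (simp add: Q_def lead_coeff_prod)
    finally show ?thesis by (metis to_ac_1 to_ac_eq_iff)
  qed
  have "poly Q x = 0" unfolding Q_def poly_prod using d r0 by (auto intro!: prod_zero bexI[of _ 0])
  then have dvd: "P dvd Q0"
    using no_common_root_of_irreducible[OF irr _ x, of Q0] unfolding Q0 by blast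
  have "d = card (r ` {..<d})" using inj by (simp add: card_image)
  also have "\<dots> \<le> card {y. poly (ac_poly P) y = 0}" using fin root by (intro card_mono) auto
  also have "\<dots> \<le> degree (ac_poly P)" using P by (intro card_poly_roots_bound) simp
  finally have "d \<le> degree P" by simp
  moreover have "Q0 \<noteq> 0" using lcQ by auto
  ultimately have deg: "degree P = d" using dvd dvd_imp_degree_le[OF dvd] degQ by simp
  obtain k where k: "Q0 = P * k" using dvd by (elim dvdE)
  then have "k \<noteq> 0" using \<open>Q0 \<noteq> 0\<close> by auto
  then have "degree k = 0" using k deg degQ P by (simp add: degree_mult_eq)
  moreover have "lead_coeff k = 1" using lcQ k monic by (simp add: lead_coeff_mult)
  ultimately have "k = 1" by (metis degree_eq_zeroE lead_coeff_pCons(2) pCons_one coeff_pCons_0)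
  then have "Q0 = P" using k by simp
  then have "ac_poly P = (\<Prod>i<degree P. [:- r i, 1:])" using Q0 Q_def deg by simp
  then show thesis using that inj rSuc d r0 deg by metis
qed

text \<open>The discriminant is the square of the Vandermonde product \<open>V\<close> of the roots,
  which Frobenius permutes in one cycle of length \<open>d\<close>. Such a cycle has sign
  \<open>(-1)^(d - 1)\<close>, so \<open>V ^ (q - 1)\<close>, which is the discriminant to the power
  \<open>h\<close>, equals this sign.\<close>

lemma quad_char_discr_irreducible:
  fixes P :: "'a::{field,finite} poly"
  assumes odd: "odd CARD('a)" and irr: "irreducible P" and monic: "lead_coeff P = 1"
  shows "quad_char (discr P) = (-1) ^ (degree P + 1)"
proof -
  obtain r where r: "ac_poly P = (\<Prod>i<degree P. [:- r i, 1:])" "inj_on r {..<degree P}"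
    "\<And>i. r (Suc i) = frob (r i)" "r (degree P) = r 0"
    using irreducible_conjugate_roots[OF irr monic] by metis
  define d where "d = degree P"
  define V where "V = vandermonde r d"
  have "d \<noteq> 0"
    using irr irreducible_not_unit[OF irr] is_unit_iff_degree[of P] unfolding d_def by fastforce
  then obtain e where e: "d = Suc e" by (cases d) auto
  have proots: "proots (ac_poly P) = image_mset r (mset_set {..<d})"
    unfolding r(1) d_def[symmetric] prod_unfold_prod_mset
    using proots_prod_mset_linear[of "image_mset r (mset_set {..<d})"]
    by (simp add: multiset.map_comp comp_def)
  have deriv: "poly (pderiv (ac_poly P)) (r i) = (\<Prod>j\<in>{..<d} - {i}. r i - r j)" if i: "i < d" for i
  proof -
    have "poly (pderiv (ac_poly P)) (r i)
        = (\<Sum>a<d. \<Prod>j\<in>{..<d} - {a}. r i - r j)"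
      unfolding r(1) d_def[symmetric] pderiv_prod by (simp add: poly_sum poly_prod pderiv_pCons)
    also have "\<dots> = (\<Sum>a<d. if a = i then \<Prod>j\<in>{..<d} - {i}. r i - r j else 0)"
    proof (intro sum.cong refl)
      fix a assume "a \<in> {..<d}"
      have "(\<Prod>j\<in>{..<d} - {a}. r i - r j) = 0" if "a \<noteq> i" using that i by (intro prod_zero) auto
      then show "(\<Prod>j\<in>{..<d} - {a}. r i - r j) = (if a = i then \<Prod>j\<in>{..<d} - {i}. r i - r j else 0)"
        by simp
    qed
    also have "\<dots> = (\<Prod>j\<in>{..<d} - {i}. r i - r j)" using i by simp
    finally show ?thesis .
  qed
  have "to_ac (root_prod P (pderiv P)) = (\<Prod>i<d. poly (pderiv (ac_poly P)) (r i))"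
    unfolding to_ac_root_prod proots prod_unfold_prod_mset[of _ "{..<d}"] to_ac_hom.map_poly_pderiv
    by (simp only: multiset.map_comp comp_def)
  also have "\<dots> = (\<Prod>i<d. \<Prod>j\<in>{..<d} - {i}. r i - r j)"
    using deriv by simp
  also have "\<dots> = (-1) ^ (d choose 2) * V\<^sup>2"
    unfolding V_def by (rule prod_differences_eq_vandermonde_power2)
  finally have "to_ac (discr P) = ((-1) ^ (d choose 2) * (-1) ^ (d choose 2)) * V\<^sup>2"
    by (simp add: discr_def d_def)
  then have discr: "to_ac (discr P) = V\<^sup>2"
    unfolding power_mult_distrib[symmetric] by simp
  have inj: "r j = r i \<Longrightarrow> i < d \<Longrightarrow> j < d \<Longrightarrow> j = i" for i j
    using r(2) unfolding inj_on_def d_def by blast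
  have "(\<Prod>i<j. r j - r i) \<noteq> 0" if "j < d" for j
  proof
    assume "(\<Prod>i<j. r j - r i) = 0"
    then obtain i where "i < j" "r j = r i" by (subst (asm) prod_zero_iff) auto
    then show False using inj[of j i] that by simp
  qed
  then have V0: "V \<noteq> 0" unfolding V_def vandermonde_def by (subst prod_zero_iff) auto
  have "frob V = vandermonde (\<lambda>i. r (Suc i)) (Suc e)"
    unfolding V_def vandermonde_def e r(3) by (simp add: frob_hom.hom_prod frob_hom.hom_mult frob_hom.hom_minus)
  also have "\<dots> = vandermonde (\<lambda>i. r (Suc i)) e * (\<Prod>i<e. r 0 - r (Suc i))"
    using r(4) unfolding d_def[symmetric] e by (simp add: vandermonde_Suc)
  also have "(\<Prod>i<e. r 0 - r (Suc i)) = (\<Prod>i<e. (-1) * (r (Suc i) - r 0))" by simp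
  also have "\<dots> = (-1) ^ e * (\<Prod>i<e. r (Suc i) - r 0)" unfolding prod.distrib by simp
  finally have frobV: "frob V = (-1) ^ e * V"
    by (simp add: V_def e vandermonde_shift mult_ac)
  define h where "h = (CARD('a) - 1) div 2"
  have q: "CARD('a) = Suc (2 * h)" using odd unfolding h_def by (auto elim!: oddE)
  have "V * V ^ (2 * h) = V * (-1) ^ e" using frobV unfolding frob_def q by (simp add: mult.commute)
  then have "V ^ (2 * h) = (-1) ^ e" using V0 by (metis mult_left_cancel)
  then have "to_ac (discr P ^ h) = to_ac ((-1) ^ e)"
    by (simp add: discr power_mult)
  then have dh: "discr P ^ h = (-1) ^ e" by (simp only: to_ac_eq_iff)
  have nz: "discr P \<noteq> 0" using discr V0 by (metis to_ac_0 zero_eq_power2)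
  have "of_int (quad_char (discr P)) = discr P ^ h"
    unfolding h_def by (rule power_half_card[OF odd nz, symmetric])
  also have "\<dots> = of_int ((-1) ^ e)" unfolding dh by simp
  finally have eq: "of_int (quad_char (discr P)) = (of_int ((-1) ^ e) :: 'a)" .
  have "\<bar>(-1) ^ e\<bar> = (1 :: int)" by (simp add: power_abs)
  then have "quad_char (discr P) = (-1) ^ e"
    using of_int_sign_eq_iff[OF odd abs_quad_char_eq_1[OF nz] _ eq] by blast
  also have "\<dots> = (-1) ^ (degree P + 1)" unfolding d_def[symmetric] e by simp
  finally show ?thesis .
qed


section \<open>Pellet's formula\<close>

lemma discr_eq_0_of_power2_dvd:
  fixes P f :: "'a::{field,finite} poly"
  assumes "irreducible P" "P\<^sup>2 dvd f" "f \<noteq> 0"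
  shows "discr f = 0"
proof -
  have "degree P > 0"
    using irreducible_not_unit[OF assms(1)] is_unit_iff_degree[of P] assms(1) by fastforce
  then have "degree (ac_poly P) > 0" by simp
  then obtain x where x: "poly (ac_poly P) x = 0" using alg_closed_imp_poly_has_root by blast
  obtain k where k: "f = P\<^sup>2 * k" using assms(2) by (elim dvdE)
  have "pderiv f = P * (P * pderiv k + 2 * (pderiv P * k))"
    by (simp add: k pderiv_mult power2_eq_square algebra_simps)
  then have "poly (ac_poly (pderiv f)) x = 0" using x by (simp only: to_ac_poly_hom.hom_mult poly_mult mult_zero_left)
  moreover have "poly (ac_poly f) x = 0"
    using x by (simp only: k to_ac_poly_hom.hom_mult poly_mult power2_eq_square mult_zero_left)
  ultimately have "root_prod f (pderiv f) = 0" using assms(3) by (auto simp: root_prod_eq_0_iff)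
  then show ?thesis by (simp add: discr_def)
qed

lemma monic_irreducible_factor:
  fixes f :: "'a::field poly"
  assumes "degree f > 0"
  obtains P where "irreducible P" "lead_coeff P = 1" "P dvd f"
proof -
  have "degree f > 0 \<and> f dvd f" using assms by simp
  from ex_has_least_nat[of "\<lambda>P. degree P > 0 \<and> P dvd f", OF this, of degree]
  obtain P where P: "degree P > 0" "P dvd f"
    and min: "\<And>Q. degree Q > 0 \<Longrightarrow> Q dvd f \<Longrightarrow> degree P \<le> degree Q"
    by auto
  have Pnz: "P \<noteq> 0" using P by auto
  have irr: "irreducible P"
  proof (rule Factorial_Ring.irreducibleI)
    show "\<not> is_unit P" using P Pnz by (simp add: is_unit_iff_degree)
    fix a b assume ab: "P = a * b"
    have nz: "a \<noteq> 0" "b \<noteq> 0" using Pnz ab by auto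
    have "is_unit b" if "degree a > 0"
    proof -
      have "degree P \<le> degree a" using that P(2) ab by (intro min) (auto dest: dvd_mult_left)
      then show ?thesis using nz ab by (simp add: degree_mult_eq is_unit_iff_degree)
    qed
    then show "is_unit a \<or> is_unit b" using nz by (cases "degree a") (auto simp: is_unit_iff_degree)
  qed (rule Pnz)
  let ?P = "smult (inverse (lead_coeff P)) P"
  have "is_unit [:inverse (lead_coeff P):]" using Pnz by (simp add: is_unit_iff_degree)
  then have "irreducible ([:inverse (lead_coeff P):] * P)"
    using irr by (simp only: irreducible_mult_unit_left)
  then have "irreducible ?P" by simp
  moreover have "lead_coeff ?P = 1" using Pnz by simp
  moreover have "?P dvd f" using P(2) Pnz by (simp add: smult_dvd_iff)
  ultimately show thesis by (rule that)
qed

lemma distinct_factorization_exists: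
  fixes f :: "'a::field poly"
  assumes "f \<noteq> 0" and "\<And>P. irreducible P \<Longrightarrow> \<not> P\<^sup>2 dvd f"
  shows "\<exists>S. distinct_factorization f S"
  using assms
proof (induction "degree f" arbitrary: f rule: less_induct)
  case less
  show ?case
  proof (cases "degree f = 0")
    case True
    then obtain c where "f = [:c:]" by (elim degree_eq_zeroE)
    then have "distinct_factorization f {}" using less.prems(1)
      by (auto simp: distinct_factorization_def)
    then show ?thesis ..
  next
    case False
    then obtain P where P: "irreducible P" "lead_coeff P = 1" "P dvd f"
      using monic_irreducible_factor[of f] by blast
    obtain g where g: "f = P * g" using P(3) by (elim dvdE)
    have nz: "P \<noteq> 0" "g \<noteq> 0" using g less.prems(1) by auto
    have "degree P > 0" using irreducible_not_unit[OF P(1)] nz is_unit_iff_degree[of P] by blast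
    then have "degree g < degree f" using nz by (simp add: g degree_mult_eq)
    moreover have "\<not> Q\<^sup>2 dvd g" if "irreducible Q" for Q
      using less.prems(2)[OF that] g dvd_mult by blast
    ultimately obtain S where S: "distinct_factorization g S" using less.hyps nz(2) by blast
    then obtain c where c: "finite S" "c \<noteq> 0" "g = smult c (\<Prod>S)"
      by (auto simp: distinct_factorization_def)
    have "\<not> P dvd g"
      using less.prems(2)[OF P(1)] unfolding g power2_eq_square by (metis dvd_refl mult_dvd_mono)
    then have "P \<notin> S" using distinct_factorization_eq[OF S] by blast
    then have "f = smult c (\<Prod>(insert P S))" using c by (simp add: g)
    then have "distinct_factorization f (insert P S)"
      using S P c(2) unfolding distinct_factorization_def by auto
    then show ?thesis ..
  qed
qed

text \<open>The character of the discriminant is multiplicative over distinct monic irreducible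
  factors: these share no root, so the square in \<open>discr_mult\<close> is nonzero. A repeated
  factor makes both sides zero.\<close>

theorem pellet:
  fixes f :: "'a::{field,finite} poly"
  assumes odd: "odd CARD('a)" and monic: "lead_coeff f = 1"
  shows "poly_moebius f = (-1) ^ degree f * quad_char (discr f)"
proof (cases "\<exists>S. distinct_factorization f S")
  case True
  then obtain S where S: "distinct_factorization f S" ..
  then obtain c where c: "f = smult c (\<Prod>S)" and irr: "\<And>P. P \<in> S \<Longrightarrow> lead_coeff P = 1 \<and> irreducible P"
    and fin: "finite S" by (auto simp: distinct_factorization_def)
  have "lead_coeff (\<Prod>S) = (\<Prod>P\<in>S. lead_coeff P)" by (rule lead_coeff_prod)
  also have "\<dots> = 1" using irr by (intro prod.neutral) auto
  finally have "lead_coeff (\<Prod>S) = 1" .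
  moreover have "lead_coeff f = c * lead_coeff (\<Prod>S)" unfolding c by (rule lead_coeff_smult)
  ultimately have "c = 1" using monic by simp
  then have f: "f = \<Prod>S" using c by simp
  \<comment> \<open>Each factor adds its degree plus one to the exponent; the sign
    \<open>(-1) ^ degree f\<close> in the formula then leaves the number of factors.\<close>
  have "quad_char (discr (\<Prod>S)) = (-1) ^ (degree (\<Prod>S) + card S) \<and> lead_coeff (\<Prod>S) = 1"
    using fin irr
  proof (induction S)
    case empty
    then show ?case using abs_quad_char_eq_1[of "1 :: 'a"]
      by (simp add: discr_def root_prod_def numeral_2_eq_2 quad_char_def)
  next
    case (insert P S)
    then have P: "lead_coeff P = 1" "irreducible P"
      and IH: "quad_char (discr (\<Prod>S)) = (-1) ^ (degree (\<Prod>S) + card S)" "lead_coeff (\<Prod>S) = 1"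
      by auto
    have nz: "P \<noteq> 0" "\<Prod>S \<noteq> 0" using P IH by auto
    have "distinct_factorization (\<Prod>S) S"
      using insert.hyps insert.prems unfolding distinct_factorization_def by (auto intro: exI[of _ 1])
    then have "\<not> P dvd \<Prod>S" using distinct_factorization_eq[of "\<Prod>S" S] insert.hyps P by blast
    then have rp: "root_prod P (\<Prod>S) \<noteq> 0"
      using no_common_root_of_irreducible[OF P(2)] by (auto simp: root_prod_eq_0_iff)
    have "quad_char (discr (P * \<Prod>S)) = quad_char (discr P) * quad_char (discr (\<Prod>S))"
      by (simp only: discr_mult[OF P(1) IH(2)] quad_char_mult[OF odd]
          quad_char_power2[OF odd rp] mult_1_right)
    also have "\<dots> = (-1) ^ (degree P + 1 + (degree (\<Prod>S) + card S))"
      by (simp only: quad_char_discr_irreducible[OF odd P(2,1)] IH power_add)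
    also have "degree P + 1 + (degree (\<Prod>S) + card S) = degree (P * \<Prod>S) + card (insert P S)"
      using insert.hyps nz by (simp add: degree_mult_eq)
    finally show ?case using insert.hyps P IH by (simp add: lead_coeff_mult)
  qed
  then show ?thesis
    unfolding f[symmetric] poly_moebius_eqI[OF S] by (simp add: power_add flip: mult.assoc power_mult_distrib)
next
  case False
  have "f \<noteq> 0" using monic by auto
  then obtain P where "irreducible P" "P\<^sup>2 dvd f" using distinct_factorization_exists[of f] False by blast
  then have "discr f = 0" using \<open>f \<noteq> 0\<close> by (intro discr_eq_0_of_power2_dvd)
  then show ?thesis using poly_moebius_eq_0[OF False] by simp
qed

section \<open>Bitangents\<close>

text \<open>In \<open>'a poly poly\<close> the inner variable is \<open>x\<close> and the outer variable is \<open>y\<close>.\<close>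

abbreviation lift_outer :: "'a::comm_ring_1 poly \<Rightarrow> 'a poly poly" where
  "lift_outer p \<equiv> map_poly (\<lambda>a. [:a:]) p"

abbreviation eval_inner :: "'a::comm_ring_1 \<Rightarrow> 'a poly poly \<Rightarrow> 'a poly" where
  "eval_inner x A \<equiv> map_poly (\<lambda>c. poly c x) A"

interpretation eval_inner_hom: map_poly_comm_ring_hom "\<lambda>c. poly c x" for x :: "'a::comm_ring_1" ..

interpretation lift_outer_hom: map_poly_comm_ring_hom "\<lambda>a :: 'a::comm_ring_1. [:a:]"
  by unfold_locales (auto simp: pCons_one)

lemma eval_inner_lift_outer [simp]: "eval_inner x (lift_outer p) = p"
  by (rule poly_eqI) (simp add: coeff_map_poly)

lemma eval_inner_const [simp]: "eval_inner x [:c:] = [:poly c x:]"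
  by (rule poly_eqI) (simp add: coeff_map_poly coeff_pCons split: nat.splits)

text \<open>\<open>R\<close> is the resultant with respect to \<open>y\<close>. Leading coefficients
  constant in \<open>x\<close> keep both degrees under evaluation at \<open>x\<close>, so that
  evaluation commutes with the resultant; its degree is read off the Sylvester matrix.\<close>

lemma elimination:
  fixes A B :: "'a::{field,factorial_ring_gcd,semiring_gcd_mult_normalize} poly poly"
  assumes A: "lead_coeff A = [:a:]" "a \<noteq> 0" and B: "lead_coeff B = [:b:]" "b \<noteq> 0"
    and degA: "\<And>i. degree (coeff A i) \<le> n" and degB: "\<And>i. degree (coeff B i) \<le> n"
    and gcd: "degree (gcd A B) = 0"
  obtains R where "R \<noteq> 0" "degree R \<le> n * (degree A + degree B)"
    "\<And>x y. poly (eval_inner x A) y = 0 \<Longrightarrow> poly (eval_inner x B) y = 0 \<Longrightarrow> poly R x = 0"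
proof
  let ?R = "resultant A B"
  show "?R \<noteq> 0" using gcd by (simp add: resultant_0_gcd)
  show "degree ?R \<le> n * (degree A + degree B)"
    unfolding resultant_def
  proof (rule degree_det_le)
    fix i j assume "i < degree A + degree B" "j < degree A + degree B"
    then show "degree (sylvester_mat A B $$ (i, j)) \<le> n"
      using degA degB by (simp add: sylvester_index_mat)
  qed (rule sylvester_carrier_mat)
  fix x y
  assume root: "poly (eval_inner x A) y = 0" "poly (eval_inner x B) y = 0"
  have "coeff (eval_inner x A) (degree A) \<noteq> 0" using A by (simp add: coeff_map_poly)
  then have dA: "degree (eval_inner x A) = degree A"
    by (intro antisym le_degree map_poly_degree_leq) auto
  have "coeff (eval_inner x B) (degree B) \<noteq> 0" using B by (simp add: coeff_map_poly)
  then have dB: "degree (eval_inner x B) = degree B"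
    by (intro antisym le_degree map_poly_degree_leq) auto
  have nz: "eval_inner x A \<noteq> 0" using \<open>coeff (eval_inner x A) (degree A) \<noteq> 0\<close> coeff_0 by metis
  let ?g = "gcd (eval_inner x A) (eval_inner x B)"
  have "[:- y, 1:] dvd ?g" using root by (simp add: poly_eq_0_iff_dvd)
  moreover have "?g \<noteq> 0" using nz by simp
  ultimately have "degree [:- y, 1:] \<le> degree ?g" by (rule dvd_imp_degree_le)
  then have "resultant (eval_inner x A) (eval_inner x B) = 0" by (simp add: resultant_0_gcd)
  then show "poly ?R x = 0" using poly_hom.resultant_map_poly[OF dA dB] by simp
qed

lemma prime_factor_positive_degree:
  fixes D :: "'a::{factorial_ring_gcd,semiring_gcd_mult_normalize} poly"
  assumes "degree D > 0"
  obtains p where "prime_elem p" "p dvd D" "degree p > 0"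
proof -
  have D: "D \<noteq> 0" using assms by auto
  obtain M where M: "\<And>p. p \<in># M \<Longrightarrow> prime p" "normalize (prod_mset M) = normalize D"
    using prime_factorization_exists'[OF D] by blast
  have dvd: "p dvd D" if "p \<in># M" for p
  proof -
    have "p dvd normalize (prod_mset M)" using dvd_prod_mset[OF that] by simp
    then show ?thesis unfolding M(2) by simp
  qed
  have "\<exists>p\<in>#M. degree p > 0"
  proof (rule ccontr)
    assume "\<not> ?thesis"
    then have "degree p = 0" if "p \<in># M" for p using that by auto
    then have "degree (prod_mset M) = 0"
    proof (induction M)
      case (add p M)
      then have "degree p = 0" "degree (prod_mset M) = 0" by auto
      then show ?case using degree_mult_le[of p "prod_mset M"] by simp
    qed simp
    moreover have "D dvd prod_mset M" using M(2) by (metis associatedD2 dvd_normalize_iff dvd_refl)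
    moreover have "prod_mset M \<noteq> 0" using M(1)[THEN prime_imp_prime_elem] unfolding prod_mset_zero_iff
      by (auto dest: prime_elem_not_zeroI)
    ultimately show False using assms dvd_imp_degree_le[of D "prod_mset M"] by simp
  qed
  then show thesis using that M(1) dvd by auto
qed

text \<open>\<open>map_poly pderiv\<close> is the partial derivative in \<open>x\<close>, while
  \<open>pderiv\<close> itself is the one in \<open>y\<close>.\<close>

lemma map_poly_pderiv_diff: "map_poly pderiv (A - B) = map_poly pderiv A - map_poly pderiv B"
  for A B :: "'a::idom poly poly"
  by (rule poly_eqI) (simp add: coeff_map_poly pderiv_diff)

lemma map_poly_pderiv_mult:
  "map_poly pderiv (A * B) = map_poly pderiv A * B + A * map_poly pderiv B"
  for A B :: "'a::idom poly poly"
proof (rule poly_eqI)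
  fix k
  have "pderiv (coeff (A * B) k)
      = (\<Sum>i\<le>k. pderiv (coeff A i) * coeff B (k - i) + coeff A i * pderiv (coeff B (k - i)))"
    unfolding coeff_mult pderiv_sum by (intro sum.cong refl) (simp add: pderiv_mult mult.commute add.commute)
  then show "coeff (map_poly pderiv (A * B)) k = coeff (map_poly pderiv A * B + A * map_poly pderiv B) k"
    by (simp add: coeff_map_poly coeff_mult sum.distrib)
qed

lemma map_poly_pderiv_lift_outer: "map_poly pderiv (lift_outer p) = 0"
  for p :: "'a::idom poly"
  by (rule poly_eqI) (simp add: coeff_map_poly)

lemma map_poly_pderiv_const: "map_poly pderiv [:c:] = [:pderiv c:]"
  for c :: "'a::idom poly"
  by (rule poly_eqI) (simp add: coeff_map_poly coeff_pCons split: nat.splits)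

text \<open>The gradients of \<open>A\<close> and \<open>B\<close> are parallel along a common component \<open>p = 0\<close>.\<close>

lemma common_factor_dvd_jacobian:
  fixes A B p :: "'a::idom poly poly"
  assumes "p dvd A" "p dvd B"
  shows "p dvd map_poly pderiv A * pderiv B - pderiv A * map_poly pderiv B"
proof -
  obtain U V where UV: "A = p * U" "B = p * V" using assms by (auto elim!: dvdE)
  let ?D = "map_poly pderiv"
  have "?D A * pderiv B - pderiv A * ?D B
      = (?D p * U + p * ?D U) * (p * pderiv V + V * pderiv p)
        - (p * pderiv U + U * pderiv p) * (?D p * V + p * ?D V)"
    unfolding UV map_poly_pderiv_mult pderiv_mult by simp
  also have "\<dots> = p * (?D p * U * pderiv V + ?D U * (p * pderiv V + V * pderiv p)
      - pderiv U * (?D p * V + p * ?D V) - U * pderiv p * ?D V)"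
    by (simp add: algebra_simps)
  finally show ?thesis by (metis dvd_triv_left)
qed

text \<open>The linear polynomial is monic, so \<open>p\<close> can differ from it only by a
  unit.\<close>

lemma factor_of_linear:
  fixes p A :: "'a::field poly poly"
  assumes "degree p > 0" "p dvd [:- c, 1:]" "p dvd A"
  shows "poly A c = 0"
proof -
  obtain k where k: "[:- c, 1:] = p * k" using assms(2) by (elim dvdE)
  then have "k \<noteq> 0" "p \<noteq> 0" using assms(1) by auto
  moreover have "degree (p * k) = 1" unfolding k[symmetric] by simp
  ultimately have "degree p + degree k = 1" using degree_mult_eq[of p k] by simp
  then have "degree k = 0" using assms(1) by simp
  then obtain k0 where k0: "k = [:k0:]" by (elim degree_eq_zeroE)
  have "lead_coeff (p * k) = 1" unfolding k[symmetric] by simp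
  moreover have "lead_coeff k = k0" unfolding k0 by simp
  ultimately have lc: "lead_coeff p * k0 = 1" unfolding lead_coeff_mult by simp
  have "poly p c * k0 = poly [:- c, 1:] c" unfolding k k0 by simp
  then have "poly p c * k0 = 0" by simp
  then have "poly p c = 0" using lc by auto
  moreover obtain m where "A = p * m" using assms(3) by (elim dvdE)
  ultimately show ?thesis by simp
qed

text \<open>A polynomial in \<open>y\<close> alone splits into linear factors, so each of its
  components is a horizontal line.\<close>

lemma prime_factor_of_lift_outer:
  fixes p :: "'a::{alg_closed_field,factorial_ring_gcd,semiring_gcd_mult_normalize} poly poly"
  assumes p: "prime_elem p" "degree p > 0" and dvd: "p dvd lift_outer h" and h: "h \<noteq> 0"
  obtains y where "p dvd [:- [:y:], 1:]"
proof -
  obtain M where M: "h = smult (lead_coeff h) (\<Prod>y\<in>#M. [:- y, 1:])"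
    using alg_closed_imp_factorization[OF h] by blast
  have "lift_outer h = [:[:lead_coeff h:]:] * lift_outer (\<Prod>y\<in>#M. [:- y, 1:])"
    by (subst M) (simp add: coeff_lift_hom.map_poly_hom_smult)
  then have "p dvd [:[:lead_coeff h:]:] \<or> p dvd lift_outer (\<Prod>y\<in>#M. [:- y, 1:])"
    using dvd p(1) prime_elem_dvd_multD by metis
  moreover have "\<not> p dvd [:[:lead_coeff h:]:]"
    using p(2) h dvd_imp_degree_le[of p "[:[:lead_coeff h:]:]"] by auto
  ultimately have "p dvd lift_outer (\<Prod>y\<in>#M. [:- y, 1:])" by blast
  then have "\<exists>y. p dvd lift_outer [:- y, 1:]"
  proof (induction M)
    case empty
    then have "is_unit p" by simp
    then show ?case using p(1) by (simp add: prime_elem_def)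
  next
    case (add y M)
    have "lift_outer (\<Prod>y\<in>#add_mset y M. [:- y, 1:]) = lift_outer [:- y, 1:] * lift_outer (\<Prod>y\<in>#M. [:- y, 1:])"
      unfolding image_mset_add_mset prod_mset.add_mset by (rule lift_outer_hom.hom_mult)
    then show ?case using add p(1) prime_elem_dvd_multD by metis
  qed
  then obtain y where "p dvd lift_outer [:- y, 1:]" ..
  also have "lift_outer [:- y, 1:] = [:- [:y:], 1:]"
    by (simp add: coeff_lift_hom.map_poly_pCons_hom pCons_one)
  finally show thesis by (rule that)
qed


text \<open>
  The tangent line of the graph of \<open>G\<close> at \<open>x\<close> has slope \<open>G' x\<close> and intercept
  \<open>poly (intercept G) x\<close>; the equations below say that it is also the tangent line of the graph
  of \<open>H\<close> at \<open>y\<close>.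
\<close>

definition intercept :: "'a::idom poly \<Rightarrow> 'a poly" where
  "intercept G = G - pCons 0 (pderiv G)"

lemma pderiv_intercept: "pderiv (intercept G) = - pCons 0 (pderiv (pderiv G))"
  by (simp add: intercept_def pderiv_diff pderiv_pCons)

lemma degree_intercept_le: "degree (intercept G) \<le> degree G"
proof (cases "pderiv G = 0")
  case False
  have "degree (pCons 0 (pderiv G)) \<le> degree G"
  proof (cases "degree G")
    case 0
    then show ?thesis using False by (auto elim!: degree_eq_zeroE simp: pderiv_pCons)
  next
    case (Suc k)
    then show ?thesis using False degree_pderiv_le[of G] by simp
  qed
  then show ?thesis unfolding intercept_def by (intro degree_diff_le) auto
qed (simp add: intercept_def)

lemma lead_coeff_const_minus_lift_outer:
  fixes H :: "'a::idom poly"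
  assumes "degree H \<ge> 1"
  shows "lead_coeff ([:c:] - lift_outer H) = [:- lead_coeff H:]" "degree ([:c:] - lift_outer H) = degree H"
proof -
  have coeff: "coeff ([:c:] - lift_outer H) i = - [:coeff H i:]" if "i \<ge> 1" for i
    using that by (cases i) (auto simp: coeff_map_poly)
  have nz: "coeff ([:c:] - lift_outer H) (degree H) \<noteq> 0"
    using assms by (subst coeff) auto
  have le: "degree ([:c:] - lift_outer H) \<le> degree H"
    by (rule degree_diff_le) simp_all
  show deg: "degree ([:c:] - lift_outer H) = degree H" by (rule antisym[OF le le_degree[OF nz]])
  show "lead_coeff ([:c:] - lift_outer H) = [:- lead_coeff H:]"
    unfolding deg using assms by (subst coeff) auto
qed

lemma degree_coeff_const_minus_lift_outer:
  fixes H :: "'a::idom poly"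
  assumes "degree c \<le> n"
  shows "degree (coeff ([:c:] - lift_outer H) i) \<le> n"
proof -
  have "degree (coeff [:c:] i) \<le> n" using assms by (cases i) auto
  moreover have "degree (coeff (lift_outer H) i) \<le> n" by (simp add: coeff_map_poly)
  ultimately show ?thesis by (simp add: degree_diff_le)
qed

lemma degree_ge_1_of_pderiv: "pderiv p \<noteq> 0 \<Longrightarrow> degree p \<ge> 1"
  by (cases "degree p") (auto elim!: degree_eq_zeroE simp: pderiv_pCons)

text \<open>Of the three factors of the Jacobian, the second derivative in \<open>x\<close> has
  degree 0 in \<open>y\<close> and cannot contain \<open>p\<close>. The second derivative in
  \<open>y\<close> would make \<open>p\<close> a horizontal line, along which equality of slopes
  forces \<open>pderiv G\<close> to be constant. Only the diagonal is left.\<close>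

lemma bitangent_common_factor:
  fixes G H :: "'a::{alg_closed_field,factorial_ring_gcd,semiring_gcd_mult_normalize} poly"
  assumes G: "pderiv (pderiv G) \<noteq> 0" and H: "pderiv (pderiv H) \<noteq> 0"
    and p: "prime_elem p" "degree p > 0"
    and A: "p dvd [:pderiv G:] - lift_outer (pderiv H)"
    and B: "p dvd [:intercept G:] - lift_outer (intercept H)"
  shows "p dvd [:- [:0, 1:], 1:]"
proof -
  let ?A = "[:pderiv G:] - lift_outer (pderiv H)" and ?B = "[:intercept G:] - lift_outer (intercept H)"
  let ?G2 = "pderiv (pderiv G)" and ?H2 = "pderiv (pderiv H)"
  have DxA: "map_poly pderiv ?A = [:?G2:]"
    by (simp add: map_poly_pderiv_diff map_poly_pderiv_lift_outer map_poly_pderiv_const)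
  have DxB: "map_poly pderiv ?B = [:- pCons 0 ?G2:]"
    by (simp add: map_poly_pderiv_diff map_poly_pderiv_lift_outer map_poly_pderiv_const pderiv_intercept)
  have DyA: "pderiv ?A = - lift_outer ?H2"
    by (simp add: pderiv_diff pderiv_pCons flip: coeff_lift_hom.map_poly_pderiv)
  have "pderiv ?B = - lift_outer (pderiv (intercept H))"
    by (simp add: pderiv_diff pderiv_pCons flip: coeff_lift_hom.map_poly_pderiv)
  also have "\<dots> = lift_outer (pCons 0 ?H2)"
    unfolding pderiv_intercept
    by (rule poly_eqI) (simp add: coeff_map_poly coeff_pCons split: nat.splits)
  also have "\<dots> = pCons 0 (lift_outer ?H2)" by (simp add: coeff_lift_hom.map_poly_pCons_hom)
  finally have DyB: "pderiv ?B = pCons 0 (lift_outer ?H2)" .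
  have "map_poly pderiv ?A * pderiv ?B - pderiv ?A * map_poly pderiv ?B
      = [:?G2:] * (lift_outer ?H2 * [:- [:0, 1:], 1:])"
    unfolding DxA DxB DyA DyB by (simp add: algebra_simps)
  then have "p dvd [:?G2:] * (lift_outer ?H2 * [:- [:0, 1:], 1:])"
    using common_factor_dvd_jacobian[OF A B] by simp
  moreover have "\<not> p dvd [:?G2:]" using p(2) G dvd_imp_degree_le[of p "[:?G2:]"] by auto
  moreover have "\<not> p dvd lift_outer ?H2"
  proof
    assume "p dvd lift_outer ?H2"
    then obtain y where "p dvd [:- [:y:], 1:]" using prime_factor_of_lift_outer[OF p _ H] by blast
    then have "poly ?A [:y:] = 0" using factor_of_linear p(2) A by blast
    then have "pderiv G = [:poly (pderiv H) y:]" by (simp add: coeff_lift_hom.poly_map_poly)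
    then have "?G2 = 0" by (simp add: pderiv_pCons)
    then show False using G by simp
  qed
  ultimately show ?thesis using p(1) prime_elem_dvd_multD by metis
qed

text \<open>On the diagonal, equal slopes and equal intercepts mean \<open>G = H\<close>. So there
  is no common component, and elimination applies with degrees at most \<open>n - 1\<close> and
  \<open>n\<close> in \<open>y\<close>.\<close>

lemma bitangent:
  fixes G H :: "'a::{alg_closed_field,factorial_ring_gcd,semiring_gcd_mult_normalize} poly"
  assumes G: "pderiv (pderiv G) \<noteq> 0" and H: "pderiv (pderiv H) \<noteq> 0" and neq: "G \<noteq> H"
    and deg: "degree G \<le> n" "degree H \<le> n" "n \<ge> 1"
  obtains R where "R \<noteq> 0" "degree R \<le> n * (2 * n - 1)"
    "\<And>x y. poly (pderiv G) x = poly (pderiv H) y \<Longrightarrow> poly (intercept G) x = poly (intercept H) y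
      \<Longrightarrow> poly R x = 0"
proof -
  let ?A = "[:pderiv G:] - lift_outer (pderiv H)" and ?B = "[:intercept G:] - lift_outer (intercept H)"
  have degH': "degree (pderiv H) \<ge> 1" using degree_ge_1_of_pderiv[OF H] .
  have "pderiv (intercept H) \<noteq> 0" using H by (simp add: pderiv_intercept)
  then have degiH: "degree (intercept H) \<ge> 1" by (rule degree_ge_1_of_pderiv)
  have gcd: "degree (gcd ?A ?B) = 0"
  proof (rule ccontr)
    assume "degree (gcd ?A ?B) \<noteq> 0"
    then obtain p where p: "prime_elem p" "p dvd gcd ?A ?B" "degree p > 0"
      using prime_factor_positive_degree[of "gcd ?A ?B"] by blast
    then have dvd: "p dvd ?A" "p dvd ?B" by auto
    have lin: "p dvd [:- [:0, 1:], 1:]" using bitangent_common_factor[OF G H p(1,3) dvd] .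
    have "poly ?A [:0, 1:] = 0" "poly ?B [:0, 1:] = 0"
      using factor_of_linear[OF p(3) lin] dvd by blast+
    then have "pderiv G = pderiv H" "intercept G = intercept H"
      by (simp_all flip: pcompose_altdef add: pcompose_idR)
    then show False using neq by (simp add: intercept_def)
  qed
  obtain R where R: "R \<noteq> 0" "degree R \<le> n * (degree ?A + degree ?B)"
    "\<And>x y. poly (eval_inner x ?A) y = 0 \<Longrightarrow> poly (eval_inner x ?B) y = 0 \<Longrightarrow> poly R x = 0"
  proof (rule elimination[of ?A "- lead_coeff (pderiv H)" ?B "- lead_coeff (intercept H)" n])
    show "lead_coeff ?A = [:- lead_coeff (pderiv H):]" "lead_coeff ?B = [:- lead_coeff (intercept H):]"
      using lead_coeff_const_minus_lift_outer degH' degiH by blast+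
    show "- lead_coeff (pderiv H) \<noteq> 0" "- lead_coeff (intercept H) \<noteq> 0" using degH' degiH by auto
    show "degree (coeff ?A i) \<le> n" for i
      using deg degree_pderiv_le[of G] by (intro degree_coeff_const_minus_lift_outer) linarith
    show "degree (coeff ?B i) \<le> n" for i
      using deg degree_intercept_le[of G] by (intro degree_coeff_const_minus_lift_outer) linarith
  qed (use gcd in blast)+
  show thesis
  proof (rule that[OF R(1)])
    have "degree ?A + degree ?B \<le> 2 * n - 1"
      using deg degree_pderiv_le[of H] degree_intercept_le[of H]
        lead_coeff_const_minus_lift_outer(2)[OF degH'] lead_coeff_const_minus_lift_outer(2)[OF degiH]
      by simp
    then show "degree R \<le> n * (2 * n - 1)" using R(2) mult_le_mono2 order_trans by blast
    fix x y assume "poly (pderiv G) x = poly (pderiv H) y" "poly (intercept G) x = poly (intercept H) y"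
    then show "poly R x = 0"
      by (intro R(3)[of x y]) (simp_all add: eval_inner_hom.hom_minus)
  qed
qed


lemma degree_coeff_synthetic_div_le:
  "degree (coeff (synthetic_div (lift_outer p) [:0, 1:]) i) \<le> degree p"
  for p :: "'a::idom poly"
proof (induction p arbitrary: i)
  case (pCons a p)
  have eq: "synthetic_div (lift_outer (pCons a p)) [:0, 1:] = pCons p (synthetic_div (lift_outer p) [:0, 1:])"
    by (simp add: coeff_lift_hom.map_poly_pCons_hom synthetic_div_pCons pcompose_idR flip: pcompose_altdef)
  have "degree p \<le> degree (pCons a p)" by (cases "p = 0") auto
  moreover from this have "degree (coeff (synthetic_div (lift_outer p) [:0, 1:]) k) \<le> degree (pCons a p)" for k
    using pCons.IH order_trans by blast
  ultimately show ?case unfolding eq coeff_pCons by (cases i) simp_all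
qed simp

text \<open>For a single graph the diagonal does solve both equations. The slope equation is
  therefore replaced by the difference quotient \<open>S\<close> of \<open>pderiv G\<close>, whose
  value on the diagonal is the second derivative; hence the diagonal is no component of
  \<open>S\<close>.\<close>

lemma self_bitangent:
  fixes G :: "'a::{alg_closed_field,factorial_ring_gcd,semiring_gcd_mult_normalize} poly"
  assumes G: "pderiv (pderiv G) \<noteq> 0" and deg: "degree G \<le> n" "n \<ge> 1"
  obtains R where "R \<noteq> 0" "degree R \<le> n * (2 * n - 1)"
    "\<And>x y. x \<noteq> y \<Longrightarrow> poly (pderiv G) x = poly (pderiv G) y \<Longrightarrow> poly (intercept G) x = poly (intercept G) y
      \<Longrightarrow> poly R x = 0"
proof -
  let ?A = "[:pderiv G:] - lift_outer (pderiv G)" and ?B = "[:intercept G:] - lift_outer (intercept G)"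
  define S where "S = synthetic_div (lift_outer (pderiv G)) [:0, 1:]"
  let ?L = "[:- [:0, 1:], 1:] :: 'a poly poly"
  have degG': "degree (pderiv G) \<ge> 1" using degree_ge_1_of_pderiv[OF G] .
  have "pderiv (intercept G) \<noteq> 0" using G by (simp add: pderiv_intercept)
  then have degiG: "degree (intercept G) \<ge> 1" by (rule degree_ge_1_of_pderiv)
  have "?L * S + [:poly (lift_outer (pderiv G)) [:0, 1:]:] = lift_outer (pderiv G)"
    unfolding S_def by (rule synthetic_div_correct')
  then have S: "lift_outer (pderiv G) = ?L * S + [:pderiv G:]"
    by (simp add: pcompose_idR flip: pcompose_altdef)
  then have A: "?A = - (?L * S)" by simp
  have Snz: "S \<noteq> 0" using degG' unfolding S_def by (simp add: synthetic_div_eq_0_iff)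
  have lcS: "lead_coeff S = [:lead_coeff (pderiv G):]"
  proof -
    have "lead_coeff (- (?L * S)) = - lead_coeff S"
      unfolding lead_coeff_minus lead_coeff_mult by simp
    moreover have "lead_coeff (- (?L * S)) = [:- lead_coeff (pderiv G):]"
      unfolding A[symmetric] by (rule lead_coeff_const_minus_lift_outer(1)[OF degG'])
    ultimately have "- lead_coeff S = - [:lead_coeff (pderiv G):]" by simp
    then show ?thesis by (simp only: neg_equal_iff_equal)
  qed
  have gcd: "degree (gcd S ?B) = 0"
  proof (rule ccontr)
    assume "degree (gcd S ?B) \<noteq> 0"
    then obtain p where p: "prime_elem p" "p dvd gcd S ?B" "degree p > 0"
      using prime_factor_positive_degree[of "gcd S ?B"] by blast
    then have dvdS: "p dvd S" and dvdB: "p dvd ?B" by simp_all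
    have dvd: "p dvd ?A" "p dvd ?B"
      using dvdB dvd_mult[OF dvdS, of ?L] unfolding A dvd_minus_iff by blast+
    have lin: "p dvd ?L" using bitangent_common_factor[OF G G p(1,3) dvd] .
    have S0: "poly S [:0, 1:] = 0" using factor_of_linear[OF p(3) lin dvdS] .
    have "lift_outer (pderiv (pderiv G)) = pderiv (lift_outer (pderiv G))"
      by (rule coeff_lift_hom.map_poly_pderiv)
    also have "\<dots> = ?L * pderiv S + S"
      unfolding S pderiv_add pderiv_mult by (simp add: pderiv_pCons)
    finally have "poly (lift_outer (pderiv (pderiv G))) [:0, 1:] = 0" using S0 by simp
    then show False using G by (simp add: pcompose_idR flip: pcompose_altdef)
  qed
  obtain R where R: "R \<noteq> 0" "degree R \<le> n * (degree S + degree ?B)"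
    "\<And>x y. poly (eval_inner x S) y = 0 \<Longrightarrow> poly (eval_inner x ?B) y = 0 \<Longrightarrow> poly R x = 0"
  proof (rule elimination[of S "lead_coeff (pderiv G)" ?B "- lead_coeff (intercept G)" n])
    show "lead_coeff S = [:lead_coeff (pderiv G):]" "lead_coeff ?B = [:- lead_coeff (intercept G):]"
      using lcS lead_coeff_const_minus_lift_outer degiG by blast+
    show "lead_coeff (pderiv G) \<noteq> 0" "- lead_coeff (intercept G) \<noteq> 0" using degG' degiG by auto
    show "degree (coeff S i) \<le> n" for i
      using deg degree_pderiv_le[of G] degree_coeff_synthetic_div_le[of "pderiv G" i]
      unfolding S_def by linarith
    show "degree (coeff ?B i) \<le> n" for i
      using deg degree_intercept_le[of G] by (intro degree_coeff_const_minus_lift_outer) linarith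
  qed (use gcd in blast)+
  show thesis
  proof (rule that[OF R(1)])
    have "degree S + degree ?B \<le> 2 * n - 1"
      using deg degree_pderiv_le[of G] degree_intercept_le[of G]
        lead_coeff_const_minus_lift_outer(2)[OF degiG]
      by (simp add: S_def degree_synthetic_div)
    then show "degree R \<le> n * (2 * n - 1)" using R(2) mult_le_mono2 order_trans by blast
    fix x y assume xy: "x \<noteq> y" and eq: "poly (pderiv G) x = poly (pderiv G) y"
      "poly (intercept G) x = poly (intercept G) y"
    have L: "eval_inner x ?L = [:- x, 1:]" by (simp add: map_poly_pCons)
    have "pderiv G = eval_inner x (?L * S + [:pderiv G:])"
      unfolding S[symmetric] by simp
    also have "\<dots> = [:- x, 1:] * eval_inner x S + [:poly (pderiv G) x:]"
      by (simp only: eval_inner_hom.hom_add eval_inner_hom.hom_mult L eval_inner_const)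
    finally have "poly (pderiv G) y = poly ([:- x, 1:] * eval_inner x S + [:poly (pderiv G) x:]) y"
      by (rule arg_cong)
    also have "\<dots> = (y - x) * poly (eval_inner x S) y + poly (pderiv G) x"
      unfolding poly_add poly_mult by (simp add: algebra_simps)
    finally have "poly (pderiv G) y = (y - x) * poly (eval_inner x S) y + poly (pderiv G) x" .
    then have "poly (eval_inner x S) y = 0" using xy eq(1) by simp
    then show "poly R x = 0"
      using eq by (intro R(3)[of x y]) (simp_all add: eval_inner_hom.hom_minus)
  qed
qed

section \<open>Sums along lines\<close>

text \<open>The roots of \<open>crit_poly f\<close> are the negatives of the critical values of \<open>f\<close>.\<close>

definition crit_poly :: "'a::{field,finite} poly \<Rightarrow> 'a poly" where
  "crit_poly f = map_poly of_ac (\<Prod>x\<in>#proots (ac_poly (pderiv f)). [:poly (ac_poly f) x, 1:])"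

lemma ac_poly_crit_poly:
  "ac_poly (crit_poly f) = (\<Prod>x\<in>#proots (ac_poly (pderiv f)). [:poly (ac_poly f) x, 1:])"
proof -
  let ?h = "\<lambda>x. poly (ac_poly f) x" and ?M = "proots (ac_poly (pderiv f))"
  have "map_poly frob (\<Prod>x\<in>#M. [:?h x, 1:]) = (\<Prod>x\<in>#image_mset frob M. [:?h x, 1:])" for M
    by (induction M) (simp_all add: frob_poly_hom.hom_mult frob_poly del: mult_pCons_left)
  then have "map_poly frob (\<Prod>x\<in>#?M. [:?h x, 1:]) = (\<Prod>x\<in>#?M. [:?h x, 1:])"
    by (simp only: frob_proots)
  then obtain p where p: "(\<Prod>x\<in>#?M. [:?h x, 1:]) = ac_poly p" by (rule frob_poly_fixed)
  have "map_poly of_ac (ac_poly p) = p" by (rule poly_eqI) (simp add: coeff_map_poly)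
  then show ?thesis unfolding crit_poly_def p by simp
qed

lemma proots_crit_poly:
  "proots (ac_poly (crit_poly f)) = image_mset (\<lambda>x. - poly (ac_poly f) x) (proots (ac_poly (pderiv f)))"
  using proots_prod_mset_linear[of "image_mset (\<lambda>x. - poly (ac_poly f) x) (proots (ac_poly (pderiv f)))"]
  by (simp add: ac_poly_crit_poly multiset.map_comp comp_def)

lemma crit_poly_neq_0: "crit_poly f \<noteq> 0"
proof
  assume "crit_poly f = 0"
  then have "ac_poly (crit_poly f) = 0" by simp
  then show False unfolding ac_poly_crit_poly by (auto simp: prod_mset_zero_iff)
qed

lemma degree_crit_poly: "degree (crit_poly f) = degree (pderiv f)"
proof -
  have "degree (crit_poly f) = size (proots (ac_poly (crit_poly f)))"
    by (simp add: size_proots_alg_closed)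
  then show ?thesis by (simp add: proots_crit_poly size_proots_alg_closed)
qed

lemma poly_crit_poly: "poly (crit_poly f) b = root_prod (pderiv f) (f + [:b:])"
proof -
  have "to_ac (poly (crit_poly f) b) = poly (ac_poly (crit_poly f)) (to_ac b)"
    by simp
  also have "\<dots> = to_ac (root_prod (pderiv f) (f + [:b:]))"
    by (simp add: ac_poly_crit_poly to_ac_root_prod poly_prod_mset multiset.map_comp comp_def
        to_ac_poly_hom.hom_add to_ac_hom.map_poly_pCons_hom)
  finally show ?thesis by (simp only: to_ac_eq_iff)
qed

lemma pderiv_add_const: "pderiv (f + [:b:]) = pderiv f"
  by (simp add: pderiv_add pderiv_pCons)

lemma poly_moebius_add_const:
  fixes f :: "'a::{field,finite} poly"
  assumes odd: "odd CARD('a)" and monic: "lead_coeff f = 1" and deg: "degree f \<ge> 1"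
    and deriv: "pderiv f \<noteq> 0"
  obtains s where "\<bar>s\<bar> = 1" "\<And>b. poly_moebius (f + [:b:]) = s * quad_char (poly (crit_poly f) b)"
proof -
  define n where "n = degree f"
  define c where "c = lead_coeff (pderiv f) ^ n * (-1) ^ (n * degree (pderiv f))"
  define C where "C = (-1) ^ (n choose 2) * c"
  have C: "C \<noteq> 0" using deriv by (simp add: C_def c_def)
  show thesis
  proof (rule that[of "(-1) ^ n * quad_char C"])
    show "\<bar>(-1) ^ n * quad_char C\<bar> = 1"
      using abs_quad_char_eq_1[OF C] by (simp add: abs_mult power_abs)
    fix b
    let ?f = "f + [:b:]"
    have deg_f: "degree ?f = n" unfolding n_def using deg by (intro degree_add_eq_left) simp
    have "coeff ?f n = 1" using monic deg unfolding n_def by (cases "degree f") simp_all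
    then have monic_f: "lead_coeff ?f = 1" by (simp only: deg_f)
    have "discr ?f = (-1) ^ (n choose 2) * root_prod ?f (pderiv f)"
      unfolding discr_def deg_f pderiv_add_const ..
    also have "root_prod ?f (pderiv f) = c * root_prod (pderiv f) ?f"
      using root_prod_swap[OF monic_f deriv] unfolding deg_f c_def .
    finally have "discr ?f = C * poly (crit_poly f) b"
      unfolding poly_crit_poly C_def by (simp only: mult.assoc)
    then show "poly_moebius ?f = (-1) ^ n * quad_char C * quad_char (poly (crit_poly f) b)"
      unfolding pellet[OF odd monic_f] deg_f by (simp only: quad_char_mult[OF odd] mult.assoc)
  qed
qed

lemma abs_poly_moebius_le: "\<bar>poly_moebius f\<bar> \<le> 1"
  by (simp add: poly_moebius_def power_abs)

text \<open>In \<open>u^2 * f = c * v^2\<close> the order at \<open>x\<close> would be odd on the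
  left and even on the right. The other roots of \<open>f\<close> may have any multiplicity.\<close>

lemma nonsquare_of_simple_root:
  fixes f :: "'a::field poly"
  assumes f: "f \<noteq> 0" and order: "order x (ac_poly f) = 1"
  shows "nonsquare f"
  unfolding nonsquare_def
proof (intro allI impI)
  fix u v :: "'a poly" and c
  assume c: "c \<noteq> 0" and eq: "u\<^sup>2 * f = smult c (v\<^sup>2)"
  show "u = 0"
  proof (rule ccontr)
    assume u: "u \<noteq> 0"
    have "smult c (v\<^sup>2) \<noteq> 0" using u f eq by (metis mult_eq_0_iff power2_eq_square)
    then have v: "v \<noteq> 0" by auto
    let ?U = "ac_poly u" and ?V = "ac_poly v"
    have "order x (ac_poly (u\<^sup>2 * f)) = 2 * order x ?U + 1"
      using u f order
      by (simp add: to_ac_poly_hom.hom_mult power2_eq_square order_mult)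
    moreover have "order x (ac_poly (smult c (v\<^sup>2))) = 2 * order x ?V"
      using v c
      by (simp add: to_ac_hom.map_poly_hom_smult to_ac_poly_hom.hom_mult power2_eq_square order_mult order_smult)
    ultimately have "2 * order x ?U + 1 = 2 * order x ?V" using eq by simp
    then show False by presburger
  qed
qed

lemma order_eq_1_of_pderiv:
  fixes f :: "'a::field poly"
  assumes "poly f x = 0" "poly (pderiv f) x \<noteq> 0"
  shows "order x f = 1"
proof -
  obtain k where k: "f = [:- x, 1:] * k" using assms(1) by (auto simp: poly_eq_0_iff_dvd elim: dvdE)
  have "pderiv f = [:- x, 1:] * pderiv k + k" unfolding k pderiv_mult by (simp add: pderiv_pCons)
  then have kx: "poly k x \<noteq> 0" using assms(2) by simp
  have "f \<noteq> 0" using assms(2) by auto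
  then have "order x f = order x [:- x, 1:] + order x k" unfolding k by (rule order_mult)
  moreover have "order x k = 0" using kx by (simp add: order_root)
  moreover have "order x [:- x, 1:] = 1" using order_power_n_n[of x 1] by simp
  ultimately show ?thesis by simp
qed

text \<open>\<open>I\<close> and \<open>J\<close> hold the indices with exponents 1 and 2. The
  factors from \<open>I\<close> combine to the character of \<open>Q\<close>, up to a sign; those
  from \<open>J\<close> are the indicator of the complement of \<open>Z\<close>, so they change the
  sum by at most \<open>card Z\<close>.\<close>

lemma moebius_line_bound:
  fixes F :: "'i \<Rightarrow> 'a::{field,finite} poly"
  assumes odd: "odd CARD('a)" and fin: "finite I" "finite J"
    and monic: "\<And>j. j \<in> I \<union> J \<Longrightarrow> lead_coeff (F j) = 1"
    and deg: "\<And>j. j \<in> I \<union> J \<Longrightarrow> degree (F j) = n" and n: "n \<ge> 1"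
    and deriv: "\<And>j. j \<in> I \<union> J \<Longrightarrow> pderiv (F j) \<noteq> 0"
    and i: "i \<in> I"
    and root: "poly (ac_poly (pderiv (F i))) x = 0" "poly (ac_poly (pderiv (pderiv (F i)))) x \<noteq> 0"
    and uniq: "\<And>j y. j \<in> I \<Longrightarrow> poly (ac_poly (pderiv (F j))) y = 0
      \<Longrightarrow> poly (ac_poly (F j)) y = poly (ac_poly (F i)) x \<Longrightarrow> j = i \<and> y = x"
  shows "real_of_int \<bar>\<Sum>b\<in>UNIV. (\<Prod>j\<in>I. poly_moebius (F j + [:b:])) * (\<Prod>j\<in>J. poly_moebius (F j + [:b:]) ^ 2)\<bar>
    \<le> 2 * (real (card I * (n - 1)) + 2) * sqrt (real CARD('a)) + real (card J * (n - 1))"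
proof -
  define Q where "Q = (\<Prod>j\<in>I. crit_poly (F j))"
  have Qnz: "Q \<noteq> 0" using fin by (simp add: Q_def crit_poly_neq_0)
  have degc: "degree (crit_poly (F j)) \<le> n - 1" if "j \<in> I \<union> J" for j
    using deg[OF that] degree_pderiv_le[of "F j"] by (simp add: degree_crit_poly)
  have "degree Q \<le> (\<Sum>j\<in>I. degree (crit_poly (F j)))"
    unfolding Q_def using degree_prod_sum_le[OF fin(1), of "\<lambda>j. crit_poly (F j)"] by (simp add: comp_def)
  also have "\<dots> \<le> card I * (n - 1)"
    using sum_bounded_above[of I "\<lambda>j. degree (crit_poly (F j))" "n - 1"] degc by simp
  finally have degQ: "degree Q \<le> card I * (n - 1)" .
  define t where "t = - poly (ac_poly (F i)) x"
  let ?M = "\<lambda>j. proots (ac_poly (pderiv (F j)))"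
  \<comment> \<open>By \<open>uniq\<close> the critical value belonging to \<open>t\<close> is taken
    only at \<open>x\<close> and only for the index \<open>i\<close>, and \<open>x\<close> is a
    simple critical point. So \<open>t\<close> is a simple root of \<open>Q\<close>.\<close>
  have count: "count (image_mset (\<lambda>x. - poly (ac_poly (F j)) x) (?M j)) t = (if j = i then 1 else 0)"
    if j: "j \<in> I" for j
  proof -
    have "(\<lambda>x. - poly (ac_poly (F j)) x) -` {t} \<inter> set_mset (?M j) = (if j = i then {x} else {})"
      using uniq[OF j] deriv[of j] deriv[of i] root i j by (auto simp: t_def)
    moreover have "count (?M i) x = 1"
    proof -
      have "order x (ac_poly (pderiv (F i))) = 1"
        using root by (intro order_eq_1_of_pderiv) (simp_all flip: to_ac_hom.map_poly_pderiv)
      then show ?thesis using deriv[of i] i by simp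
    qed
    ultimately show ?thesis unfolding count_image_mset by simp
  qed
  have "order t (ac_poly Q) = count (proots (ac_poly Q)) t" using Qnz by simp
  also have "proots (ac_poly Q) = (\<Sum>j\<in>I. proots (ac_poly (crit_poly (F j))))"
    unfolding Q_def to_ac_poly_hom.hom_prod by (rule proots_prod) (simp add: crit_poly_neq_0)
  also have "count \<dots> t = (\<Sum>j\<in>I. if j = i then 1 else 0)"
    unfolding count_sum proots_crit_poly by (intro sum.cong refl count)
  also have "\<dots> = 1" using i fin by simp
  finally have nonsq: "nonsquare Q" by (rule nonsquare_of_simple_root[OF Qnz])
  have "\<forall>j\<in>I. \<exists>s. \<bar>s\<bar> = 1 \<and> (\<forall>b. poly_moebius (F j + [:b:]) = s * quad_char (poly (crit_poly (F j)) b))"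
  proof
    fix j assume "j \<in> I"
    then have j: "j \<in> I \<union> J" by simp
    have "degree (F j) \<ge> 1" using deg[OF j] n by simp
    from poly_moebius_add_const[OF odd monic[OF j] this deriv[OF j]]
    show "\<exists>s. \<bar>s\<bar> = 1 \<and> (\<forall>b. poly_moebius (F j + [:b:]) = s * quad_char (poly (crit_poly (F j)) b))"
      by metis
  qed
  then obtain s where s: "\<And>j. j \<in> I \<Longrightarrow> \<bar>s j\<bar> = 1"
    "\<And>j b. j \<in> I \<Longrightarrow> poly_moebius (F j + [:b:]) = s j * quad_char (poly (crit_poly (F j)) b)"
    by metis
  define s' where "s' = (\<Prod>j\<in>I. s j)"
  have s': "\<bar>s'\<bar> = 1" unfolding s'_def abs_prod using s(1) by (simp add: prod.neutral)
  have qprod: "(\<Prod>j\<in>I. quad_char (poly (crit_poly (F j)) b)) = quad_char (poly Q b)" for b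
  proof -
    have one: "quad_char (1 :: 'a) = 1" by (simp add: quad_char_def)
    have "(\<Prod>j\<in>I. quad_char (h j)) = quad_char (\<Prod>j\<in>I. h j)" for h :: "'i \<Rightarrow> 'a"
      using fin(1) by (induction I rule: finite_induct) (simp_all add: one quad_char_mult[OF odd])
    then show ?thesis by (simp add: Q_def poly_prod)
  qed
  define w where "w b = (\<Prod>j\<in>J. poly_moebius (F j + [:b:]) ^ 2)" for b
  define Z where "Z = (\<Union>j\<in>J. {b. poly (crit_poly (F j)) b = 0})"
  have w: "w b = (if b \<in> Z then 0 else 1)" for b
  proof -
    have *: "poly_moebius (F j + [:b:]) ^ 2 = (if poly (crit_poly (F j)) b = 0 then 0 else 1)" if "j \<in> J" for j
    proof -
      have j: "j \<in> I \<union> J" using that by simp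
      have "degree (F j) \<ge> 1" using deg[OF j] n by simp
      from poly_moebius_add_const[OF odd monic[OF j] this deriv[OF j]]
      obtain u where u: "\<bar>u\<bar> = 1" "\<And>b. poly_moebius (F j + [:b:]) = u * quad_char (poly (crit_poly (F j)) b)"
        by metis
      have "poly_moebius (F j + [:b:]) ^ 2 = \<bar>u * quad_char (poly (crit_poly (F j)) b)\<bar> ^ 2"
        unfolding u(2) by simp
      also have "\<dots> = (if poly (crit_poly (F j)) b = 0 then 0 else 1)"
      proof (cases "poly (crit_poly (F j)) b = 0")
        case False
        show ?thesis unfolding abs_mult u(1) abs_quad_char_eq_1[OF False] using False by simp
      qed simp
      finally show ?thesis .
    qed
    have "w b = (\<Prod>j\<in>J. if poly (crit_poly (F j)) b = 0 then 0 else 1)"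
      unfolding w_def by (intro prod.cong refl *)
    also have "\<dots> = (if b \<in> Z then 0 else 1)"
      using fin(2) by (auto simp: Z_def prod_zero_iff intro!: prod.neutral)
    finally show ?thesis .
  qed
  have cardZ: "card Z \<le> card J * (n - 1)"
  proof -
    have "card Z \<le> (\<Sum>j\<in>J. card {b. poly (crit_poly (F j)) b = 0})"
      unfolding Z_def by (rule card_UN_le[OF fin(2)])
    also have "\<dots> \<le> (\<Sum>j\<in>J. n - 1)"
    proof (rule sum_mono)
      fix j assume "j \<in> J"
      then have "j \<in> I \<union> J" by simp
      then show "card {b. poly (crit_poly (F j)) b = 0} \<le> n - 1"
        using card_poly_roots_bound[OF crit_poly_neq_0] degc order_trans by blast
    qed
    finally show ?thesis by simp
  qed
  have "(\<Sum>b\<in>UNIV. (\<Prod>j\<in>I. poly_moebius (F j + [:b:])) * w b)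
      = (\<Sum>b\<in>UNIV. s' * quad_char (poly Q b) - (if b \<in> Z then s' * quad_char (poly Q b) else 0))"
  proof (intro sum.cong refl)
    fix b
    have "(\<Prod>j\<in>I. poly_moebius (F j + [:b:])) = s' * quad_char (poly Q b)"
      using s(2) by (simp add: s'_def prod.distrib flip: qprod)
    then show "(\<Prod>j\<in>I. poly_moebius (F j + [:b:])) * w b
        = s' * quad_char (poly Q b) - (if b \<in> Z then s' * quad_char (poly Q b) else 0)"
      by (simp add: w)
  qed
  also have "\<dots> = s' * (\<Sum>b\<in>UNIV. quad_char (poly Q b)) - (\<Sum>b\<in>Z. s' * quad_char (poly Q b))"
    unfolding sum_subtractf sum_distrib_left[symmetric]
    by (simp add: sum.inter_restrict[of UNIV _ Z, simplified, symmetric] sum_distrib_left)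
  also have "\<bar>\<dots>\<bar> \<le> \<bar>s' * (\<Sum>b\<in>UNIV. quad_char (poly Q b))\<bar> + \<bar>\<Sum>b\<in>Z. s' * quad_char (poly Q b)\<bar>"
    by (rule abs_triangle_ineq4)
  also have "\<bar>s' * (\<Sum>b\<in>UNIV. quad_char (poly Q b))\<bar> = \<bar>\<Sum>b\<in>UNIV. quad_char (poly Q b)\<bar>"
    unfolding abs_mult s' by simp
  also have "\<bar>\<Sum>b\<in>Z. s' * quad_char (poly Q b)\<bar> \<le> (\<Sum>b\<in>Z. 1)"
    by (rule order_trans[OF sum_abs sum_mono]) (simp add: abs_mult s' abs_quad_char_le)
  finally have "\<bar>\<Sum>b\<in>UNIV. (\<Prod>j\<in>I. poly_moebius (F j + [:b:])) * w b\<bar>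
      \<le> \<bar>\<Sum>b\<in>UNIV. quad_char (poly Q b)\<bar> + int (card Z)" by simp
  then have "real_of_int \<bar>\<Sum>b\<in>UNIV. (\<Prod>j\<in>I. poly_moebius (F j + [:b:])) * w b\<bar>
      \<le> real_of_int (\<bar>\<Sum>b\<in>UNIV. quad_char (poly Q b)\<bar> + int (card Z))"
    by (simp only: of_int_le_iff)
  also have "\<dots> = real_of_int \<bar>\<Sum>b\<in>UNIV. quad_char (poly Q b)\<bar> + real (card Z)"
    by (simp only: of_int_add of_int_of_nat_eq)
  also have "\<dots> \<le> 2 * (real (degree Q) + 2) * sqrt (real CARD('a)) + real (card J * (n - 1))"
    using abs_sum_quad_char_poly_le[OF odd nonsq] cardZ by (intro add_mono) (simp_all only: of_nat_le_iff)
  also have "2 * (real (degree Q) + 2) * sqrt (real CARD('a))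
      \<le> 2 * (real (card I * (n - 1)) + 2) * sqrt (real CARD('a))"
    using degQ by (intro mult_right_mono mult_left_mono add_right_mono) (simp_all only: of_nat_le_iff, simp_all)
  finally show ?thesis unfolding w_def by simp
qed


section \<open>Splitting off the two lowest coefficients\<close>

lemma monic_polys_eq:
  assumes "n \<ge> 2"
  shows "monic_polys n = (\<lambda>(p, a, b). monom 1 n + pCons b (pCons a p)) ` (polys_below (n - 2) \<times> UNIV \<times> UNIV)"
proof (intro equalityI subsetI)
  fix F :: "'a poly" assume "F \<in> monic_polys n"
  then have F: "coeff F n = 1" "degree F = n" by (auto simp: monic_polys_def)
  have "F - monom 1 n \<in> polys_below n"
    unfolding polys_below_def using F by (auto simp: le_less coeff_eq_0)
  moreover obtain b a p where p: "F - monom 1 n = pCons b (pCons a p)" by (metis pCons_cases)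
  ultimately have below: "pCons b (pCons a p) \<in> polys_below n" by simp
  have "p \<in> polys_below (n - 2)"
    unfolding polys_below_def
  proof (intro CollectI allI impI)
    fix k assume "n - 2 \<le> k"
    then have "n \<le> Suc (Suc k)" by linarith
    with below have "coeff (pCons b (pCons a p)) (Suc (Suc k)) = 0" unfolding polys_below_def by blast
    then show "coeff p k = 0" by simp
  qed
  moreover have "F = monom 1 n + pCons b (pCons a p)" using p by (metis add.commute diff_add_cancel)
  ultimately show "F \<in> (\<lambda>(p, a, b). monom 1 n + pCons b (pCons a p)) ` (polys_below (n - 2) \<times> UNIV \<times> UNIV)"
    by (intro image_eqI[of _ _ "(p, a, b)"]) auto
next
  fix F :: "'a poly"
  assume "F \<in> (\<lambda>(p, a, b). monom 1 n + pCons b (pCons a p)) ` (polys_below (n - 2) \<times> UNIV \<times> UNIV)"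
  then obtain p a b where F: "F = monom 1 n + pCons b (pCons a p)" and p: "p \<in> polys_below (n - 2)" by auto
  have low: "coeff (pCons b (pCons a p)) i = 0" if "i \<ge> n" for i
  proof -
    obtain k where "i = Suc (Suc k)" using \<open>i \<ge> n\<close> assms by (metis Suc_le_D numeral_2_eq_2 order_trans Suc_le_mono)
    then show ?thesis using that p by (auto simp: polys_below_def)
  qed
  have "coeff F n = 1" "coeff F i = 0" if "i > n" for i
    using low that by (simp_all add: F)
  then have "coeff F n = 1" "\<forall>i>n. coeff F i = 0" using low by (auto simp: F)
  then have "degree F = n" by (metis degree_le le_antisym le_degree zero_neq_one)
  then show "F \<in> monic_polys n" using \<open>coeff F n = 1\<close> by (simp add: monic_polys_def)
qed

lemma sum_monic_polys:
  fixes T :: "'a::{field,finite} poly \<Rightarrow> int"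
  assumes "n \<ge> 2"
  shows "(\<Sum>F\<in>monic_polys n. T F)
    = (\<Sum>p\<in>polys_below (n - 2). \<Sum>a\<in>UNIV. \<Sum>b\<in>UNIV. T (monom 1 n + pCons b (pCons a p)))"
proof -
  let ?f = "\<lambda>(p :: 'a poly, a, b). monom 1 n + pCons b (pCons a p)"
  have "inj_on ?f (polys_below (n - 2) \<times> UNIV \<times> UNIV)" by (auto simp: inj_on_def)
  then have "(\<Sum>F\<in>monic_polys n. T F) = (\<Sum>x\<in>polys_below (n - 2) \<times> UNIV \<times> UNIV. T (?f x))"
    unfolding monic_polys_eq[OF assms] by (simp add: sum.reindex)
  also have "\<dots> = (\<Sum>p\<in>polys_below (n - 2). \<Sum>a\<in>UNIV. \<Sum>b\<in>UNIV. T (monom 1 n + pCons b (pCons a p)))"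
    unfolding sum.cartesian_product by (simp add: case_prod_unfold)
  finally show ?thesis .
qed

text \<open>The constant coefficient of a second derivative is twice the coefficient of
  \<open>X^2\<close>, and 2 is invertible; so vanishing prescribes the lowest coefficient of
  \<open>p\<close>. For \<open>n = 2\<close> the coefficient in question is 1 and there is no such
  \<open>p\<close>; the factor \<open>CARD('a)\<close> on the left covers this case without a
  negative exponent.\<close>

lemma card_second_pderiv_eq_0:
  fixes \<alpha> :: "'a::{field,finite} poly"
  assumes odd: "odd CARD('a)" and n: "n \<ge> 2" and \<alpha>: "degree \<alpha> < n"
  shows "card {p \<in> polys_below (n - 2). pderiv (pderiv (monom 1 n + pCons 0 (pCons 0 p) + \<alpha>)) = 0} * CARD('a)
    \<le> CARD('a) ^ (n - 2)"
proof -
  let ?S = "{p \<in> polys_below (n - 2). pderiv (pderiv (monom 1 n + pCons 0 (pCons 0 p) + \<alpha>)) = 0}"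
  have two: "(2 :: 'a) \<noteq> 0" using one_neq_minus_one[OF odd] by (metis add_eq_0_iff one_add_one)
  have coeff2: "coeff (monom 1 n + pCons 0 (pCons 0 p) + \<alpha>) 2 = 0" if "p \<in> ?S" for p
  proof -
    have "coeff (pderiv (pderiv (monom 1 n + pCons 0 (pCons 0 p) + \<alpha>))) 0 = 0" using that by simp
    moreover have "coeff (pderiv (pderiv q)) 0 = 2 * coeff q 2" for q :: "'a poly"
      by (simp add: coeff_pderiv numeral_2_eq_2)
    ultimately show ?thesis using two by (metis mult_eq_0_iff)
  qed
  show ?thesis
  proof (cases "n = 2")
    case True
    have "p \<notin> ?S" for p
    proof
      assume p: "p \<in> ?S"
      then have "p = 0" using True by (simp add: polys_below_0)
      then show False using coeff2[OF p] True \<alpha> by (simp add: coeff_eq_0)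
    qed
    then have S: "?S = {}" by blast
    show ?thesis unfolding S by simp
  next
    case False
    define m where "m = n - 3"
    have m: "n - 2 = Suc m" using False n by (simp add: m_def)
    have "?S \<subseteq> (\<lambda>p. pCons (- coeff \<alpha> 2) p) ` polys_below m"
    proof
      fix p assume p: "p \<in> ?S"
      then have "p \<in> polys_below (Suc m)" by (simp add: m)
      then obtain c p' where p': "p = pCons c p'" "p' \<in> polys_below m" by (auto simp: polys_below_Suc)
      have "c + coeff \<alpha> 2 = 0" using coeff2[OF p] False p' by (simp add: numeral_2_eq_2)
      then have "c = - coeff \<alpha> 2" by (simp add: eq_neg_iff_add_eq_0)
      then show "p \<in> (\<lambda>p. pCons (- coeff \<alpha> 2) p) ` polys_below m" using p' by blast
    qed
    then have "card ?S \<le> card ((\<lambda>p. pCons (- coeff \<alpha> 2) p) ` (polys_below m :: 'a poly set))"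
      by (intro card_mono finite_imageI finite_polys_below)
    also have "\<dots> \<le> card (polys_below m :: 'a poly set)" by (rule card_image_le[OF finite_polys_below])
    also have "\<dots> = CARD('a) ^ m" by (rule card_polys_below)
    finally have "card ?S * CARD('a) \<le> CARD('a) ^ m * CARD('a)" by (rule mult_right_mono) simp
    then show ?thesis unfolding m by (simp only: power_Suc mult.commute)
  qed
qed

text \<open>A slope is bad only if it is minus the derivative of \<open>G i\<close> at a point of
  \<open>E\<close>, that is, at a zero of the second derivative or at a root of one of the
  resultants. Each point of \<open>E\<close> spoils at most one slope.\<close>

lemma card_bad_slopes:
  fixes G :: "'i \<Rightarrow> 'a::{field,finite} poly"
  assumes fin: "finite I" and i: "i \<in> I" and inj: "inj_on G I"
    and second: "\<And>j. j \<in> I \<Longrightarrow> pderiv (pderiv (G j)) \<noteq> 0"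
    and deg: "\<And>j. j \<in> I \<Longrightarrow> degree (G j) \<le> n" and n: "n \<ge> 1"
  obtains A where "card A \<le> n + card I * (n * (2 * n - 1))"
    "\<forall>a. a \<notin> A \<longrightarrow> (\<exists>x. poly (ac_poly (pderiv (G i + [:0, a:]))) x = 0
      \<and> poly (ac_poly (pderiv (pderiv (G i + [:0, a:])))) x \<noteq> 0
      \<and> (\<forall>j\<in>I. \<forall>y. poly (ac_poly (pderiv (G j + [:0, a:]))) y = 0
          \<longrightarrow> poly (ac_poly (G j + [:0, a:])) y = poly (ac_poly (G i + [:0, a:])) x \<longrightarrow> j = i \<and> y = x))"
proof -
  let ?G = "\<lambda>j. ac_poly (G j)"
  have acp: "ac_poly (pderiv p) = pderiv (ac_poly p)" for p :: "'a poly"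
    by (rule to_ac_hom.map_poly_pderiv)
  have second': "pderiv (pderiv (?G j)) \<noteq> 0" if "j \<in> I" for j
    using second[OF that] unfolding acp[symmetric] by simp
  have "\<forall>j\<in>I. \<exists>R. R \<noteq> 0 \<and> degree R \<le> n * (2 * n - 1) \<and>
    (\<forall>x y. (j \<noteq> i \<or> x \<noteq> y) \<longrightarrow> poly (pderiv (?G i)) x = poly (pderiv (?G j)) y \<longrightarrow>
      poly (intercept (?G i)) x = poly (intercept (?G j)) y \<longrightarrow> poly R x = 0)"
  proof
    fix j assume j: "j \<in> I"
    have degs: "degree (?G i) \<le> n" "degree (?G j) \<le> n" using deg i j by simp_all
    show "\<exists>R. R \<noteq> 0 \<and> degree R \<le> n * (2 * n - 1) \<and>
      (\<forall>x y. (j \<noteq> i \<or> x \<noteq> y) \<longrightarrow> poly (pderiv (?G i)) x = poly (pderiv (?G j)) y \<longrightarrow>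
        poly (intercept (?G i)) x = poly (intercept (?G j)) y \<longrightarrow> poly R x = 0)"
    proof (cases "j = i")
      case True
      obtain R where "R \<noteq> 0" "degree R \<le> n * (2 * n - 1)"
        "\<And>x y. x \<noteq> y \<Longrightarrow> poly (pderiv (?G i)) x = poly (pderiv (?G i)) y
          \<Longrightarrow> poly (intercept (?G i)) x = poly (intercept (?G i)) y \<Longrightarrow> poly R x = 0"
        using self_bitangent[OF second'[OF i] degs(1) n] by blast
      then show ?thesis using True by blast
    next
      case False
      then have "?G i \<noteq> ?G j" using inj_onD[OF inj _ i j] by auto
      then obtain R where "R \<noteq> 0" "degree R \<le> n * (2 * n - 1)"
        "\<And>x y. poly (pderiv (?G i)) x = poly (pderiv (?G j)) y
          \<Longrightarrow> poly (intercept (?G i)) x = poly (intercept (?G j)) y \<Longrightarrow> poly R x = 0"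
        using bitangent[OF second'[OF i] second'[OF j] _ degs n] by blast
      then show ?thesis by blast
    qed
  qed
  then obtain R where R: "\<And>j. j \<in> I \<Longrightarrow> R j \<noteq> 0" "\<And>j. j \<in> I \<Longrightarrow> degree (R j) \<le> n * (2 * n - 1)"
    "\<And>j x y. j \<in> I \<Longrightarrow> j \<noteq> i \<or> x \<noteq> y \<Longrightarrow> poly (pderiv (?G i)) x = poly (pderiv (?G j)) y \<Longrightarrow>
      poly (intercept (?G i)) x = poly (intercept (?G j)) y \<Longrightarrow> poly (R j) x = 0"
    by metis
  define E where "E = {x. poly (pderiv (pderiv (?G i))) x = 0} \<union> (\<Union>j\<in>I. {x. poly (R j) x = 0})"
  define A where "A = {a. \<exists>x\<in>E. to_ac a = - poly (pderiv (?G i)) x}"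
  have finE: "finite E" unfolding E_def
    using fin poly_roots_finite[OF second'[OF i]] poly_roots_finite[OF R(1)] by blast
  have "card E \<le> card {x. poly (pderiv (pderiv (?G i))) x = 0} + (\<Sum>j\<in>I. card {x. poly (R j) x = 0})"
    unfolding E_def by (intro order_trans[OF card_Un_le] add_left_mono card_UN_le fin)
  also have "\<dots> \<le> n + (\<Sum>j\<in>I. n * (2 * n - 1))"
  proof (intro add_mono sum_mono)
    have "card {x. poly (pderiv (pderiv (?G i))) x = 0} \<le> degree (pderiv (pderiv (?G i)))"
      by (rule card_poly_roots_bound[OF second'[OF i]])
    also have "\<dots> \<le> n"
      using degree_pderiv_le[of "pderiv (?G i)"] degree_pderiv_le[of "?G i"] deg[OF i] by simp
    finally show "card {x. poly (pderiv (pderiv (?G i))) x = 0} \<le> n" .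
    fix j assume "j \<in> I"
    then show "card {x. poly (R j) x = 0} \<le> n * (2 * n - 1)"
      using card_poly_roots_bound[OF R(1)] R(2) order_trans by blast
  qed
  finally have cardE: "card E \<le> n + card I * (n * (2 * n - 1))" by simp
  show thesis
  proof (rule that[OF _ allI[OF impI]])
    have "A \<subseteq> (\<lambda>x. of_ac (- poly (pderiv (?G i)) x)) ` E"
      unfolding A_def by (auto intro!: image_eqI simp: of_ac_eqI)
    then have "card A \<le> card E" using finE card_image_le card_mono finite_imageI order_trans by meson
    then show "card A \<le> n + card I * (n * (2 * n - 1))" using cardE by linarith
    fix a assume a: "a \<notin> A"
    have d1: "ac_poly (pderiv (p + [:0, a:])) = pderiv (ac_poly p) + [:to_ac a:]" for p
      by (simp add: acp to_ac_poly_hom.hom_add to_ac_hom.map_poly_pCons_hom pderiv_add pderiv_pCons)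
    have d2: "ac_poly (pderiv (pderiv (p + [:0, a:]))) = pderiv (pderiv (ac_poly p))" for p
      unfolding acp[of "pderiv (p + [:0, a:])"] d1 by (simp add: pderiv_add pderiv_pCons)
    \<comment> \<open>At a critical point \<open>y\<close> of \<open>p + a X\<close> the derivative
      of \<open>p\<close> is \<open>- a\<close>, so the critical value is the intercept of the
      tangent line of \<open>p\<close> at \<open>y\<close>.\<close>
    have val: "poly (ac_poly (p + [:0, a:])) y = poly (intercept (ac_poly p)) y"
      if "poly (pderiv (ac_poly p) + [:to_ac a:]) y = 0" for p y
    proof -
      have "poly (pderiv (ac_poly p)) y = - to_ac a" using that by (simp add: eq_neg_iff_add_eq_0)
      then show ?thesis
        by (simp add: intercept_def to_ac_poly_hom.hom_add to_ac_hom.map_poly_pCons_hom)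
    qed
    \<comment> \<open>A nonzero second derivative makes \<open>pderiv (?G i)\<close> nonconstant, so
      a critical point exists in the closure; outside \<open>A\<close> any of them will do.\<close>
    have "degree (pderiv (?G i) + [:to_ac a:]) = degree (pderiv (?G i))"
      using degree_ge_1_of_pderiv[OF second'[OF i]] by (intro degree_add_eq_left) simp
    then have "degree (pderiv (?G i) + [:to_ac a:]) > 0"
      using degree_ge_1_of_pderiv[OF second'[OF i]] by simp
    then obtain x where x: "poly (pderiv (?G i) + [:to_ac a:]) x = 0"
      using alg_closed_imp_poly_has_root by blast
    then have "to_ac a = - poly (pderiv (?G i)) x" by (simp add: eq_neg_iff_add_eq_0 add.commute)
    then have xE: "x \<notin> E" using a by (auto simp: A_def)
    have "j = i \<and> y = x" if j: "j \<in> I" and y: "poly (pderiv (?G j) + [:to_ac a:]) y = 0"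
      and eq: "poly (intercept (?G j)) y = poly (intercept (?G i)) x" for j y
    proof (rule ccontr)
      assume "\<not> (j = i \<and> y = x)"
      then have ne: "j \<noteq> i \<or> x \<noteq> y" by blast
      have "poly (pderiv (?G i)) x = poly (pderiv (?G j)) y" using x y by (simp add: add_eq_0_iff2)
      then have "poly (R j) x = 0" using R(3)[OF j ne] eq by simp
      then show False using xE j by (auto simp: E_def)
    qed
    then show "\<exists>x. poly (ac_poly (pderiv (G i + [:0, a:]))) x = 0
      \<and> poly (ac_poly (pderiv (pderiv (G i + [:0, a:])))) x \<noteq> 0
      \<and> (\<forall>j\<in>I. \<forall>y. poly (ac_poly (pderiv (G j + [:0, a:]))) y = 0
          \<longrightarrow> poly (ac_poly (G j + [:0, a:])) y = poly (ac_poly (G i + [:0, a:])) x \<longrightarrow> j = i \<and> y = x)"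
      unfolding d1 d2 using x xE val by (intro exI[of _ x]) (auto simp: E_def)
  qed
qed

section \<open>Summation over all lines\<close>

theorem theorem1p1:
  fixes \<alpha> :: "nat \<Rightarrow> ('a::{field,finite}) poly"
    and \<epsilon> :: "nat \<Rightarrow> nat"
    and r n :: nat
  assumes q_odd: "odd CARD('a)"
    and r: "r > 1"
    and n: "n > 1"
    and distinct: "inj_on \<alpha> {1..r}"
    and deg: "Max ((\<lambda>j. degree (\<alpha> j)) ` {1..r}) < n"
    and eps: "\<And>j. j \<in> {1..r} \<Longrightarrow> \<epsilon> j \<in> {1, 2}"
    and not_all_2: "\<not> (\<forall>j\<in>{1..r}. \<epsilon> j = 2)"
  shows "real_of_int \<bar>\<Sum>F\<in>monic_polys n. \<Prod>j=1..r. poly_moebius (F + \<alpha> j) ^ \<epsilon> j\<bar>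
           \<le> 2 * real r * real n * real CARD('a) powr (real n - 1/2)
             + 3 * real r * (real n)^2 * real CARD('a) ^ (n - 1)"
proof -
  define q where "q = CARD('a)"
  have q0: "q > 0" by (simp add: q_def)
  define s where "s = sqrt (real q)"
  have s0: "s \<ge> 0" by (simp add: s_def)
  define I where "I = {j \<in> {1..r}. \<epsilon> j = 1}"
  define J where "J = {j \<in> {1..r}. \<epsilon> j = 2}"
  have fin: "finite I" "finite J" by (simp_all add: I_def J_def)
  have "\<forall>j\<in>{1..r}. \<epsilon> j = 1 \<or> \<epsilon> j = 2" using eps by blast
  then have IJ: "I \<union> J = {1..r}" unfolding I_def J_def by blast
  have disj: "I \<inter> J = {}" by (auto simp: I_def J_def)
  have cardIJ: "card I + card J = r" using card_Un_disjoint[OF fin disj] unfolding IJ by simp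
  obtain i where "i \<in> {1..r}" "\<epsilon> i \<noteq> 2" using not_all_2 by blast
  then have i: "i \<in> I" using eps[of i] by (simp add: I_def)
  have deg\<alpha>: "degree (\<alpha> j) < n" if "j \<in> {1..r}" for j
    using deg that r by (subst (asm) Max_less_iff) auto
  define T where "T F = (\<Prod>j=1..r. poly_moebius (F + \<alpha> j) ^ \<epsilon> j)" for F
  have T_le: "\<bar>T F\<bar> \<le> 1" for F
    unfolding T_def abs_prod
    by (intro prod_le_1 conjI) (auto simp: power_abs abs_poly_moebius_le intro!: power_le_one)
  have T_eq: "T F = (\<Prod>j\<in>I. poly_moebius (F + \<alpha> j)) * (\<Prod>j\<in>J. poly_moebius (F + \<alpha> j) ^ 2)" for F
    unfolding T_def IJ[symmetric] prod.union_disjoint[OF fin disj] by (simp add: I_def J_def)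
  define G where "G p j = monom 1 n + pCons 0 (pCons 0 p) + \<alpha> j" for p j
  define P where "P = (polys_below (n - 2) :: 'a poly set)"
  have finP: "finite P" unfolding P_def by (rule finite_polys_below)
  have cardP: "card P = q ^ (n - 2)" unfolding P_def q_def by (rule card_polys_below)
  define B where "B = (\<Union>j\<in>{1..r}. {p \<in> P. pderiv (pderiv (G p j)) = 0})"
  have cardB: "card B * q \<le> r * q ^ (n - 2)"
  proof -
    have "card B * q \<le> (\<Sum>j\<in>{1..r}. card {p \<in> P. pderiv (pderiv (G p j)) = 0}) * q"
      unfolding B_def by (intro mult_right_mono card_UN_le) auto
    also have "\<dots> \<le> (\<Sum>j\<in>{1..r}. q ^ (n - 2))"
      unfolding sum_distrib_right G_def P_def q_def
      using n deg\<alpha> by (intro sum_mono card_second_pderiv_eq_0[OF q_odd]) auto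
    finally show ?thesis by simp
  qed
  \<comment> \<open>\<open>L\<close> is the bound of \<open>moebius_line_bound\<close> for the sum
    over \<open>b\<close> at a good slope, and \<open>N\<close> the bound of
    \<open>card_bad_slopes\<close> for the number of bad slopes.\<close>
  define L where "L = 2 * (real (card I * (n - 1)) + 2) * s + real (card J * (n - 1))"
  define N where "N = n + card I * (n * (2 * n - 1))"
  have L0: "L \<ge> 0" using s0 by (simp add: L_def)
  define S where "S p a = (\<Sum>b\<in>UNIV. T (monom 1 n + pCons b (pCons a p)))" for p a
  have shift: "monom 1 n + pCons b (pCons a p) + \<alpha> j = (G p j + [:0, a:]) + [:b:]" for a b p j
  proof -
    have "pCons b (pCons a p) = pCons 0 (pCons 0 p) + [:0, a:] + [:b:]" by simp
    then show ?thesis unfolding G_def by (simp only: add_ac)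
  qed
  have S_triv: "\<bar>real_of_int (S p a)\<bar> \<le> real q" for p a
  proof -
    have "\<bar>S p a\<bar> \<le> (\<Sum>b\<in>(UNIV :: 'a set). 1)" unfolding S_def
      by (rule order_trans[OF sum_abs sum_mono]) (rule T_le)
    then have "\<bar>S p a\<bar> \<le> int q" by (simp add: q_def)
    then show ?thesis by linarith
  qed
  have G_deg: "degree (G p j) = n" and G_monic: "lead_coeff (G p j) = 1"
    if p: "p \<in> P" and j: "j \<in> {1..r}" for p j
  proof -
    have "monom 1 n + pCons 0 (pCons 0 p) \<in> monic_polys n"
      using p n unfolding P_def by (subst monic_polys_eq) (auto intro!: image_eqI[of _ _ "(p, 0, 0)"])
    then have m: "degree (monom 1 n + pCons 0 (pCons 0 p)) = n" "lead_coeff (monom 1 n + pCons 0 (pCons 0 p)) = 1"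
      by (auto simp: monic_polys_def)
    show d: "degree (G p j) = n"
      unfolding G_def using m deg\<alpha>[OF j] by (subst degree_add_eq_left) simp_all
    show "lead_coeff (G p j) = 1"
      unfolding d using m deg\<alpha>[OF j] by (simp only: G_def coeff_add) (simp add: coeff_eq_0)
  qed
  have n1: "n \<ge> 1" using n by simp
  have good: "(\<Sum>a\<in>UNIV. \<bar>real_of_int (S p a)\<bar>) \<le> real N * real q + real q * L" if p: "p \<in> P" "p \<notin> B" for p
  proof -
    have second: "pderiv (pderiv (G p j)) \<noteq> 0" if "j \<in> {1..r}" for j
      using p that by (auto simp: B_def)
    have sub: "I \<subseteq> {1..r}" "J \<subseteq> {1..r}" by (auto simp: I_def J_def)
    have inj: "inj_on (G p) I"
      using distinct sub by (auto simp: inj_on_def G_def)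
    have degI: "degree (G p j) \<le> n" if "j \<in> I" for j using G_deg[OF p(1)] that sub by auto
    have secI: "pderiv (pderiv (G p j)) \<noteq> 0" if "j \<in> I" for j using second that sub by auto
    obtain A where A: "card A \<le> N"
      "\<forall>a. a \<notin> A \<longrightarrow> (\<exists>x. poly (ac_poly (pderiv (G p i + [:0, a:]))) x = 0
        \<and> poly (ac_poly (pderiv (pderiv (G p i + [:0, a:])))) x \<noteq> 0
        \<and> (\<forall>j\<in>I. \<forall>y. poly (ac_poly (pderiv (G p j + [:0, a:]))) y = 0
          \<longrightarrow> poly (ac_poly (G p j + [:0, a:])) y = poly (ac_poly (G p i + [:0, a:])) x \<longrightarrow> j = i \<and> y = x))"
      by (rule card_bad_slopes[OF fin(1) i inj secI degI n1, folded N_def]; (rule that)?; assumption)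
    have goodS: "\<bar>real_of_int (S p a)\<bar> \<le> L" if a: "a \<notin> A" for a
    proof -
      obtain x where x: "poly (ac_poly (pderiv (G p i + [:0, a:]))) x = 0"
          "poly (ac_poly (pderiv (pderiv (G p i + [:0, a:])))) x \<noteq> 0"
        and uniq: "\<And>j y. j \<in> I \<Longrightarrow> poly (ac_poly (pderiv (G p j + [:0, a:]))) y = 0
          \<Longrightarrow> poly (ac_poly (G p j + [:0, a:])) y = poly (ac_poly (G p i + [:0, a:])) x \<Longrightarrow> j = i \<and> y = x"
        using A(2) a by blast
      have dG: "degree (G p j + [:0, a:]) = n" if "j \<in> I \<union> J" for j
        using G_deg[OF p(1), of j] that n unfolding IJ
        by (subst degree_add_eq_left) (auto intro: le_less_trans[OF degree_pCons_le])
      have mG: "lead_coeff (G p j + [:0, a:]) = 1" if "j \<in> I \<union> J" for j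
      proof -
        have "coeff [:0, a:] n = 0" using n by (cases n) (auto simp: coeff_pCons split: nat.splits)
        then show ?thesis
          using G_deg[OF p(1), of j] G_monic[OF p(1), of j] that dG[OF that] unfolding IJ by simp
      qed
      have pG: "pderiv (G p j + [:0, a:]) \<noteq> 0" if "j \<in> I \<union> J" for j
      proof
        assume "pderiv (G p j + [:0, a:]) = 0"
        then have "pderiv (pderiv (G p j + [:0, a:])) = 0" by simp
        then have "pderiv (pderiv (G p j)) = 0" by (simp add: pderiv_add pderiv_pCons)
        then show False using second that unfolding IJ by blast
      qed
      have S_eq: "S p a = (\<Sum>b\<in>UNIV. (\<Prod>j\<in>I. poly_moebius (G p j + [:0, a:] + [:b:]))
          * (\<Prod>j\<in>J. poly_moebius (G p j + [:0, a:] + [:b:]) ^ 2))"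
        unfolding S_def T_eq shift ..
      have "real_of_int \<bar>S p a\<bar> \<le> L"
        unfolding L_def s_def q_def S_eq
        by (rule moebius_line_bound[where F = "\<lambda>j. G p j + [:0, a:]" and i = i and x = x,
            OF q_odd fin mG dG n1 pG i x uniq])
      then show ?thesis by (simp only: of_int_abs)
    qed
    have "(\<Sum>a\<in>UNIV. \<bar>real_of_int (S p a)\<bar>) \<le> (\<Sum>a\<in>UNIV. (if a \<in> A then real q else 0) + L)"
    proof (rule sum_mono)
      fix a
      show "\<bar>real_of_int (S p a)\<bar> \<le> (if a \<in> A then real q else 0) + L"
        using S_triv[of p a] goodS[of a] L0 by (cases "a \<in> A") auto
    qed
    also have "\<dots> = (\<Sum>a\<in>UNIV. if a \<in> A then real q else 0) + (\<Sum>a\<in>(UNIV :: 'a set). L)"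
      by (rule sum.distrib)
    also have "(\<Sum>a\<in>UNIV. if a \<in> A then real q else 0) = real (card A) * real q"
      by (subst sum.If_cases) simp_all
    also have "(\<Sum>a\<in>(UNIV :: 'a set). L) = real q * L" by (simp add: q_def)
    also have "real (card A) * real q + real q * L \<le> real N * real q + real q * L"
      using A(1) by (intro add_right_mono mult_right_mono) auto
    finally show ?thesis .
  qed
  have bad: "(\<Sum>a\<in>UNIV. \<bar>real_of_int (S p a)\<bar>) \<le> real q * real q" for p
  proof -
    have "(\<Sum>a\<in>UNIV. \<bar>real_of_int (S p a)\<bar>) \<le> (\<Sum>a\<in>(UNIV :: 'a set). real q)"
      by (rule sum_mono) (rule S_triv)
    then show ?thesis by (simp add: q_def)
  qed
  have M0: "real N * real q + real q * L \<ge> 0" using L0 by simp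
  have "(\<Sum>F\<in>monic_polys n. T F) = (\<Sum>p\<in>P. \<Sum>a\<in>UNIV. S p a)"
    unfolding S_def P_def using n by (intro sum_monic_polys) simp
  then have "real_of_int \<bar>\<Sum>F\<in>monic_polys n. T F\<bar> = \<bar>\<Sum>p\<in>P. \<Sum>a\<in>UNIV. real_of_int (S p a)\<bar>" by simp
  also have "\<dots> \<le> (\<Sum>p\<in>P. \<Sum>a\<in>UNIV. \<bar>real_of_int (S p a)\<bar>)"
    by (rule order_trans[OF sum_abs sum_mono]) (rule sum_abs)
  also have "\<dots> \<le> (\<Sum>p\<in>P. (if p \<in> B then real q * real q else 0) + (real N * real q + real q * L))"
  proof (rule sum_mono)
    fix p assume "p \<in> P"
    then show "(\<Sum>a\<in>UNIV. \<bar>real_of_int (S p a)\<bar>)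
        \<le> (if p \<in> B then real q * real q else 0) + (real N * real q + real q * L)"
      using bad[of p] good[of p] M0 by (cases "p \<in> B") auto
  qed
  also have "\<dots> = real (card B * q) * real q + real (q ^ (n - 2)) * (real N * real q + real q * L)"
  proof -
    have "P \<inter> B = B" by (auto simp: B_def)
    then show ?thesis using finP by (simp add: sum.distrib sum.If_cases cardP)
  qed
  also have "\<dots> \<le> real (r * q ^ (n - 2)) * real q + real (q ^ (n - 2)) * (real N * real q + real q * L)"
    using cardB by (intro add_right_mono mult_right_mono) (simp_all only: of_nat_le_iff of_nat_0_le_iff)
  \<comment> \<open>The three terms come from the exceptional \<open>p\<close>, where
    \<open>q * q\<close> pairs of coefficients are estimated trivially, from the bad slopes, and
    from the good ones.\<close>
  also have "\<dots> = real q ^ (n - 1) * (real r + real N + L)"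
  proof -
    have "n - 1 = Suc (n - 2)" using n by simp
    then show ?thesis by (simp add: algebra_simps)
  qed
  also have "\<dots> \<le> real q ^ (n - 1) * (2 * real r * real n * s + 3 * real r * (real n)\<^sup>2)"
  proof (rule mult_left_mono)
    \<comment> \<open>The 2 lost in the character sum is absorbed because \<open>r\<close> is at
      least 2.\<close>
    have "card I * (n - 1) + 2 \<le> r * n"
    proof -
      have "card I * (n - 1) \<le> r * (n - 1)" using cardIJ by (intro mult_right_mono) auto
      moreover have "r * n = r * (n - 1) + r" using n by (simp add: diff_mult_distrib2)
      ultimately show ?thesis using r by linarith
    qed
    then have "real (card I * (n - 1) + 2) \<le> real (r * n)" by (simp only: of_nat_le_iff)
    then have 1: "2 * (real (card I * (n - 1)) + 2) * s \<le> 2 * real r * real n * s"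
      using s0 by (intro mult_right_mono) simp_all
    \<comment> \<open>Enlarging the term for \<open>J\<close> to the shape of the one for
      \<open>I\<close> lets \<open>card I + card J = r\<close> apply; \<open>r + n\<close> is at
      most \<open>r * n\<close>, as both are at least 2.\<close>
    have "r + N + card J * (n - 1) \<le> 3 * r * n\<^sup>2"
    proof -
      have nn: "n * (2 * n - 1) + n = 2 * n * n" using n by (cases n) (auto simp: algebra_simps)
      have "card J * (n - 1) \<le> card J * (n * (2 * n - 1))"
        using nn n by (intro mult_le_mono2) (cases n, auto)
      then have "r + N + card J * (n - 1) \<le> r + n + (card I + card J) * (n * (2 * n - 1))"
        by (simp add: N_def add_mult_distrib)
      also have "\<dots> = r + n + r * (n * (2 * n - 1))" by (simp add: cardIJ)
      also have "\<dots> \<le> r * (n * n) + r * (2 * n * n)"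
      proof -
        define K M where "K = r * (n * (2 * n - 1))" and "M = r * (2 * n * n)"
        have "2 * r \<le> n * r" "2 * n \<le> r * n" using n r by (auto intro: mult_right_mono)
        then have "2 * r \<le> r * n" "2 * n \<le> r * n" by (simp_all only: mult.commute)
        moreover have "K + r * n = M"
          unfolding K_def M_def nn[symmetric] by (rule add_mult_distrib2[symmetric])
        ultimately have "r + n + K \<le> r * (n * n) + M" by linarith
        then show ?thesis by (simp only: K_def M_def)
      qed
      also have "\<dots> = 3 * r * n\<^sup>2" by (simp add: power2_eq_square)
      finally show ?thesis .
    qed
    then have "real (r + N + card J * (n - 1)) \<le> real (3 * r * n\<^sup>2)" by (simp only: of_nat_le_iff)
    then have 2: "real r + real N + real (card J * (n - 1)) \<le> 3 * real r * (real n)\<^sup>2" by simp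
    show "real r + real N + L \<le> 2 * real r * real n * s + 3 * real r * (real n)\<^sup>2"
      using 1 2 unfolding L_def by linarith
  qed simp
  also have "\<dots> = 2 * real r * real n * (real q ^ (n - 1) * s) + 3 * real r * (real n)\<^sup>2 * real q ^ (n - 1)"
    by (simp add: algebra_simps)
  also have "real q ^ (n - 1) * s = real q powr (real n - 1 / 2)"
  proof -
    have "real q ^ (n - 1) * s = real q powr (real (n - 1)) * real q powr (1 / 2)"
      using q0 by (simp add: s_def powr_realpow powr_half_sqrt)
    also have "\<dots> = real q powr (real (n - 1) + 1 / 2)" by (rule powr_add[symmetric])
    also have "real (n - 1) + 1 / 2 = real n - 1 / 2" using n by (simp add: of_nat_diff)
    finally show ?thesis .
  qed
  finally show ?thesis unfolding T_def q_def .
qed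

end
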